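(* Let $\Omega\subset\mathbb{R}^2$ be a bounded domain and let $u$ be a (nonzero, real-valued) Dirichlet eigenfunction, $-\Delta u=\lambda u$ in $\Omega$, $u|_{\partial\Omega}=0$, that extends real-analytically to an open neighbourhood of $\overline\Omega$. Then twice the number of Neumann domains of $u$ is greater than or equal to the number of nodal domains of $u$.
   Context: The nodal set of $u$ is $\mathcal{D}(u)=\overline{\{x\in\Omega:u(x)=0\}}$, and the nodal domains of $u$ are the connected components of $\Omega\setminus\mathcal{D}(u)$. Put $\Gamma^D=\partial\Omega$. Local maxima/minima are understood in the non-strict sense; for points of $\partial\Omega$ they are understood for the analytic extension of $u$. Put $\mathcal{C}=\{x\in\overline\Omega:\operatorname{grad}u(x)=0\}$; let $\mathcal{M}_+$, $\mathcal{M}_-$ be the sets of points of $\mathcal{C}$ that are local maxima, resp. local minima, of $u$, and let $\mathcal{S}=\mathcal{C}\setminus(\mathcal{M}_+\cup\mathcal{M}_-)$ be the set of saddle points (possibly degenerate). For $x\in\overline\Omega$ let $\gamma_x(t)$ be the integral curve of the vector field $-\operatorname{grad}u$ with $\gamma_x(0)=x$, followed forward and backward as long as it stays in $\overline\Omega$. It is known that in each time direction, for $x\in\Omega$, the curve either reaches $\Gamma^D$ in finite time or tends to a point of $\mathcal{C}$ as $t\to\pm\infty$; in the latter case the limit is denoted $\gamma_x(\pm\infty)$. For $x_0\in\mathcal{C}$ put $W^s(x_0)=\{x\in\overline\Omega:\gamma_x(+\infty)=x_0\}$, $W^u(x_0)=\{x\in\overline\Omega:\gamma_x(-\infty)=x_0\}$,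 and for $r\in\mathcal{S}$ put $L(r)=W^s(r)\cup W^u(r)$. The Neumann line set is $$\mathcal{N}(u)=\overline{\bigcup_{r\in\mathcal{S}}\partial L(r)\setminus\Gamma^D}\,\cup\,\mathcal{C},$$ with boundary and closure taken in $\mathbb{R}^2$. The Neumann domains of $u$ are the connected components of $\Omega\setminus\mathcal{N}(u)$. *)

theory Defs
  imports "HOL-Analysis.Analysis" "HOL-Library.Extended_Nat"
begin

definition real_analytic_on :: "(real^2 \<Rightarrow> real) \<Rightarrow> (real^2) set \<Rightarrow> bool" where
  "real_analytic_on f S \<longleftrightarrow>
     (\<forall>p\<in>S. \<exists>r>0. \<exists>a :: nat \<Rightarrow> nat \<Rightarrow> real. \<forall>x\<in>ball p r.
        ((\<lambda>(i, j). a i j * (x $ 1 - p $ 1) ^ i * (x $ 2 - p $ 2) ^ j) has_sum f x) UNIV)"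

definition partial_deriv :: "2 \<Rightarrow> (real^2 \<Rightarrow> real) \<Rightarrow> real^2 \<Rightarrow> real" where
  "partial_deriv i f x = frechet_derivative f (at x) (axis i 1)"

definition grad :: "(real^2 \<Rightarrow> real) \<Rightarrow> real^2 \<Rightarrow> real^2" where
  "grad f x = (\<chi> i. partial_deriv i f x)"

definition laplacian :: "(real^2 \<Rightarrow> real) \<Rightarrow> real^2 \<Rightarrow> real" where
  "laplacian f x = (\<Sum>i\<in>UNIV. partial_deriv i (partial_deriv i f) x)"

text \<open>
  Below, \<open>u\<close> is a total function that stands both for the function on the closure of \<open>\<Omega>\<close>
  and for its real-analytic extension to a neighbourhood of it.  The germ of the extension at a
  boundary point is determined by the values in \<open>\<Omega>\<close>, so gradients and local extrema on the
  boundary do not depend on the extension.  As \<open>partial_deriv\<close> is meaningful only at points of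
  differentiability, the eigenvalue equation is to be read together with \<open>real_analytic_on\<close>.
\<close>

definition dirichlet_eigenfunction :: "(real^2) set \<Rightarrow> real \<Rightarrow> (real^2 \<Rightarrow> real) \<Rightarrow> bool" where
  "dirichlet_eigenfunction \<Omega> ev u \<longleftrightarrow>
     (\<exists>x\<in>\<Omega>. u x \<noteq> 0) \<and>
     (\<forall>x\<in>\<Omega>. - laplacian u x = ev * u x) \<and>
     (\<forall>x\<in>frontier \<Omega>. u x = 0)"

definition nodal_set :: "(real^2) set \<Rightarrow> (real^2 \<Rightarrow> real) \<Rightarrow> (real^2) set" where
  "nodal_set \<Omega> u = closure {x \<in> \<Omega>. u x = 0}"

definition nodal_domains :: "(real^2) set \<Rightarrow> (real^2 \<Rightarrow> real) \<Rightarrow> (real^2) set set" where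
  "nodal_domains \<Omega> u = components (\<Omega> - nodal_set \<Omega> u)"

definition critical_points :: "(real^2) set \<Rightarrow> (real^2 \<Rightarrow> real) \<Rightarrow> (real^2) set" where
  "critical_points \<Omega> u = {x \<in> closure \<Omega>. grad u x = 0}"

definition maximum_points :: "(real^2) set \<Rightarrow> (real^2 \<Rightarrow> real) \<Rightarrow> (real^2) set" where
  "maximum_points \<Omega> u = {x \<in> critical_points \<Omega> u. \<forall>\<^sub>F y in nhds x. u y \<le> u x}"

definition minimum_points :: "(real^2) set \<Rightarrow> (real^2 \<Rightarrow> real) \<Rightarrow> (real^2) set" where
  "minimum_points \<Omega> u = {x \<in> critical_points \<Omega> u. \<forall>\<^sub>F y in nhds x. u x \<le> u y}"

definition saddle_points :: "(real^2) set \<Rightarrow> (real^2 \<Rightarrow> real) \<Rightarrow> (real^2) set" where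
  "saddle_points \<Omega> u = critical_points \<Omega> u - (maximum_points \<Omega> u \<union> minimum_points \<Omega> u)"

text \<open>
  \<open>gradient_curve \<Omega> u T x \<gamma>\<close>: on the time interval \<open>T\<close> (containing 0), \<open>\<gamma>\<close> is the integral curve
  of \<open>- grad u\<close> through \<open>x\<close>, and it stays in the closure of \<open>\<Omega>\<close>.  For real-analytic \<open>u\<close> the
  restriction of \<open>\<gamma>\<close> to \<open>T\<close> is unique, so the existential quantifiers over \<open>\<gamma>\<close> in the stable
  and unstable sets refer to the integral curve through \<open>x\<close>; the half-line \<open>T\<close> expresses that
  the curve never leaves the closure of \<open>\<Omega>\<close> in that time direction.
\<close>

definition gradient_curve ::
    "(real^2) set \<Rightarrow> (real^2 \<Rightarrow> real) \<Rightarrow> real set \<Rightarrow> real^2 \<Rightarrow> (real \<Rightarrow> real^2) \<Rightarrow> bool" where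
  "gradient_curve \<Omega> u T x \<gamma> \<longleftrightarrow>
     \<gamma> 0 = x \<and>
     (\<forall>t\<in>T. \<gamma> t \<in> closure \<Omega> \<and> (\<gamma> has_vector_derivative - grad u (\<gamma> t)) (at t within T))"

definition stable_set :: "(real^2) set \<Rightarrow> (real^2 \<Rightarrow> real) \<Rightarrow> real^2 \<Rightarrow> (real^2) set" where
  "stable_set \<Omega> u x0 =
     {x \<in> closure \<Omega>. \<exists>\<gamma>. gradient_curve \<Omega> u {0..} x \<gamma> \<and> (\<gamma> \<longlongrightarrow> x0) at_top}"

definition unstable_set :: "(real^2) set \<Rightarrow> (real^2 \<Rightarrow> real) \<Rightarrow> real^2 \<Rightarrow> (real^2) set" where
  "unstable_set \<Omega> u x0 =
     {x \<in> closure \<Omega>. \<exists>\<gamma>. gradient_curve \<Omega> u {..0} x \<gamma> \<and> (\<gamma> \<longlongrightarrow> x0) at_bot}"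

definition saddle_lines :: "(real^2) set \<Rightarrow> (real^2 \<Rightarrow> real) \<Rightarrow> real^2 \<Rightarrow> (real^2) set" where
  "saddle_lines \<Omega> u r = stable_set \<Omega> u r \<union> unstable_set \<Omega> u r"

definition neumann_line_set :: "(real^2) set \<Rightarrow> (real^2 \<Rightarrow> real) \<Rightarrow> (real^2) set" where
  "neumann_line_set \<Omega> u =
     closure ((\<Union>r\<in>saddle_points \<Omega> u. frontier (saddle_lines \<Omega> u r)) - frontier \<Omega>)
       \<union> critical_points \<Omega> u"

definition neumann_domains :: "(real^2) set \<Rightarrow> (real^2 \<Rightarrow> real) \<Rightarrow> (real^2) set set" where
  "neumann_domains \<Omega> u = components (\<Omega> - neumann_line_set \<Omega> u)"

text \<open>Unlike \<open>card\<close>, this does not assign 0 to infinite sets.\<close>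

definition number_of :: "'a set \<Rightarrow> enat" where
  "number_of A = (if finite A then enat (card A) else \<infinity>)"

end

theory Submission
  imports Defs "HOL-Complex_Analysis.Conformal_Mappings"
begin

text \<open>
  It suffices that (a) every nodal domain meets a Neumann domain, and (b) a Neumann domain meets at
  most one nodal domain of each sign.  Replacing \<open>u\<close> by \<open>- u\<close> reverses the flow, so only the forward
  flow of \<open>- grad u\<close> and, in (b), only negative nodal domains have to be treated.

  The flow of a cut-off of \<open>- grad u\<close> exists for all times, and \<open>u\<close> strictly decreases along it.  A
  trajectory that starts in \<open>\<Omega>\<close> leaves the closure of \<open>\<Omega>\<close>, or enters a negative nodal domain and
  remains there, or remains in the closure with \<open>u \<ge> 0\<close>.  The first two are open conditions.  In the
  last case the trajectory converges to a saddle \<open>r\<close> with \<open>u r \<ge> 0\<close>: at critical zeros the leading Taylor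
  form is harmonic, so they are isolated saddles; at critical points with \<open>u > 0\<close> the Laplacian is
  negative, so they are no local minima, and they are isolated unless \<open>u\<close> attains a local maximum
  there, which a descending trajectory cannot approach.  If this happens for one point of a Neumann
  domain, the whole domain lies in \<open>L(r)\<close>, on which \<open>u \<noteq> u r\<close>, hence in \<open>u > u r \<ge> 0\<close>.
  Otherwise its points all have the same fate by connectedness.  This gives (b).

  For (a), a limit point that is not a saddle is either a strict local minimum or the bottom of a
  valley, where \<open>u - u q\<close> is bounded by the squared gradient; both confine all nearby
  trajectories.  So where the stable sets of saddles are dense, they cover everything; there are countably
  many saddles, and by the Baire category theorem one stable set has interior points.  Applied to
  \<open>u\<close> and \<open>- u\<close>, this yields open subsets of every nodal domain that miss the boundary of every \<open>L(r)\<close>.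
\<close>

section \<open>Double power series\<close>

text \<open>Only the frontier of each \<open>L(r)\<close> enters the Neumann line set, and a set
  that is dense in an open set but has no interior there has all of that open set in its frontier.
  This is the obstacle in (a): a priori a nodal domain could be filled with Neumann lines. Nothing
  is known about the shape of stable sets, so a category argument takes the place of geometry.
  Critical points may be degenerate or fill arcs, yet no general Lojasiewicz inequality is invoked.
  Where \<open>u\<close> is nonzero in the domain, so is the Laplacian, hence some pure second
  derivative; this alone makes a valley or ridge out of accumulating critical points. At isolated
  critical points a compactness argument gives convergence. The boundary is arbitrary and
  trajectories may cross it. As \<open>u\<close> vanishes there and strictly decreases along the
  flow, a trajectory from a regular point meets the boundary at most once. Coefficients are real,
  but the arguments of \<open>dps\<close> range over any complete normed field: the identity theorem
  and the implicit function theorem are applied to the same series at complex arguments.\<close>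

definition dps :: "(nat \<Rightarrow> nat \<Rightarrow> real) \<Rightarrow> 'a::{real_normed_field,banach} \<Rightarrow> 'a \<Rightarrow> 'a" where
  "dps a z w = (\<Sum>\<^sub>\<infinity>(i, j)\<in>UNIV. of_real (a i j) * z ^ i * w ^ j)"

text \<open>Absolute summability at the corner of the closed bidisc of radius \<rho>. It dominates
  the series at all arguments of modulus at most \<rho>, boundary included.\<close>

definition dps_conv :: "(nat \<Rightarrow> nat \<Rightarrow> real) \<Rightarrow> real \<Rightarrow> bool" where
  "dps_conv a \<rho> \<longleftrightarrow> 0 < \<rho> \<and> (\<lambda>(i, j). \<bar>a i j\<bar> * \<rho> ^ (i + j)) summable_on UNIV"

definition dps_dx :: "(nat \<Rightarrow> nat \<Rightarrow> real) \<Rightarrow> nat \<Rightarrow> nat \<Rightarrow> real" where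
  "dps_dx a i j = real (Suc i) * a (Suc i) j"

definition dps_dy :: "(nat \<Rightarrow> nat \<Rightarrow> real) \<Rightarrow> nat \<Rightarrow> nat \<Rightarrow> real" where
  "dps_dy a i j = real (Suc j) * a i (Suc j)"

lemma dps_term_le:
  fixes z w :: "'a::{real_normed_field,banach}"
  assumes "norm z \<le> \<rho>" "norm w \<le> \<rho>"
  shows "norm (of_real c * z ^ i * w ^ j) \<le> \<bar>c\<bar> * \<rho> ^ (i + j)"
proof -
  have "norm (z ^ i * w ^ j) \<le> \<rho> ^ i * \<rho> ^ j"
    unfolding norm_mult norm_power using assms order_trans[OF norm_ge_zero assms(1)]
    by (intro mult_mono power_mono) auto
  then have "\<bar>c\<bar> * norm (z ^ i * w ^ j) \<le> \<bar>c\<bar> * \<rho> ^ (i + j)"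
    by (intro mult_left_mono) (auto simp: power_add)
  then show ?thesis by (simp add: norm_mult mult.assoc)
qed

lemma dps_abs_summable:
  fixes z w :: "'a::{real_normed_field,banach}"
  assumes "dps_conv a \<rho>" "norm z \<le> \<rho>" "norm w \<le> \<rho>"
  shows "(\<lambda>(i, j). norm (of_real (a i j) * z ^ i * w ^ j)) summable_on UNIV"
proof (rule summable_on_comparison_test)
  show "(\<lambda>(i, j). \<bar>a i j\<bar> * \<rho> ^ (i + j)) summable_on UNIV"
    using assms by (simp add: dps_conv_def)
qed (use dps_term_le[OF assms(2,3)] in auto)

lemma dps_has_sum:
  fixes z w :: "'a::{real_normed_field,banach}"
  assumes "dps_conv a \<rho>" "norm z \<le> \<rho>" "norm w \<le> \<rho>"
  shows "((\<lambda>(i, j). of_real (a i j) * z ^ i * w ^ j) has_sum dps a z w) UNIV"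
proof -
  have "(\<lambda>(i, j). of_real (a i j) * z ^ i * w ^ j) summable_on UNIV"
    by (rule abs_summable_summable) (use dps_abs_summable[OF assms] in \<open>simp add: case_prod_unfold\<close>)
  then show ?thesis
    unfolding dps_def by (rule has_sum_infsum)
qed

lemma dps_conv_mono:
  assumes "dps_conv a \<rho>" "0 < \<sigma>" "\<sigma> \<le> \<rho>"
  shows "dps_conv a \<sigma>"
  unfolding dps_conv_def
proof
  show "(\<lambda>(i, j). \<bar>a i j\<bar> * \<sigma> ^ (i + j)) summable_on UNIV"
  proof (rule summable_on_comparison_test)
    show "(\<lambda>(i, j). \<bar>a i j\<bar> * \<rho> ^ (i + j)) summable_on UNIV"
      using assms by (simp add: dps_conv_def)
  qed (use assms in \<open>auto intro!: mult_left_mono power_mono\<close>)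
qed fact

text \<open>Serves the index shift from \<open>(i, j)\<close> to \<open>(Suc i, j)\<close>: the
  differentiated series has no contribution from row 0, which is exactly what the shift
  misses.\<close>

lemma has_sum_inj_extend:
  assumes "((\<lambda>x. g (h x)) has_sum s) UNIV" "inj h" "\<And>y. y \<notin> range h \<Longrightarrow> g y = 0"
  shows "(g has_sum s) UNIV"
proof -
  have "(g has_sum s) (range h)"
    using assms(1) has_sum_reindex[OF assms(2), of g s] by (simp add: o_def)
  then show ?thesis
    using assms(3) by (subst has_sum_cong_neutral[where T="range h" and g=g]) auto
qed

lemma summable_on_inj_range:
  fixes g :: "'b \<Rightarrow> 'c::banach"
  assumes "g summable_on UNIV" "inj h"
  shows "(\<lambda>x. g (h x)) summable_on UNIV"
proof -
  have "g summable_on (range h)"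
    using assms(1) by (rule summable_on_subset_banach) auto
  then show ?thesis
    using summable_on_reindex[OF assms(2), of g] by (simp add: o_def)
qed

lemma dps_conv_swap: "dps_conv (\<lambda>i j. a j i) \<rho> \<longleftrightarrow> dps_conv a \<rho>"
proof -
  have "dps_conv (\<lambda>i j. a j i) \<rho>" if "dps_conv a \<rho>" for a
    unfolding dps_conv_def
    using that summable_on_inj_range[of "\<lambda>(i, j). \<bar>a i j\<bar> * \<rho> ^ (i + j)" prod.swap]
    by (auto simp: dps_conv_def case_prod_unfold add.commute)
  from this[of a] this[of "\<lambda>i j. a j i"] show ?thesis by auto
qed

lemma dps_swap:
  fixes z w :: "'a::{real_normed_field,banach}"
  shows "dps (\<lambda>i j. a j i) w z = dps a z w"
  unfolding dps_def
  by (rule infsum_reindex_bij_witness[of _ prod.swap prod.swap]) (auto simp: mult.assoc mult.commute)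

lemma dps_dy_swap: "dps_dy a = (\<lambda>i j. dps_dx (\<lambda>i j. a j i) j i)"
  by (auto simp: dps_dx_def dps_dy_def fun_eq_iff)

text \<open>The factor \<open>Suc i\<close> is absorbed by the smaller radius, since
  \<open>n * q ^ n\<close> is bounded for \<open>q = \<sigma> / \<rho> < 1\<close>.\<close>

lemma dps_conv_dx:
  assumes a: "dps_conv a \<rho>" and \<sigma>: "0 < \<sigma>" "\<sigma> < \<rho>"
  shows "dps_conv (dps_dx a) \<sigma>"
proof -
  have "(\<lambda>n. real n * (\<sigma> / \<rho>) ^ n) \<longlonglongrightarrow> 0"
    using \<sigma> powser_times_n_limit_0[of "\<sigma> / \<rho>"] by simp
  then obtain M where M: "\<And>n. \<bar>real n * (\<sigma> / \<rho>) ^ n\<bar> \<le> M"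
    by (metis convergentI convergent_imp_Bseq BseqE real_norm_def)
  have le: "real (Suc i) * \<sigma> ^ (i + j) \<le> M / \<sigma> * \<rho> ^ (Suc i + j)" for i j
  proof -
    have "real (Suc i) * \<sigma> ^ Suc i \<le> M * \<rho> ^ Suc i"
      using M[of "Suc i"] \<sigma> by (simp add: power_divide field_simps del: power_Suc)
    then have "real (Suc i) * \<sigma> ^ Suc i * \<sigma> ^ j \<le> M * \<rho> ^ Suc i * \<rho> ^ j"
      using \<sigma> M[of 0] by (rule_tac mult_mono) (auto intro: power_mono)
    then have "(real (Suc i) * \<sigma> ^ Suc i * \<sigma> ^ j) / \<sigma> \<le> (M * \<rho> ^ Suc i * \<rho> ^ j) / \<sigma>"
      using \<sigma> by (intro divide_right_mono) auto
    then show ?thesis using \<sigma> by (simp add: power_add)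
  qed
  have "(\<lambda>(i, j). \<bar>a i j\<bar> * \<rho> ^ (i + j)) summable_on UNIV" using a by (simp add: dps_conv_def)
  from summable_on_inj_range[OF this, of "\<lambda>(i, j). (Suc i, j)"]
  have "(\<lambda>(i, j). \<bar>a (Suc i) j\<bar> * \<rho> ^ (Suc i + j)) summable_on UNIV"
    by (simp add: inj_on_def case_prod_unfold)
  then have "(\<lambda>p. M / \<sigma> * (case p of (i, j) \<Rightarrow> \<bar>a (Suc i) j\<bar> * \<rho> ^ (Suc i + j))) summable_on UNIV"
    by (rule summable_on_cmult_right)
  then have "(\<lambda>(i, j). \<bar>dps_dx a i j\<bar> * \<sigma> ^ (i + j)) summable_on UNIV"
  proof (rule summable_on_comparison_test)
    fix p :: "nat \<times> nat"
    obtain i j where p: "p = (i, j)" by force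
    have "\<bar>a (Suc i) j\<bar> * (real (Suc i) * \<sigma> ^ (i + j)) \<le> \<bar>a (Suc i) j\<bar> * (M / \<sigma> * \<rho> ^ (Suc i + j))"
      by (intro mult_left_mono le) auto
    then show "(case p of (i, j) \<Rightarrow> \<bar>dps_dx a i j\<bar> * \<sigma> ^ (i + j))
        \<le> M / \<sigma> * (case p of (i, j) \<Rightarrow> \<bar>a (Suc i) j\<bar> * \<rho> ^ (Suc i + j))"
      by (simp add: p dps_dx_def abs_mult mult_ac)
  qed (use \<sigma> in auto)
  then show ?thesis using \<sigma> by (simp add: dps_conv_def)
qed

lemma dps_conv_dy:
  assumes "dps_conv a \<rho>" "0 < \<sigma>" "\<sigma> < \<rho>"
  shows "dps_conv (dps_dy a) \<sigma>"
proof -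
  have "dps_conv (dps_dx (\<lambda>i j. a j i)) \<sigma>"
    using dps_conv_dx[OF iffD2[OF dps_conv_swap, OF assms(1)] assms(2,3)] .
  then have "dps_conv (\<lambda>i j. dps_dx (\<lambda>i j. a j i) j i) \<sigma>" by (rule iffD2[OF dps_conv_swap])
  then show ?thesis by (simp add: dps_dy_swap)
qed

text \<open>M-test along an enumeration \<open>e\<close> of the index pairs. The terms keep the
  indexing in which termwise differentiation produces them. The enumeration is arbitrary so that
  composing it with \<open>prod.swap\<close> handles the other variable.\<close>

lemma dps_dx_uniform_limit:
  fixes S :: "('a::{real_normed_field,banach} \<times> 'a) set"
    and e :: "nat \<Rightarrow> nat \<times> nat"
  assumes bij: "bij e" and a: "dps_conv a \<rho>" and S: "\<And>z w. (z, w) \<in> S \<Longrightarrow> norm z \<le> \<sigma> \<and> norm w \<le> \<sigma>"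
    and \<sigma>: "0 < \<sigma>" "\<sigma> < \<rho>"
  shows "uniform_limit S
      (\<lambda>n p. \<Sum>k<n. case e k of (i, j) \<Rightarrow> of_real (a i j) * (of_nat i * fst p ^ (i - 1)) * snd p ^ j)
      (\<lambda>p. dps (dps_dx a) (fst p) (snd p)) sequentially"
proof -
  let ?f = "\<lambda>p::'a\<times>'a. \<lambda>(i, j). of_real (a i j) * (of_nat i * fst p ^ (i - 1)) * snd p ^ j"
  let ?M = "\<lambda>(i, j). \<bar>a i j\<bar> * (real i * \<sigma> ^ (i - 1)) * \<sigma> ^ j"
  have cv: "dps_conv (dps_dx a) \<sigma>" using dps_conv_dx[OF a \<sigma>] .
  have hs: "(?f p has_sum dps (dps_dx a) (fst p) (snd p)) UNIV" if "p \<in> S" for p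
  proof (rule has_sum_inj_extend[where h="\<lambda>(i, j). (Suc i, j)"])
    have "norm (fst p) \<le> \<sigma>" "norm (snd p) \<le> \<sigma>" using S[of "fst p" "snd p"] that by auto
    from dps_has_sum[OF cv this]
    show "((\<lambda>x. ?f p (case x of (i, j) \<Rightarrow> (Suc i, j))) has_sum dps (dps_dx a) (fst p) (snd p)) UNIV"
      by (simp add: case_prod_unfold dps_dx_def mult_ac)
    \<comment> \<open>For \<open>i = 0\<close> the truncated exponent \<open>i - 1\<close> is 0 as
      well, but the factor \<open>of_nat i\<close> removes the term.\<close>
    show "?f p y = 0" if "y \<notin> range (\<lambda>(i, j). (Suc i, j))" for y
    proof -
      obtain i j where y: "y = (i, j)" by force
      have "i = 0" using that y by (cases i) (auto simp: image_iff)
      then show ?thesis by (simp add: y)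
    qed
  qed (auto simp: inj_on_def)
  have ms: "?M summable_on UNIV"
  proof -
    have "((\<lambda>x. ?M (case x of (i, j) \<Rightarrow> (Suc i, j))) has_sum
        infsum (\<lambda>(i, j). \<bar>dps_dx a i j\<bar> * \<sigma> ^ (i + j)) UNIV) UNIV"
      using cv \<sigma> by (auto simp: dps_conv_def case_prod_unfold dps_dx_def abs_mult power_add mult_ac)
    then have "(?M has_sum infsum (\<lambda>(i, j). \<bar>dps_dx a i j\<bar> * \<sigma> ^ (i + j)) UNIV) UNIV"
    proof (rule has_sum_inj_extend)
      show "?M y = 0" if "y \<notin> range (\<lambda>(i, j). (Suc i, j))" for y
      proof -
        obtain i j where y: "y = (i, j)" by force
        have "i = 0" using that y by (cases i) (auto simp: image_iff)
        then show ?thesis by (simp add: y)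
      qed
    qed (auto simp: inj_on_def)
    then show ?thesis by (rule has_sum_imp_summable)
  qed
  have "summable (\<lambda>k. ?M (e k))"
    using summable_on_inj_range[OF ms, of e] bij
    by (intro summable_on_imp_summable) (auto simp: bij_def)
  then have "uniform_limit S (\<lambda>n p. \<Sum>k<n. ?f p (e k)) (\<lambda>p. suminf (\<lambda>k. ?f p (e k)))
      sequentially"
  proof (rule Weierstrass_m_test[rotated])
    fix k p assume "p \<in> S"
    then have p: "norm (fst p) \<le> \<sigma>" "norm (snd p) \<le> \<sigma>" using S[of "fst p" "snd p"] by auto
    obtain i j where k: "e k = (i, j)" by force
    have "norm (of_real (a i j * real i) * fst p ^ (i - 1) * snd p ^ j) \<le> \<bar>a i j * real i\<bar> * \<sigma> ^ (i - 1 + j)"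
      by (rule dps_term_le) fact+
    then show "norm (?f p (e k)) \<le> ?M (e k)"
      by (simp add: k abs_mult power_add mult_ac)
  qed
  moreover have "suminf (\<lambda>k. ?f p (e k)) = dps (dps_dx a) (fst p) (snd p)" if "p \<in> S" for p
  proof -
    have "((\<lambda>k. ?f p (e k)) has_sum dps (dps_dx a) (fst p) (snd p)) UNIV"
      using hs[OF that] has_sum_reindex_bij_betw[OF bij, of "?f p"] by simp
    then show ?thesis by (intro sums_unique[symmetric] has_sum_imp_sums)
  qed
  ultimately show ?thesis
    using uniform_limit_cong' by (metis (no_types, lifting))
qed

text \<open>Termwise differentiation: the partial sums converge at the given point and their
  derivatives converge uniformly on a convex open neighbourhood.\<close>

lemma dps_has_derivative:
  fixes z w :: "'a::{real_normed_field,banach}"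
  assumes a: "dps_conv a \<rho>" and zw: "norm z < \<rho>" "norm w < \<rho>"
  shows "((\<lambda>p. dps a (fst p) (snd p)) has_derivative
      (\<lambda>h. dps (dps_dx a) z w * fst h + dps (dps_dy a) z w * snd h)) (at (z, w))"
proof -
  \<comment> \<open>A radius strictly between the point and \<rho>, because the differentiated
    series is controlled only on smaller bidiscs.\<close>
  define \<sigma> where "\<sigma> = (max (norm z) (norm w) + \<rho>) / 2"
  have \<rho>: "0 < \<rho>" using a by (simp add: dps_conv_def)
  have \<sigma>: "norm z < \<sigma>" "norm w < \<sigma>" "0 < \<sigma>" "\<sigma> < \<rho>"
    using zw \<rho> norm_ge_zero[of z] norm_ge_zero[of w] unfolding \<sigma>_def max_def
    by (simp_all add: field_simps split: if_splits) (smt (verit) norm_ge_zero)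
  define S where "S = (ball 0 \<sigma> :: 'a set) \<times> (ball 0 \<sigma> :: 'a set)"
  have S: "open S" "convex S" "(z, w) \<in> S" using \<sigma> unfolding S_def
    by (auto intro: open_Times convex_Times)
  define f where "f = (\<lambda>n (p::'a\<times>'a). case prod_decode n of (i, j) \<Rightarrow> of_real (a i j) * fst p ^ i * snd p ^ j)"
  define D1 where "D1 = (\<lambda>n (p::'a\<times>'a). case prod_decode n of (i, j) \<Rightarrow>
     of_real (a i j) * (of_nat i * fst p ^ (i - 1)) * snd p ^ j)"
  define D2 where "D2 = (\<lambda>n (p::'a\<times>'a). case prod_decode n of (i, j) \<Rightarrow>
     of_real (a i j) * (of_nat j * snd p ^ (j - 1)) * fst p ^ i)"
  define f' where "f' = (\<lambda>n p (h::'a\<times>'a). D1 n p * fst h + D2 n p * snd h)"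
  define g' where "g' = (\<lambda>(p::'a\<times>'a) (h::'a\<times>'a).
     dps (dps_dx a) (fst p) (snd p) * fst h + dps (dps_dy a) (fst p) (snd p) * snd h)"
  have u1: "uniform_limit S (\<lambda>n p. \<Sum>k<n. D1 k p) (\<lambda>p. dps (dps_dx a) (fst p) (snd p)) sequentially"
    unfolding D1_def by (rule dps_dx_uniform_limit[OF bij_prod_decode a _ \<sigma>(3,4)]) (auto simp: S_def)
  have u2: "uniform_limit S (\<lambda>n p. \<Sum>k<n. D2 k p) (\<lambda>p. dps (dps_dy a) (fst p) (snd p)) sequentially"
  proof -
    have "bij (prod.swap \<circ> prod_decode :: nat \<Rightarrow> nat \<times> nat)"
      by (rule bij_comp[OF bij_prod_decode]) (auto intro: bijI' simp: prod_eq_iff)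
    from dps_dx_uniform_limit[OF this iffD2[OF dps_conv_swap a] _ \<sigma>(3,4), of S]
    have "uniform_limit S (\<lambda>n p. \<Sum>k<n. case (prod.swap \<circ> prod_decode) k of (i, j) \<Rightarrow>
         of_real (a j i) * (of_nat i * fst p ^ (i - 1)) * snd p ^ j)
      (\<lambda>p. dps (dps_dx (\<lambda>i j. a j i)) (fst p) (snd p)) sequentially"
      by (auto simp: S_def)
    then have "uniform_limit S (\<lambda>n p. \<Sum>k<n. case (prod.swap \<circ> prod_decode) k of (i, j) \<Rightarrow>
         of_real (a j i) * (of_nat i * fst (prod.swap p) ^ (i - 1)) * snd (prod.swap p) ^ j)
      (\<lambda>p. dps (dps_dx (\<lambda>i j. a j i)) (fst (prod.swap p)) (snd (prod.swap p))) sequentially"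
      unfolding uniform_limit_iff S_def
      by (fastforce elim!: eventually_mono simp: case_prod_unfold)
    moreover have "dps (dps_dy a) (fst p) (snd p) = dps (dps_dx (\<lambda>i j. a j i)) (snd p) (fst p)" for p :: "'a \<times> 'a"
      unfolding dps_dy_swap by (rule dps_swap)
    ultimately show ?thesis
      by (simp add: D2_def case_prod_unfold)
  qed
  have "\<exists>g. \<forall>x\<in>S. (\<lambda>n. f n x) sums (g x) \<and> (g has_derivative g' x) (at x within S)"
  proof (rule has_derivative_series[where f'=f'])
    show "convex S" "(z, w) \<in> S" by fact+
    show "(f n has_derivative f' n p) (at p within S)" for n p
    proof -
      obtain i j where n: "prod_decode n = (i, j)" by force
      have p1: "((\<lambda>p. fst p ^ i) has_derivative (\<lambda>h. of_nat i * fst p ^ (i - 1) * fst h)) (at p within S)"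
        by (auto intro!: derivative_eq_intros simp: mult_ac)
      have p2: "((\<lambda>p. snd p ^ j) has_derivative (\<lambda>h. of_nat j * snd p ^ (j - 1) * snd h)) (at p within S)"
        by (auto intro!: derivative_eq_intros simp: mult_ac)
      have "((\<lambda>p. of_real (a i j) * (fst p ^ i * snd p ^ j)) has_derivative
         (\<lambda>h. of_real (a i j) * (fst p ^ i * (of_nat j * snd p ^ (j - 1) * snd h) +
            of_nat i * fst p ^ (i - 1) * fst h * snd p ^ j))) (at p within S)"
        by (intro has_derivative_mult_right has_derivative_mult p1 p2)
      moreover have "(\<lambda>h. of_real (a i j) * (fst p ^ i * (of_nat j * snd p ^ (j - 1) * snd h) +
            of_nat i * fst p ^ (i - 1) * fst h * snd p ^ j)) = f' n p"
        by (auto simp: f'_def D1_def D2_def n algebra_simps)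
      moreover have "(\<lambda>p. of_real (a i j) * (fst p ^ i * snd p ^ j)) = f n"
        by (auto simp: f_def n mult.assoc)
      ultimately show ?thesis by (simp only:)
    qed
    show "\<forall>\<^sub>F n in sequentially. \<forall>p\<in>S. \<forall>h. norm ((\<Sum>i<n. f' i p h) - g' p h) \<le> e * norm h"
      if "e > 0" for e
    proof -
      have "\<forall>\<^sub>F n in sequentially. \<forall>p\<in>S. dist (\<Sum>k<n. D1 k p) (dps (dps_dx a) (fst p) (snd p)) < e / 2"
        "\<forall>\<^sub>F n in sequentially. \<forall>p\<in>S. dist (\<Sum>k<n. D2 k p) (dps (dps_dy a) (fst p) (snd p)) < e / 2"
        using u1[unfolded uniform_limit_iff, rule_format, of "e / 2"]
          u2[unfolded uniform_limit_iff, rule_format, of "e / 2"] that by simp_all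
      then show ?thesis
      proof (eventually_elim, intro ballI allI)
        case (elim n)
        fix p h assume p: "p \<in> S"
        let ?A = "(\<Sum>k<n. D1 k p) - dps (dps_dx a) (fst p) (snd p)"
        let ?B = "(\<Sum>k<n. D2 k p) - dps (dps_dy a) (fst p) (snd p)"
        have "(\<Sum>i<n. f' i p h) - g' p h = ?A * fst h + ?B * snd h"
          by (simp add: f'_def g'_def sum.distrib algebra_simps flip: sum_distrib_left)
        then have "norm ((\<Sum>i<n. f' i p h) - g' p h) \<le> norm ?A * norm (fst h) + norm ?B * norm (snd h)"
          by (metis norm_triangle_ineq norm_mult)
        also have "\<dots> \<le> e / 2 * norm h + e / 2 * norm h"
          using elim p norm_fst_le[of "fst h" "snd h"] norm_snd_le[of "snd h" "fst h"] that
          by (intro add_mono mult_mono) (auto simp: dist_norm less_imp_le)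
        finally show "norm ((\<Sum>i<n. f' i p h) - g' p h) \<le> e * norm h" by simp
      qed
    qed
    show "(\<lambda>n. f n (z, w)) sums suminf (\<lambda>n. f n (z, w))"
    proof -
      have "((\<lambda>(i, j). of_real (a i j) * z ^ i * w ^ j) has_sum dps a z w) UNIV"
        by (rule dps_has_sum[OF a]) (use zw in auto)
      then have "((\<lambda>n. f n (z, w)) has_sum dps a z w) UNIV"
        using has_sum_reindex_bij_betw[OF bij_prod_decode, of "\<lambda>(i, j). of_real (a i j) * z ^ i * w ^ j"]
        by (simp add: f_def)
      then show ?thesis using has_sum_imp_sums sums_summable summable_sums by blast
    qed
  qed
  then obtain g where g: "\<And>x. x \<in> S \<Longrightarrow> (\<lambda>n. f n x) sums (g x)"
      "\<And>x. x \<in> S \<Longrightarrow> (g has_derivative g' x) (at x within S)" by blast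
  have eq: "g x = dps a (fst x) (snd x)" if "x \<in> S" for x
  proof -
    have "((\<lambda>(i, j). of_real (a i j) * fst x ^ i * snd x ^ j) has_sum dps a (fst x) (snd x)) UNIV"
      by (rule dps_has_sum[OF a]) (use that \<sigma> in \<open>auto simp: S_def mem_Times_iff\<close>)
    then have "((\<lambda>n. f n x) has_sum dps a (fst x) (snd x)) UNIV"
      using has_sum_reindex_bij_betw[OF bij_prod_decode, of "\<lambda>(i, j). of_real (a i j) * fst x ^ i * snd x ^ j"]
      by (simp add: f_def)
    from has_sum_imp_sums[OF this] g(1)[OF that] show ?thesis by (metis sums_unique2)
  qed
  have "(g has_derivative g' (z, w)) (at (z, w))"
    using g(2)[OF S(3)] by (simp only: at_within_open[OF S(3,1)])
  then have "((\<lambda>p. dps a (fst p) (snd p)) has_derivative g' (z, w)) (at (z, w))"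
    by (rule has_derivative_transform_within_open[OF _ S(1,3)]) (rule eq)
  then show ?thesis by (simp add: g'_def)
qed

lemma dps_0_0 [simp]: "dps a 0 0 = (of_real (a 0 0) :: 'a::{real_normed_field,banach})"
proof -
  have "dps a 0 0 = (\<Sum>\<^sub>\<infinity>(i, j)\<in>{(0, 0)}. of_real (a i j) * (0::'a) ^ i * 0 ^ j)"
    unfolding dps_def by (rule infsum_cong_neutral) (auto simp: power_0_left split: if_splits)
  then show ?thesis by simp
qed

text \<open>The derivative series vanish near the origin too, and \<open>a i j\<close> is, up to a
  nonzero factor, the value of an iterated one at the origin. Induction on \<open>j\<close> settles
  row 0; induction on \<open>i\<close> reduces the other rows to it.\<close>

lemma dps_coeff_0:
  assumes "dps_conv a \<rho>" "0 < \<epsilon>" "\<And>x y::real. \<bar>x\<bar> < \<epsilon> \<Longrightarrow> \<bar>y\<bar> < \<epsilon> \<Longrightarrow> dps a x y = 0"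
  shows "a i j = 0"
proof -
  have step: "dps (dps_dx a) x y = 0 \<and> dps (dps_dy a) x y = 0"
    if a: "dps_conv a \<rho>" "\<And>x y::real. \<bar>x\<bar> < \<epsilon> \<Longrightarrow> \<bar>y\<bar> < \<epsilon> \<Longrightarrow> dps a x y = 0"
      and xy: "\<bar>x\<bar> < \<epsilon>" "\<bar>y\<bar> < \<epsilon>" "\<bar>x\<bar> < \<rho>" "\<bar>y\<bar> < \<rho>" for a \<rho> \<epsilon> and x y :: real
  proof -
    have "((\<lambda>p. dps a (fst p) (snd p)) has_derivative
      (\<lambda>h. dps (dps_dx a) x y * fst h + dps (dps_dy a) x y * snd h)) (at (x, y))"
      by (rule dps_has_derivative[OF a(1)]) (use xy in auto)
    then have "((\<lambda>p. 0) has_derivative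
      (\<lambda>h. dps (dps_dx a) x y * fst h + dps (dps_dy a) x y * snd h)) (at (x, y))"
      by (rule has_derivative_transform_within_open[where s="ball 0 \<epsilon> \<times> ball 0 \<epsilon>"])
         (use a xy in \<open>auto intro: open_Times\<close>)
    then have "(\<lambda>h. dps (dps_dx a) x y * fst h + dps (dps_dy a) x y * snd h) = (\<lambda>h. 0)"
      using has_derivative_unique has_derivative_const by blast
    from fun_cong[OF this, of "(1, 0)"] fun_cong[OF this, of "(0, 1)"] show ?thesis by simp
  qed
  have y: "a 0 j = 0"
    if "dps_conv a \<rho>" "0 < \<epsilon>" "\<And>x y::real. \<bar>x\<bar> < \<epsilon> \<Longrightarrow> \<bar>y\<bar> < \<epsilon> \<Longrightarrow> dps a x y = 0" for a \<rho> \<epsilon> j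
    using that
  proof (induction j arbitrary: a \<rho> \<epsilon>)
    case 0
    then show ?case using 0(3)[of 0 0] by simp
  next
    case (Suc j)
    have pos: "0 < \<rho>" using Suc.prems by (simp add: dps_conv_def)
    have "dps_dy a 0 j = 0"
    proof (rule Suc.IH)
      show "dps_conv (dps_dy a) (\<rho> / 2)" using dps_conv_dy[OF Suc.prems(1)] pos by simp
      show "dps (dps_dy a) x y = 0" if "\<bar>x\<bar> < min \<epsilon> \<rho>" "\<bar>y\<bar> < min \<epsilon> \<rho>" for x y :: real
        using step[OF Suc.prems(1,3)] that by auto
    qed (use Suc.prems pos in auto)
    then show ?case by (simp add: dps_dy_def)
  qed
  show ?thesis using assms
  proof (induction i arbitrary: a \<rho> \<epsilon>)
    case 0
    then show ?case using y by blast
  next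
    case (Suc i)
    have pos: "0 < \<rho>" using Suc.prems by (simp add: dps_conv_def)
    have "dps_dx a i j = 0"
    proof (rule Suc.IH)
      show "dps_conv (dps_dx a) (\<rho> / 2)" using dps_conv_dx[OF Suc.prems(1)] pos by simp
      show "dps (dps_dx a) x y = 0" if "\<bar>x\<bar> < min \<epsilon> \<rho>" "\<bar>y\<bar> < min \<epsilon> \<rho>" for x y :: real
        using step[OF Suc.prems(1,3)] that by auto
    qed (use Suc.prems pos in auto)
    then show ?case by (simp add: dps_dx_def)
  qed
qed

lemma dps_add:
  fixes z w :: "'a::{real_normed_field,banach}"
  assumes "dps_conv a \<rho>" "dps_conv b \<rho>" "norm z \<le> \<rho>" "norm w \<le> \<rho>"
  shows "dps (\<lambda>i j. a i j + c * b i j) z w = dps a z w + of_real c * dps b z w"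
proof -
  have "((\<lambda>p. (case p of (i, j) \<Rightarrow> of_real (a i j) * z ^ i * w ^ j) +
      of_real c * (case p of (i, j) \<Rightarrow> of_real (b i j) * z ^ i * w ^ j)) has_sum
      dps a z w + of_real c * dps b z w) UNIV"
    by (intro has_sum_add has_sum_cmult_right dps_has_sum) fact+
  then have "((\<lambda>(i, j). of_real (a i j + c * b i j) * z ^ i * w ^ j) has_sum
      dps a z w + of_real c * dps b z w) UNIV"
    by (simp add: case_prod_unfold algebra_simps)
  then show ?thesis unfolding dps_def by (rule infsumI)
qed

lemma dps_conv_add:
  assumes "dps_conv a \<rho>" "dps_conv b \<rho>"
  shows "dps_conv (\<lambda>i j. a i j + c * b i j) \<rho>"
proof -
  have \<rho>: "0 < \<rho>" using assms by (simp add: dps_conv_def)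
  have "(\<lambda>p. (case p of (i, j) \<Rightarrow> \<bar>a i j\<bar> * \<rho> ^ (i + j)) +
      \<bar>c\<bar> * (case p of (i, j) \<Rightarrow> \<bar>b i j\<bar> * \<rho> ^ (i + j))) summable_on UNIV"
    using assms by (intro summable_on_add summable_on_cmult_right) (auto simp: dps_conv_def)
  then have "(\<lambda>(i, j). \<bar>a i j + c * b i j\<bar> * \<rho> ^ (i + j)) summable_on UNIV"
  proof (rule summable_on_comparison_test)
    fix p :: "nat \<times> nat"
    obtain i j where p: "p = (i, j)" by force
    have "\<bar>a i j + c * b i j\<bar> * \<rho> ^ (i + j) \<le> (\<bar>a i j\<bar> + \<bar>c\<bar> * \<bar>b i j\<bar>) * \<rho> ^ (i + j)"
      using \<rho> abs_triangle_ineq[of "a i j" "c * b i j"] by (intro mult_right_mono) (auto simp: abs_mult)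
    then show "(case p of (i, j) \<Rightarrow> \<bar>a i j + c * b i j\<bar> * \<rho> ^ (i + j)) \<le>
       (case p of (i, j) \<Rightarrow> \<bar>a i j\<bar> * \<rho> ^ (i + j)) + \<bar>c\<bar> * (case p of (i, j) \<Rightarrow> \<bar>b i j\<bar> * \<rho> ^ (i + j))"
      by (simp add: p algebra_simps)
  qed (use \<rho> in auto)
  then show ?thesis using \<rho> by (simp add: dps_conv_def)
qed

section \<open>Real-analytic functions of two variables\<close>

lemma dps_of_real:
  assumes "dps_conv a \<rho>" "\<bar>x\<bar> \<le> \<rho>" "\<bar>y\<bar> \<le> \<rho>"
  shows "dps a (of_real x :: 'a::{real_normed_field,banach}) (of_real y) = of_real (dps a x y)"
proof -
  have "((\<lambda>(i, j). of_real (a i j) * x ^ i * y ^ j) has_sum dps a x y) UNIV"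
    using assms by (intro dps_has_sum) auto
  then have "((\<lambda>p. of_real (case p of (i, j) \<Rightarrow> of_real (a i j) * x ^ i * y ^ j)) has_sum
      (of_real (dps a x y) :: 'a)) UNIV"
    by (rule has_sum_of_real)
  then have "((\<lambda>(i, j). of_real (a i j) * of_real x ^ i * of_real y ^ j) has_sum
      (of_real (dps a x y) :: 'a)) UNIV"
    by (simp add: case_prod_unfold)
  then show ?thesis unfolding dps_def[where ?'a='a] by (rule infsumI)
qed

lemma dps_cnj:
  assumes "dps_conv a \<rho>" "norm z \<le> \<rho>" "norm w \<le> \<rho>"
  shows "dps a (cnj z) (cnj w) = cnj (dps a z w)"
  unfolding dps_def infsum_cnj[symmetric] by (rule infsum_cong) (auto simp: case_prod_unfold)

text \<open>Chain rule along the graph of \<open>Y\<close>. A constant \<open>Y\<close> gives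
  holomorphy in one variable; an implicit function \<open>Y\<close> gives the derivative along a
  curve of zeros.\<close>

lemma dps_comp_field_derivative:
  fixes Y :: "'a::{real_normed_field,banach} \<Rightarrow> 'a"
  assumes b: "dps_conv b \<rho>" and z: "norm z < \<rho>" "norm (Y z) < \<rho>"
    and Y: "(Y has_field_derivative D) (at z)"
  shows "((\<lambda>z. dps b z (Y z)) has_field_derivative
    (dps (dps_dx b) z (Y z) + dps (dps_dy b) z (Y z) * D)) (at z)"
proof -
  have "((\<lambda>z. (z, Y z)) has_derivative (\<lambda>h. (h, D * h))) (at z)"
    by (intro has_derivative_Pair has_derivative_ident) (use Y in \<open>simp add: has_field_derivative_def\<close>)
  moreover have "((\<lambda>p. dps b (fst p) (snd p)) has_derivative
      (\<lambda>h. dps (dps_dx b) z (Y z) * fst h + dps (dps_dy b) z (Y z) * snd h)) (at (z, Y z))"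
    by (rule dps_has_derivative[OF b z])
  ultimately have "((\<lambda>z. dps b z (Y z)) has_derivative
      (\<lambda>h. dps (dps_dx b) z (Y z) * h + dps (dps_dy b) z (Y z) * (D * h))) (at z)"
    using has_derivative_compose[of "\<lambda>z. (z, Y z)" _ z UNIV "\<lambda>p. dps b (fst p) (snd p)"] by fastforce
  moreover have "(\<lambda>h. dps (dps_dx b) z (Y z) * h + dps (dps_dy b) z (Y z) * (D * h)) =
      (*) (dps (dps_dx b) z (Y z) + dps (dps_dy b) z (Y z) * D)"
    by (auto simp: algebra_simps)
  ultimately show ?thesis by (simp add: has_field_derivative_def)
qed

lemma dps_snd_derivative:
  fixes x y :: real
  assumes b: "dps_conv b \<rho>" and xy: "\<bar>x\<bar> < \<rho>" "\<bar>y\<bar> < \<rho>"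
  shows "((\<lambda>y. dps b x y) has_real_derivative dps (dps_dy b) x y) (at y)"
proof -
  have "((\<lambda>y. dps (\<lambda>i j. b j i) y x) has_real_derivative dps (dps_dx (\<lambda>i j. b j i)) y x) (at y)"
    using dps_comp_field_derivative[OF iffD2[OF dps_conv_swap b], of y "\<lambda>_. x" 0] xy by simp
  moreover have "dps (dps_dx (\<lambda>i j. b j i)) y x = dps (dps_dy b) x y"
    unfolding dps_dy_swap by (rule dps_swap[symmetric])
  ultimately show ?thesis by (simp add: dps_swap[of b])
qed

lemma dps_holomorphic_1:
  assumes "dps_conv a \<rho>" "norm w < \<rho>"
  shows "(\<lambda>z. dps a z (w::complex)) holomorphic_on ball 0 \<rho>"
proof (rule holomorphic_onI)
  fix z assume "z \<in> ball (0::complex) \<rho>"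
  then have "cmod z < \<rho>" by simp
  from dps_comp_field_derivative[OF assms(1) this assms(2) DERIV_const]
  show "(\<lambda>z. dps a z w) field_differentiable (at z within ball 0 \<rho>)"
    by (meson field_differentiable_def field_differentiable_at_within)
qed

text \<open>For fixed real \<open>y\<close> the series is holomorphic in the first variable on the
  whole disc, and its real zeros accumulate at \<open>q\<close>; the identity theorem of one complex
  variable applies.\<close>

lemma dps_zero_extend_1:
  assumes a: "dps_conv a \<rho>" and y: "\<bar>y\<bar> < \<rho>" and q: "\<bar>q\<bar> < \<rho>" "0 < \<epsilon>"
    and z: "\<And>x::real. \<bar>x - q\<bar> < \<epsilon> \<Longrightarrow> \<bar>x\<bar> < \<rho> \<Longrightarrow> dps a x y = 0" and x: "\<bar>x\<bar> < \<rho>"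
  shows "dps a x y = 0"
proof -
  let ?U = "complex_of_real ` ({q - \<epsilon><..<q + \<epsilon>} \<inter> {-\<rho><..<\<rho>})"
  have "dps a (complex_of_real x) (complex_of_real y) = 0"
  proof (rule analytic_continuation[where f="\<lambda>z. dps a z (complex_of_real y)" and S="ball 0 \<rho>" and U="?U"])
    show "(\<lambda>z. dps a z (complex_of_real y)) holomorphic_on ball 0 \<rho>"
      using y by (intro dps_holomorphic_1[OF a]) auto
    show "complex_of_real q islimpt ?U"
    proof (rule islimpt_approachable[THEN iffD2], safe)
      fix e :: real assume "e > 0"
      define t where "t = min e (min \<epsilon> (\<rho> - \<bar>q\<bar>)) / 2"
      have t: "0 < t" "t < e" "t < \<epsilon>" "t < \<rho> - \<bar>q\<bar>" using q \<open>e > 0\<close> by (auto simp: t_def)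
      have "complex_of_real (q + t) \<in> ?U"
        using t by (intro imageI) auto
      moreover have "complex_of_real (q + t) \<noteq> complex_of_real q \<and> dist (complex_of_real (q + t)) (complex_of_real q) < e"
        using t by (simp add: dist_norm)
      ultimately show "\<exists>x'\<in>?U. x' \<noteq> complex_of_real q \<and> dist x' (complex_of_real q) < e" by blast
    qed
    show "dps a z (complex_of_real y) = 0" if "z \<in> ?U" for z
      using that z y by (auto simp: dps_of_real[OF a])
  qed (use q x in auto)
  then show ?thesis using x y by (simp add: dps_of_real[OF a])
qed

text \<open>Continuation one variable at a time: first in \<open>x\<close> for every
  \<open>y\<close> near \<open>q'\<close>, then, with the roles exchanged, in \<open>y\<close> for
  the fixed \<open>x\<close>.\<close>

lemma dps_zero_extend:
  assumes a: "dps_conv a \<rho>" and q: "\<bar>q\<bar> < \<rho>" "\<bar>q'\<bar> < \<rho>" "0 < \<epsilon>"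
    and z: "\<And>x y::real. \<bar>x - q\<bar> < \<epsilon> \<Longrightarrow> \<bar>x\<bar> < \<rho> \<Longrightarrow> \<bar>y - q'\<bar> < \<epsilon> \<Longrightarrow> \<bar>y\<bar> < \<rho> \<Longrightarrow> dps a x y = 0"
    and x: "\<bar>x\<bar> < \<rho>" "\<bar>y\<bar> < \<rho>"
  shows "dps a x y = 0"
proof -
  have "dps a x y = 0" if "\<bar>y - q'\<bar> < \<epsilon>" "\<bar>y\<bar> < \<rho>" for y
    by (rule dps_zero_extend_1[OF a that(2) q(1,3)]) (use z that x in auto)
  then have "dps (\<lambda>i j. a j i) y x = 0" if "\<bar>y - q'\<bar> < \<epsilon>" "\<bar>y\<bar> < \<rho>" for y
    using that by (simp add: dps_swap[of a])
  then have "dps (\<lambda>i j. a j i) y x = 0"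
    by (intro dps_zero_extend_1[OF iffD2[OF dps_conv_swap a] x(1) q(2,3) _ x(2)])
  then show ?thesis by (simp add: dps_swap[of a])
qed

section \<open>Taylor expansions on boxes and the identity theorem in the plane\<close>

definition taylor_at :: "(real^2 \<Rightarrow> real) \<Rightarrow> real^2 \<Rightarrow> (nat \<Rightarrow> nat \<Rightarrow> real) \<Rightarrow> real \<Rightarrow> bool" where
  "taylor_at f p a \<rho> \<longleftrightarrow> dps_conv a \<rho> \<and>
     (\<forall>x. \<bar>x $ 1 - p $ 1\<bar> < \<rho> \<longrightarrow> \<bar>x $ 2 - p $ 2\<bar> < \<rho> \<longrightarrow> f x = dps a (x $ 1 - p $ 1) (x $ 2 - p $ 2))"

lemma taylor_atD: "taylor_at f p a \<rho> \<Longrightarrow> \<bar>x $ 1 - p $ 1\<bar> < \<rho> \<Longrightarrow> \<bar>x $ 2 - p $ 2\<bar> < \<rho>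
    \<Longrightarrow> f x = dps a (x $ 1 - p $ 1) (x $ 2 - p $ 2)"
  by (simp add: taylor_at_def)

lemma taylor_at_conv: "taylor_at f p a \<rho> \<Longrightarrow> dps_conv a \<rho>"
  by (simp add: taylor_at_def)

lemma taylor_at_pos: "taylor_at f p a \<rho> \<Longrightarrow> 0 < \<rho>"
  by (simp add: taylor_at_def dps_conv_def)

lemma norm_le_2:
  fixes x :: "real^2"
  shows "norm x \<le> \<bar>x $ 1\<bar> + \<bar>x $ 2\<bar>"
  using norm_le_l1_cart[of x] by (simp add: sum_2)

text \<open>A summable family of reals is absolutely summable, so convergence at one point off the
  axes already yields absolute convergence on a box.\<close>

lemma real_analytic_on_iff_taylor:
  "real_analytic_on f S \<longleftrightarrow> (\<forall>p\<in>S. \<exists>a \<rho>. taylor_at f p a \<rho>)"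
proof (intro iffI ballI)
  fix p assume "real_analytic_on f S" "p \<in> S"
  then obtain r a where r: "r > 0" and hs: "\<And>x. x \<in> ball p r \<Longrightarrow>
      ((\<lambda>(i, j). a i j * (x $ 1 - p $ 1) ^ i * (x $ 2 - p $ 2) ^ j) has_sum f x) UNIV"
    unfolding real_analytic_on_def by blast
  \<comment> \<open>With a third of the radius, even the corner of the box has norm at most
    \<open>2 * r / 3\<close> relative to \<open>p\<close> and lies in the ball.\<close>
  define \<sigma> where "\<sigma> = r / 3"
  have \<sigma>: "0 < \<sigma>" using r by (simp add: \<sigma>_def)
  have box: "x \<in> ball p r" if "\<bar>x $ 1 - p $ 1\<bar> \<le> \<sigma>" "\<bar>x $ 2 - p $ 2\<bar> \<le> \<sigma>" for x
    using that norm_le_2[of "x - p"] r by (auto simp: \<sigma>_def dist_norm norm_minus_commute)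
  have "dps_conv a \<sigma>"
  proof -
    have "(p + vector [\<sigma>, \<sigma>]) \<in> ball p r" using \<sigma> by (intro box) (auto simp: vector_2)
    from has_sum_imp_summable[OF hs[OF this]]
    have "(\<lambda>(i, j). a i j * \<sigma> ^ i * \<sigma> ^ j) summable_on UNIV" by (simp add: vector_2)
    then have "(\<lambda>p. \<bar>case p of (i, j) \<Rightarrow> a i j * \<sigma> ^ i * \<sigma> ^ j\<bar>) summable_on UNIV"
      using summable_on_iff_abs_summable_on_real[of "\<lambda>(i, j). a i j * \<sigma> ^ i * \<sigma> ^ j" UNIV] by simp
    then have "(\<lambda>(i, j). \<bar>a i j\<bar> * \<sigma> ^ (i + j)) summable_on UNIV"
      using \<sigma> by (simp add: case_prod_unfold abs_mult power_add mult_ac)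
    then show ?thesis using \<sigma> by (simp add: dps_conv_def)
  qed
  moreover have "f x = dps a (x $ 1 - p $ 1) (x $ 2 - p $ 2)"
    if "\<bar>x $ 1 - p $ 1\<bar> < \<sigma>" "\<bar>x $ 2 - p $ 2\<bar> < \<sigma>" for x
    using infsumI[OF hs[OF box]] that by (simp add: dps_def)
  ultimately have "taylor_at f p a \<sigma>" by (simp add: taylor_at_def)
  then show "\<exists>a \<rho>. taylor_at f p a \<rho>" by blast
next
  assume *: "\<forall>p\<in>S. \<exists>a \<rho>. taylor_at f p a \<rho>"
  show "real_analytic_on f S" unfolding real_analytic_on_def
  proof
    fix p assume "p \<in> S"
    then obtain a \<rho> where t: "taylor_at f p a \<rho>" using * by blast
    have "((\<lambda>(i, j). a i j * (x $ 1 - p $ 1) ^ i * (x $ 2 - p $ 2) ^ j) has_sum f x) UNIV"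
      if "x \<in> ball p \<rho>" for x
    proof -
      have "\<bar>x $ 1 - p $ 1\<bar> < \<rho>" "\<bar>x $ 2 - p $ 2\<bar> < \<rho>"
        using that component_le_norm_cart[of "x - p" 1] component_le_norm_cart[of "x - p" 2]
        by (auto simp: dist_norm norm_minus_commute)
      then show ?thesis
        using dps_has_sum[OF taylor_at_conv[OF t], of "x $ 1 - p $ 1" "x $ 2 - p $ 2"] taylor_atD[OF t]
        by simp
    qed
    then show "\<exists>r>0. \<exists>a. \<forall>x\<in>ball p r.
        ((\<lambda>(i, j). a i j * (x $ 1 - p $ 1) ^ i * (x $ 2 - p $ 2) ^ j) has_sum f x) UNIV"
      using taylor_at_pos[OF t] by blast
  qed
qed

lemma taylor_at_mono:
  assumes "taylor_at f p a \<rho>" "0 < \<sigma>" "\<sigma> \<le> \<rho>"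
  shows "taylor_at f p a \<sigma>"
  using assms dps_conv_mono by (force simp: taylor_at_def)

text \<open>The real trace of a bidisc. Unlike in a ball, the coordinates vary independently, as
  continuation one variable at a time requires.\<close>

definition box_at :: "real^2 \<Rightarrow> real \<Rightarrow> (real^2) set" where
  "box_at p \<rho> = {x. \<bar>x $ 1 - p $ 1\<bar> < \<rho> \<and> \<bar>x $ 2 - p $ 2\<bar> < \<rho>}"

lemma open_box_at: "open (box_at p \<rho>)"
  unfolding box_at_def by (intro open_Collect_conj open_Collect_less continuous_intros)

lemma center_in_box_at: "0 < \<rho> \<Longrightarrow> p \<in> box_at p \<rho>"
  by (simp add: box_at_def)

lemma ball_subset_box_at: "ball p \<rho> \<subseteq> box_at p \<rho>"
  using component_le_norm_cart[of "_ - p" 1] component_le_norm_cart[of "_ - p" 2]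
  by (fastforce simp: box_at_def dist_norm norm_minus_commute intro: le_less_trans)

lemma taylor_at_box: "taylor_at f p a \<rho> \<Longrightarrow> x \<in> box_at p \<rho> \<Longrightarrow> f x = dps a (x $ 1 - p $ 1) (x $ 2 - p $ 2)"
  by (simp add: taylor_at_def box_at_def)

lemma taylor_at_has_derivative:
  assumes t: "taylor_at f p a \<rho>" and x: "x \<in> box_at p \<rho>"
  shows "(f has_derivative (\<lambda>h. dps (dps_dx a) (x $ 1 - p $ 1) (x $ 2 - p $ 2) * h $ 1
      + dps (dps_dy a) (x $ 1 - p $ 1) (x $ 2 - p $ 2) * h $ 2)) (at x)"
proof -
  have "((\<lambda>x. x $ i - p $ i) has_derivative (\<lambda>h. h $ i)) (at x)" for i
    using has_derivative_diff[OF bounded_linear_imp_has_derivative[OF bounded_linear_vec_nth] has_derivative_const]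
    by fastforce
  then have "((\<lambda>x. (x $ 1 - p $ 1, x $ 2 - p $ 2)) has_derivative (\<lambda>h. (h $ 1, h $ 2))) (at x)"
    by (intro has_derivative_Pair)
  moreover have "((\<lambda>q. dps a (fst q) (snd q)) has_derivative
      (\<lambda>h. dps (dps_dx a) (x $ 1 - p $ 1) (x $ 2 - p $ 2) * fst h
         + dps (dps_dy a) (x $ 1 - p $ 1) (x $ 2 - p $ 2) * snd h)) (at (x $ 1 - p $ 1, x $ 2 - p $ 2))"
    using x by (intro dps_has_derivative[OF taylor_at_conv[OF t]]) (auto simp: box_at_def)
  ultimately have "((\<lambda>x. dps a (x $ 1 - p $ 1) (x $ 2 - p $ 2)) has_derivative
     (\<lambda>h. dps (dps_dx a) (x $ 1 - p $ 1) (x $ 2 - p $ 2) * h $ 1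
      + dps (dps_dy a) (x $ 1 - p $ 1) (x $ 2 - p $ 2) * h $ 2)) (at x)"
    using has_derivative_compose[of "\<lambda>x. (x $ 1 - p $ 1, x $ 2 - p $ 2)" _ x UNIV
      "\<lambda>p. dps a (fst p) (snd p)"] by fastforce
  then show ?thesis
    by (rule has_derivative_transform_within_open[OF _ open_box_at x]) (simp add: taylor_at_box[OF t])
qed

lemma axis_2 [simp]: "(axis 1 1 :: real^2) $ 1 = 1" "(axis 1 1 :: real^2) $ 2 = 0"
    "(axis 2 1 :: real^2) $ 1 = 0" "(axis 2 1 :: real^2) $ 2 = 1"
  by (auto simp: axis_def)

lemma taylor_at_partial_deriv:
  assumes t: "taylor_at f p a \<rho>" and x: "x \<in> box_at p \<rho>"
  shows "partial_deriv 1 f x = dps (dps_dx a) (x $ 1 - p $ 1) (x $ 2 - p $ 2)"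
    and "partial_deriv 2 f x = dps (dps_dy a) (x $ 1 - p $ 1) (x $ 2 - p $ 2)"
  using frechet_derivative_at[OF taylor_at_has_derivative[OF t x], symmetric]
  by (simp_all add: partial_deriv_def)

lemma taylor_at_partial:
  assumes t: "taylor_at f p a \<rho>" and \<sigma>: "0 < \<sigma>" "\<sigma> < \<rho>"
  shows "taylor_at (partial_deriv 1 f) p (dps_dx a) \<sigma>"
    and "taylor_at (partial_deriv 2 f) p (dps_dy a) \<sigma>"
  using dps_conv_dx[OF taylor_at_conv[OF t] \<sigma>] dps_conv_dy[OF taylor_at_conv[OF t] \<sigma>]
    taylor_at_partial_deriv[OF t] \<sigma> by (auto simp: taylor_at_def box_at_def)

lemma real_analytic_partial:
  assumes "real_analytic_on f S"
  shows "real_analytic_on (partial_deriv i f) S"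
  unfolding real_analytic_on_iff_taylor
proof
  fix p assume "p \<in> S"
  then obtain a \<rho> where t: "taylor_at f p a \<rho>" using assms real_analytic_on_iff_taylor by blast
  have "i = 1 \<or> i = 2" by (rule exhaust_2)
  then show "\<exists>a \<rho>. taylor_at (partial_deriv i f) p a \<rho>"
    using taylor_at_partial[OF t, of "\<rho> / 2"] taylor_at_pos[OF t] by auto
qed

lemma real_analytic_has_derivative:
  assumes "real_analytic_on f S" "x \<in> S"
  shows "(f has_derivative (\<lambda>h. grad f x \<bullet> h)) (at x)"
proof -
  obtain a \<rho> where t: "taylor_at f x a \<rho>" using assms real_analytic_on_iff_taylor by blast
  have x: "x \<in> box_at x \<rho>" using taylor_at_pos[OF t] by (rule center_in_box_at)
  show ?thesis
    using taylor_at_has_derivative[OF t x] taylor_at_partial_deriv[OF t x]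
    by (simp add: grad_def inner_vec_def sum_2)
qed

lemma laplacian_2: "laplacian f x = partial_deriv 1 (partial_deriv 1 f) x + partial_deriv 2 (partial_deriv 2 f) x"
  by (simp add: laplacian_def sum_2)

lemma laplacian_taylor:
  assumes t: "taylor_at f p a \<rho>"
  shows "laplacian f p = dps_dx (dps_dx a) 0 0 + dps_dy (dps_dy a) 0 0"
proof -
  have \<sigma>: "0 < \<rho> / 2" "\<rho> / 2 < \<rho>" using taylor_at_pos[OF t] by auto
  note pb' = center_in_box_at[OF \<sigma>(1), of p]
  show ?thesis unfolding laplacian_2
    using taylor_at_partial_deriv(1)[OF taylor_at_partial(1)[OF t \<sigma>] pb']
      taylor_at_partial_deriv(2)[OF taylor_at_partial(2)[OF t \<sigma>] pb'] by simp
qed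

lemma taylor_at_helmholtz:
  assumes t: "taylor_at f p a \<rho>" and \<sigma>: "0 < \<sigma>" "\<sigma> < \<rho>"
  shows "taylor_at (\<lambda>x. laplacian f x + c * f x) p
    (\<lambda>i j. dps_dx (dps_dx a) i j + 1 * dps_dy (dps_dy a) i j + c * a i j) \<sigma>"
proof -
  \<comment> \<open>Each of the two differentiations costs some radius.\<close>
  obtain \<tau> where \<tau>: "\<sigma> < \<tau>" "\<tau> < \<rho>" using dense \<sigma> by blast
  have \<tau>0: "0 < \<tau>" using \<sigma> \<tau> by simp
  note t1 = taylor_at_partial[OF t \<tau>0 \<tau>(2)]
  have 1: "taylor_at (partial_deriv 1 (partial_deriv 1 f)) p (dps_dx (dps_dx a)) \<sigma>"
    "taylor_at (partial_deriv 2 (partial_deriv 2 f)) p (dps_dy (dps_dy a)) \<sigma>"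
    "taylor_at f p a \<sigma>"
    using taylor_at_partial(1)[OF t1(1) \<sigma>(1) \<tau>(1)] taylor_at_partial(2)[OF t1(2) \<sigma>(1) \<tau>(1)]
      taylor_at_mono[OF t \<sigma>(1)] \<sigma> by auto
  note cv = 1[THEN taylor_at_conv]
  note cv' = dps_conv_add[OF cv(1,2), of 1]
  show ?thesis unfolding taylor_at_def
  proof (intro conjI allI impI)
    show "dps_conv (\<lambda>i j. dps_dx (dps_dx a) i j + 1 * dps_dy (dps_dy a) i j + c * a i j) \<sigma>"
      by (rule dps_conv_add[OF cv' cv(3)])
    fix x :: "real^2" assume x: "\<bar>x $ 1 - p $ 1\<bar> < \<sigma>" "\<bar>x $ 2 - p $ 2\<bar> < \<sigma>"
    then have n: "norm (x $ 1 - p $ 1) \<le> \<sigma>" "norm (x $ 2 - p $ 2) \<le> \<sigma>" by auto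
    show "laplacian f x + c * f x = dps (\<lambda>i j. dps_dx (dps_dx a) i j + 1 * dps_dy (dps_dy a) i j + c * a i j)
        (x $ 1 - p $ 1) (x $ 2 - p $ 2)"
      unfolding dps_add[OF cv' cv(3) n] dps_add[OF cv(1,2) n] laplacian_2
        taylor_atD[OF 1(1) x] taylor_atD[OF 1(2) x] taylor_atD[OF 1(3) x] by simp
  qed
qed

lemma real_analytic_helmholtz:
  assumes "real_analytic_on f S"
  shows "real_analytic_on (\<lambda>x. laplacian f x + c * f x) S"
  unfolding real_analytic_on_iff_taylor
proof
  fix p assume "p \<in> S"
  then obtain a \<rho> where t: "taylor_at f p a \<rho>" using assms real_analytic_on_iff_taylor by blast
  show "\<exists>a \<rho>. taylor_at (\<lambda>x. laplacian f x + c * f x) p a \<rho>"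
    using taylor_at_helmholtz[OF t, of "\<rho> / 2"] taylor_at_pos[OF t] by auto
qed

lemma taylor_at_zero_extend:
  assumes t: "taylor_at f p a \<rho>" and q: "q \<in> box_at p \<rho>" and z: "\<forall>\<^sub>F x in nhds q. f x = 0"
    and x: "x \<in> box_at p \<rho>"
  shows "f x = 0"
proof -
  obtain e where e: "e > 0" "\<And>x. dist x q < e \<Longrightarrow> f x = 0"
    using z unfolding eventually_nhds_metric by blast
  have "dps a (x $ 1 - p $ 1) (x $ 2 - p $ 2) = 0"
  proof (rule dps_zero_extend[OF taylor_at_conv[OF t]])
    show "dps a s s' = 0" if "\<bar>s - (q $ 1 - p $ 1)\<bar> < e / 2" "\<bar>s\<bar> < \<rho>"
      "\<bar>s' - (q $ 2 - p $ 2)\<bar> < e / 2" "\<bar>s'\<bar> < \<rho>" for s s' :: real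
    proof -
      define y :: "real^2" where "y = vector [p $ 1 + s, p $ 2 + s']"
      have y: "y $ 1 - p $ 1 = s" "y $ 2 - p $ 2 = s'" by (auto simp: y_def vector_2)
      have "norm (y - q) \<le> \<bar>(y - q) $ 1\<bar> + \<bar>(y - q) $ 2\<bar>" by (rule norm_le_2)
      also have "\<dots> < e" using that y by (simp add: algebra_simps)
      finally have "f y = 0" by (intro e) (simp add: dist_norm)
      then show ?thesis using taylor_at_box[OF t, of y] that y by (simp add: box_at_def)
    qed
  qed (use q x e in \<open>auto simp: box_at_def\<close>)
  then show ?thesis using taylor_at_box[OF t x] by simp
qed

text \<open>The set of points with vanishing germ is open, and so is its complement in the domain,
  as zeros spread over a whole Taylor box. A boundary point \<open>p\<close> is allowed: the open
  set of vanishing germs then meets the domain anyway.\<close>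

lemma real_analytic_identity:
  assumes f: "real_analytic_on f V" and \<Omega>: "open \<Omega>" "connected \<Omega>" "closure \<Omega> \<subseteq> V"
    and p: "p \<in> closure \<Omega>" "\<forall>\<^sub>F x in nhds p. f x = 0"
  shows "\<forall>x\<in>\<Omega>. f x = 0"
proof -
  define Z where "Z = {x. \<forall>\<^sub>F y in nhds x. f y = 0}"
  have oZ: "open Z"
    unfolding Z_def eventually_nhds by (subst open_subopen) blast
  have "\<Omega> \<inter> Z \<noteq> {}"
    using p oZ open_Int_closure_eq_empty[of Z \<Omega>] by (auto simp: Z_def)
  have "open (\<Omega> - Z)"
  proof (subst open_subopen, safe)
    fix x assume x: "x \<in> \<Omega>" "x \<notin> Z"
    then obtain a \<rho> where t: "taylor_at f x a \<rho>"
      using f \<Omega>(3) closure_subset real_analytic_on_iff_taylor by blast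
    have "box_at x \<rho> \<inter> Z = {}"
    proof (rule ccontr)
      assume "box_at x \<rho> \<inter> Z \<noteq> {}"
      then obtain q where "q \<in> box_at x \<rho>" "q \<in> Z" by blast
      then have "\<forall>y\<in>box_at x \<rho>. f y = 0"
        unfolding Z_def using taylor_at_zero_extend[OF t] by blast
      then have "x \<in> Z" unfolding Z_def eventually_nhds
        using open_box_at center_in_box_at[OF taylor_at_pos[OF t]] by blast
      with x show False by simp
    qed
    then show "\<exists>T. open T \<and> x \<in> T \<and> T \<subseteq> \<Omega> - Z"
      using x \<Omega> center_in_box_at[OF taylor_at_pos[OF t]]
      by (intro exI[of _ "\<Omega> \<inter> box_at x \<rho>"]) (auto intro: open_box_at)
  qed
  with \<open>\<Omega> \<inter> Z \<noteq> {}\<close> oZ \<Omega>(2) have "\<Omega> - Z = {}"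
    using connectedD[of \<Omega> Z "\<Omega> - Z"] by blast
  then show ?thesis by (auto simp: Z_def dest!: eventually_nhds_x_imp_x)
qed

text \<open>Carries identities known only inside the domain to the extension: a Taylor box around a
  boundary point meets the domain in an open set. In this way the eigenvalue equation holds in full
  neighbourhoods of boundary points.\<close>

lemma real_analytic_zero_closure:
  assumes f: "real_analytic_on f V" and \<Omega>: "open \<Omega>" "closure \<Omega> \<subseteq> V" and z: "\<forall>x\<in>\<Omega>. f x = 0"
    and p: "p \<in> closure \<Omega>"
  shows "\<forall>\<^sub>F x in nhds p. f x = 0"
proof -
  obtain a \<rho> where t: "taylor_at f p a \<rho>"
    using f \<Omega>(2) p real_analytic_on_iff_taylor by blast
  have pb: "p \<in> box_at p \<rho>" using taylor_at_pos[OF t] by (rule center_in_box_at)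
  then obtain q where q: "q \<in> box_at p \<rho>" "q \<in> \<Omega>"
    using p open_Int_closure_eq_empty[OF open_box_at] by blast
  have "\<forall>\<^sub>F x in nhds q. f x = 0" unfolding eventually_nhds using \<Omega> q z by blast
  then have "\<forall>x\<in>box_at p \<rho>. f x = 0" using taylor_at_zero_extend[OF t q(1)] by blast
  then show ?thesis unfolding eventually_nhds using open_box_at pb by blast
qed

lemma taylor_at_zero_coeff:
  assumes t: "taylor_at f p a \<rho>" and z: "\<forall>\<^sub>F x in nhds p. f x = 0"
  shows "a i j = 0"
proof (rule dps_coeff_0[OF taylor_at_conv[OF t] taylor_at_pos[OF t]])
  fix x y :: real assume xy: "\<bar>x\<bar> < \<rho>" "\<bar>y\<bar> < \<rho>"
  have v: "p + vector [x, y] \<in> box_at p \<rho>" using xy by (auto simp: box_at_def vector_2)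
  show "dps a x y = 0"
    using taylor_at_zero_extend[OF t center_in_box_at[OF taylor_at_pos[OF t]] z v] taylor_at_box[OF t v]
    by (simp add: vector_2)
qed

section \<open>Critical points on the nodal set\<close>

text \<open>Every remaining term has degree above \<open>n\<close>, so for
  \<open>t \<le> \<rho>\<close> replacing \<rho> by \<open>t\<close> gains at least the factor
  \<open>(t / \<rho>) ^ Suc n\<close>.\<close>

lemma dps_leading_form:
  assumes a: "dps_conv a \<rho>" and low: "\<And>i j. i + j < n \<Longrightarrow> a i j = 0"
  obtains M where "0 < M" "\<And>x y t::real. \<bar>x\<bar> \<le> t \<Longrightarrow> \<bar>y\<bar> \<le> t \<Longrightarrow> t \<le> \<rho> \<Longrightarrow>
    \<bar>dps a x y - (\<Sum>j\<le>n. a (n - j) j * x ^ (n - j) * y ^ j)\<bar> \<le> M * t ^ Suc n"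
proof -
  have \<rho>: "0 < \<rho>" using a by (simp add: dps_conv_def)
  define A where "A = (\<Sum>\<^sub>\<infinity>(i, j)\<in>UNIV. \<bar>a i j\<bar> * \<rho> ^ (i + j))"
  have A: "((\<lambda>(i, j). \<bar>a i j\<bar> * \<rho> ^ (i + j)) has_sum A) UNIV"
    using a unfolding A_def dps_conv_def by (intro has_sum_infsum) simp
  have A0: "0 \<le> A" unfolding A_def by (rule infsum_nonneg) (use \<rho> in auto)
  \<comment> \<open>Adding 1 only makes the constant positive.\<close>
  define M where "M = (A + 1) / \<rho> ^ Suc n"
  have M: "0 < M" using A0 \<rho> by (simp add: M_def)
  show ?thesis
  proof (rule that[OF M])
    fix x y t :: real assume xy: "\<bar>x\<bar> \<le> t" "\<bar>y\<bar> \<le> t" "t \<le> \<rho>"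
    have t0: "0 \<le> t" using xy by linarith
    let ?f = "\<lambda>(i, j). a i j * x ^ i * y ^ j"
    let ?T = "(\<lambda>j. (n - j, j)) ` {..n}"
    have f: "(?f has_sum dps a x y) UNIV"
      using dps_has_sum[OF a, of x y] xy by simp
    have "(?f has_sum sum ?f ?T) ?T" by (rule has_sum_finite) simp
    also have "sum ?f ?T = (\<Sum>j\<le>n. a (n - j) j * x ^ (n - j) * y ^ j)"
      by (subst sum.reindex) (auto simp: inj_on_def)
    finally have "((\<lambda>p. if p \<in> ?T then ?f p else 0) has_sum (\<Sum>j\<le>n. a (n - j) j * x ^ (n - j) * y ^ j)) UNIV"
      by (subst has_sum_cong_neutral[where T="?T" and g="?f"]) auto
    from has_sum_add[OF f has_sum_cmult_right[OF this, of "-1"]]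
    have "((\<lambda>p. ?f p - (if p \<in> ?T then ?f p else 0)) has_sum
        dps a x y - (\<Sum>j\<le>n. a (n - j) j * x ^ (n - j) * y ^ j)) UNIV"
      by simp
    moreover have "((\<lambda>p. (t / \<rho>) ^ Suc n * (case p of (i, j) \<Rightarrow> \<bar>a i j\<bar> * \<rho> ^ (i + j))) has_sum
       (t / \<rho>) ^ Suc n * A) UNIV"
      by (rule has_sum_cmult_right[OF A])
    ultimately have "norm (dps a x y - (\<Sum>j\<le>n. a (n - j) j * x ^ (n - j) * y ^ j)) \<le> (t / \<rho>) ^ Suc n * A"
    proof (rule norm_infsum_le)
      fix p :: "nat \<times> nat"
      obtain i j where p: "p = (i, j)" by force
      consider "i + j < n" | "i + j = n" | "i + j > n" by linarith
      then show "norm (?f p - (if p \<in> ?T then ?f p else 0)) \<le>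
          (t / \<rho>) ^ Suc n * (case p of (i, j) \<Rightarrow> \<bar>a i j\<bar> * \<rho> ^ (i + j))"
      proof cases
        case 1
        then show ?thesis using low by (simp add: p)
      next
        case 2
        then have "p \<in> ?T" by (force simp: p image_iff)
        then show ?thesis using t0 \<rho> by (simp add: p)
      next
        case 3
        have "norm (of_real (a i j) * x ^ i * y ^ j) \<le> \<bar>a i j\<bar> * t ^ (i + j)"
          by (rule dps_term_le) (use xy in auto)
        also have "t ^ (i + j) \<le> (t / \<rho>) ^ Suc n * \<rho> ^ (i + j)"
        proof -
          have "t ^ (i + j) = (t / \<rho>) ^ (i + j) * \<rho> ^ (i + j)" using \<rho> by (simp add: power_divide)
          also have "\<dots> \<le> (t / \<rho>) ^ Suc n * \<rho> ^ (i + j)"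
            using \<rho> xy t0 3 by (intro mult_right_mono power_decreasing) auto
          finally show ?thesis .
        qed
        then have "\<bar>a i j\<bar> * t ^ (i + j) \<le> \<bar>a i j\<bar> * ((t / \<rho>) ^ Suc n * \<rho> ^ (i + j))"
          by (intro mult_left_mono) auto
        finally show ?thesis using 3 by (auto simp: p mult_ac)
      qed
    qed
    also have "(t / \<rho>) ^ Suc n * A \<le> (t / \<rho>) ^ Suc n * (A + 1)"
      using t0 \<rho> by (intro mult_left_mono) auto
    also have "\<dots> = M * t ^ Suc n" by (simp add: M_def power_divide)
    finally show "\<bar>dps a x y - (\<Sum>j\<le>n. a (n - j) j * x ^ (n - j) * y ^ j)\<bar> \<le> M * t ^ Suc n" by simp
  qed
qed

text \<open>The binomial coefficients of the homogeneous harmonic polynomial of degree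
  \<open>n\<close> with complex factor \<open>c\<close>; leading Taylor coefficients are matched
  against them.\<close>

lemma Re_power_Complex:
  "Re (c * Complex x y ^ n) = (\<Sum>j\<le>n. real (n choose j) * Re (c * \<i> ^ j) * x ^ (n - j) * y ^ j)"
proof -
  have "Complex x y ^ n = (\<i> * complex_of_real y + complex_of_real x) ^ n"
    by (simp add: Complex_eq add.commute)
  also have "\<dots> = (\<Sum>j\<le>n. of_nat (n choose j) * (\<i> * complex_of_real y) ^ j * complex_of_real x ^ (n - j))"
    by (rule binomial_ring)
  finally have "c * Complex x y ^ n =
     (\<Sum>j\<le>n. c * (of_nat (n choose j) * (\<i> * complex_of_real y) ^ j * complex_of_real x ^ (n - j)))"
    by (simp add: sum_distrib_left)
  also have "\<dots> = (\<Sum>j\<le>n. complex_of_real (real (n choose j) * x ^ (n - j) * y ^ j) * (c * \<i> ^ j))"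
    by (rule sum.cong) (auto simp: power_mult_distrib mult_ac)
  also have "Re \<dots> = (\<Sum>j\<le>n. real (n choose j) * Re (c * \<i> ^ j) * x ^ (n - j) * y ^ j)"
    unfolding Re_sum by (rule sum.cong) (auto simp del: of_real_mult of_real_power)
  finally show ?thesis .
qed

lemma dps_leading_harmonic:
  assumes a: "dps_conv a \<rho>" and low: "\<And>i j. i + j < n \<Longrightarrow> a i j = 0"
    and lead: "\<And>j. j \<le> n \<Longrightarrow> a (n - j) j = real (n choose j) * Re (c * \<i> ^ j)"
  obtains M where "0 < M" "\<And>x y. cmod (Complex x y) \<le> \<rho> \<Longrightarrow>
    \<bar>dps a x y - Re (c * Complex x y ^ n)\<bar> \<le> M * cmod (Complex x y) ^ Suc n"
proof -
  obtain M where M: "0 < M" "\<And>x y t::real. \<bar>x\<bar> \<le> t \<Longrightarrow> \<bar>y\<bar> \<le> t \<Longrightarrow> t \<le> \<rho> \<Longrightarrow>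
    \<bar>dps a x y - (\<Sum>j\<le>n. a (n - j) j * x ^ (n - j) * y ^ j)\<bar> \<le> M * t ^ Suc n"
    using dps_leading_form[OF a low] by blast
  show ?thesis
  proof (rule that[OF M(1)])
    fix x y assume "cmod (Complex x y) \<le> \<rho>"
    moreover have "\<bar>x\<bar> \<le> cmod (Complex x y)" "\<bar>y\<bar> \<le> cmod (Complex x y)"
      using abs_Re_le_cmod[of "Complex x y"] abs_Im_le_cmod[of "Complex x y"] by auto
    moreover have "(\<Sum>j\<le>n. a (n - j) j * x ^ (n - j) * y ^ j) = Re (c * Complex x y ^ n)"
      unfolding Re_power_Complex by (rule sum.cong) (auto simp: lead)
    ultimately show "\<bar>dps a x y - Re (c * Complex x y ^ n)\<bar> \<le> M * cmod (Complex x y) ^ Suc n"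
      using M(2)[of x "cmod (Complex x y)" y] by simp
  qed
qed

text \<open>In lowest order, the equation says that the leading form is harmonic.\<close>

lemma harmonic_leading_coefficients:
  assumes rec: "\<And>i j. dps_dx (dps_dx a) i j + dps_dy (dps_dy a) i j + c * a i j = 0"
    and nz: "a i0 j0 \<noteq> 0" and a0: "a 0 0 = 0"
  obtains n d where "0 < n" "d \<noteq> 0" "\<And>i j. i + j < n \<Longrightarrow> a i j = 0"
    "\<And>j. j \<le> n \<Longrightarrow> a (n - j) j = real (n choose j) * Re (d * \<i> ^ j)"
proof -
  define n where "n = (LEAST n. \<exists>i j. i + j = n \<and> a i j \<noteq> 0)"
  have "\<exists>i j. i + j = n \<and> a i j \<noteq> 0"
    unfolding n_def by (rule LeastI[of _ "i0 + j0"]) (use nz in blast)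
  then obtain i1 j1 where ij: "i1 + j1 = n" "a i1 j1 \<noteq> 0" by blast
  have low: "a i j = 0" if "i + j < n" for i j
    using not_less_Least[OF that[unfolded n_def]] by blast
  have n: "0 < n" using ij a0 by (cases "n = 0") auto
  \<comment> \<open>Real and imaginary part are chosen to match the coefficients for
    \<open>j = 0\<close> and \<open>j = 1\<close>, where \<open>Re (d * \<i>) = - Im d\<close> and
    the binomial coefficient is \<open>n\<close>. The recurrence in steps of two fixes the
    rest.\<close>
  define d where "d = Complex (a n 0) (- (a (n - 1) 1 / real n))"
  have lead: "j \<le> n \<longrightarrow> a (n - j) j = real (n choose j) * Re (d * \<i> ^ j)" for j
  proof (induction j rule: induct_nat_012)
    case (ge2 j)
    show ?case
    proof
      assume j: "Suc (Suc j) \<le> n"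
      define i where "i = n - Suc (Suc j)"
      have i: "n = i + j + 2" using j by (simp add: i_def)
      have bin: "real (Suc (Suc j)) * (real (Suc j) * real (n choose Suc (Suc j)))
          = real (Suc i) * (real (Suc (Suc i)) * real (n choose j))"
      proof -
        have 1: "Suc k * (n choose Suc k) = (n - k) * (n choose k)" for k
          using binomial_absorption[of k n] binomial_absorb_comp[of n k] by simp
        have "Suc (Suc j) * (n choose Suc (Suc j)) = Suc i * (n choose Suc j)"
          using 1[of "Suc j"] i by simp
        moreover have "Suc j * (n choose Suc j) = Suc (Suc i) * (n choose j)"
          using 1[of j] i by simp
        ultimately have "Suc (Suc j) * (Suc j * (n choose Suc (Suc j))) = Suc i * (Suc (Suc i) * (n choose j))"
          by (metis mult.left_commute)
        then show ?thesis by (metis of_nat_mult)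
      qed
      \<comment> \<open>Here \<open>i + j = n - 2\<close>, so the term of order zero drops out and
        the recurrence is that of the Laplace equation.\<close>
      have "a i j = 0" using i by (intro low) simp
      with rec[of i j] have "real (Suc (Suc j)) * (real (Suc j) * a i (Suc (Suc j)))
          = - (real (Suc i) * (real (Suc (Suc i)) * a (Suc (Suc i)) j))"
        by (simp add: dps_dx_def dps_dy_def algebra_simps)
      also have "a (Suc (Suc i)) j = real (n choose j) * Re (d * \<i> ^ j)"
        using ge2.IH(1) i by (simp add: numeral_2_eq_2)
      also have "- (real (Suc i) * (real (Suc (Suc i)) * (real (n choose j) * Re (d * \<i> ^ j))))
          = real (Suc (Suc j)) * (real (Suc j) * (real (n choose Suc (Suc j)) * Re (d * \<i> ^ Suc (Suc j))))"
      proof -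
        have "Re (d * \<i> ^ Suc (Suc j)) = - Re (d * \<i> ^ j)" by (simp add: algebra_simps)
        then show ?thesis using bin by (simp only: mult.assoc[symmetric])
      qed
      finally have "a i (Suc (Suc j)) = real (n choose Suc (Suc j)) * Re (d * \<i> ^ Suc (Suc j))"
        by (simp only: mult_cancel_left of_nat_eq_0_iff nat.distinct simp_thms)
      then show "a (n - Suc (Suc j)) (Suc (Suc j)) = real (n choose Suc (Suc j)) * Re (d * \<i> ^ Suc (Suc j))"
        by (simp only: i_def)
    qed
  qed (use n in \<open>auto simp: d_def\<close>)
  have "d \<noteq> 0" using lead[of j1] ij by auto
  then show ?thesis using that n low lead by blast
qed

lemma Complex_neq_0_iff: "Complex x y \<noteq> 0 \<longleftrightarrow> (x, y) \<noteq> (0, 0)"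
  by (simp add: complex_eq_iff)

text \<open>With leading form the real part of \<open>d * z ^ n\<close>, the gradient has modulus
  about \<open>n * cmod d * cmod z ^ (n - 1)\<close>, which beats an error of order
  \<open>n\<close>. Both signs occur because \<open>d * z ^ n\<close> is positive along one ray and
  negative along another.\<close>

lemma dps_nodal_critical:
  assumes a: "dps_conv a \<rho>"
    and rec: "\<And>i j. dps_dx (dps_dx a) i j + dps_dy (dps_dy a) i j + c * a i j = 0"
    and nz: "a i0 j0 \<noteq> 0" and a0: "a 0 0 = 0"
  shows "\<exists>\<epsilon>>0. \<forall>x y. (x, y) \<noteq> (0, 0) \<longrightarrow> cmod (Complex x y) < \<epsilon> \<longrightarrow>
      dps (dps_dx a) x y \<noteq> 0 \<or> dps (dps_dy a) x y \<noteq> 0" (is ?isol)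
    and "0 < \<delta> \<Longrightarrow> s = 1 \<or> s = -1 \<Longrightarrow> \<exists>x y. cmod (Complex x y) < \<delta> \<and> 0 < s * dps a x y"
proof -
  obtain n d where n: "0 < n" and d: "d \<noteq> 0" and low: "\<And>i j. i + j < n \<Longrightarrow> a i j = 0"
    and lead: "\<And>j. j \<le> n \<Longrightarrow> a (n - j) j = real (n choose j) * Re (d * \<i> ^ j)"
    using harmonic_leading_coefficients[of a c, OF rec nz a0] by blast
  obtain m where m: "n = Suc m" using n by (cases n) auto
  have \<rho>: "0 < \<rho>" using a by (simp add: dps_conv_def)
  define \<sigma> where "\<sigma> = \<rho> / 2"
  have \<sigma>: "0 < \<sigma>" "\<sigma> < \<rho>" using \<rho> by (auto simp: \<sigma>_def)
  \<comment> \<open>The partial derivatives of the leading form are the real parts of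
    \<open>e * z ^ m\<close> and of \<open>e * \<i> * z ^ m\<close>.\<close>
  define e where "e = of_nat n * d"
  obtain M where M: "0 < M" "\<And>x y. cmod (Complex x y) \<le> \<rho> \<Longrightarrow>
    \<bar>dps a x y - Re (d * Complex x y ^ n)\<bar> \<le> M * cmod (Complex x y) ^ Suc n"
    using dps_leading_harmonic[OF a low lead] by blast
  have low_dx: "dps_dx a i j = 0" if "i + j < m" for i j using that low m by (simp add: dps_dx_def)
  have lead_dx: "dps_dx a (m - j) j = real (m choose j) * Re (e * \<i> ^ j)" if "j \<le> m" for j
  proof -
    have "dps_dx a (m - j) j = real (n - j) * real (n choose j) * Re (d * \<i> ^ j)"
      using lead[of j] that m by (simp add: dps_dx_def Suc_diff_le)
    also have "real (n - j) * real (n choose j) = real n * real (m choose j)"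
      using binomial_absorb_comp[of n j] m by (metis diff_Suc_1 of_nat_mult)
    finally show ?thesis by (simp add: e_def algebra_simps)
  qed
  obtain M1 where M1: "0 < M1" "\<And>x y. cmod (Complex x y) \<le> \<sigma> \<Longrightarrow>
    \<bar>dps (dps_dx a) x y - Re (e * Complex x y ^ m)\<bar> \<le> M1 * cmod (Complex x y) ^ Suc m"
    using dps_leading_harmonic[OF dps_conv_dx[OF a \<sigma>] low_dx lead_dx] by blast
  have low_dy: "dps_dy a i j = 0" if "i + j < m" for i j using that low m by (simp add: dps_dy_def)
  have lead_dy: "dps_dy a (m - j) j = real (m choose j) * Re (e * \<i> * \<i> ^ j)" if "j \<le> m" for j
  proof -
    have "dps_dy a (m - j) j = real (Suc j) * real (n choose Suc j) * Re (d * \<i> ^ Suc j)"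
      using lead[of "Suc j"] that m by (simp add: dps_dy_def)
    also have "real (Suc j) * real (n choose Suc j) = real n * real (m choose j)"
      using binomial_absorption[of j n] m by (metis diff_Suc_1 of_nat_mult)
    finally show ?thesis by (simp add: e_def algebra_simps)
  qed
  obtain M2 where M2: "0 < M2" "\<And>x y. cmod (Complex x y) \<le> \<sigma> \<Longrightarrow>
    \<bar>dps (dps_dy a) x y - Re ((e * \<i>) * Complex x y ^ m)\<bar> \<le> M2 * cmod (Complex x y) ^ Suc m"
    using dps_leading_harmonic[OF dps_conv_dy[OF a \<sigma>] low_dy lead_dy] by blast
  have e0: "0 < cmod e" using d n by (simp add: e_def norm_mult)
  show ?isol
  proof (intro exI[of _ "min \<sigma> (cmod e / (M1 + M2))"] conjI allI impI)
    show "0 < min \<sigma> (cmod e / (M1 + M2))" using \<sigma> e0 M1 M2 by simp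
    fix x y assume nz: "(x, y) \<noteq> (0, 0)" and small: "cmod (Complex x y) < min \<sigma> (cmod e / (M1 + M2))"
    define z where "z = Complex x y"
    have z: "0 < cmod z" using nz by (simp add: z_def Complex_neq_0_iff del: Complex_eq_0)
    show "dps (dps_dx a) x y \<noteq> 0 \<or> dps (dps_dy a) x y \<noteq> 0"
    proof (rule ccontr)
      assume "\<not> ?thesis"
      then have "\<bar>Re (e * z ^ m)\<bar> \<le> M1 * cmod z ^ Suc m" "\<bar>Re ((e * \<i>) * z ^ m)\<bar> \<le> M2 * cmod z ^ Suc m"
        using M1(2)[of x y] M2(2)[of x y] small by (auto simp: z_def)
      \<comment> \<open>The two partial derivatives of the leading form are, up to sign, the real
        and imaginary part of one complex number, so together they control its modulus.\<close>
      moreover have "Re ((e * \<i>) * z ^ m) = - Im (e * z ^ m)" by (simp add: algebra_simps)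
      ultimately have "cmod (e * z ^ m) \<le> M1 * cmod z ^ Suc m + M2 * cmod z ^ Suc m"
        using cmod_le[of "e * z ^ m"] by linarith
      then have "cmod e * cmod z ^ m \<le> (M1 + M2) * cmod z * cmod z ^ m"
        by (simp add: norm_mult norm_power algebra_simps)
      then have "cmod e \<le> (M1 + M2) * cmod z" using z by (simp add: mult_le_cancel_right)
      moreover have "(M1 + M2) * cmod z < cmod e"
        using small M1 M2 by (simp add: z_def pos_less_divide_eq mult.commute)
      ultimately show False by simp
    qed
  qed
  show "\<exists>x y. cmod (Complex x y) < \<delta> \<and> 0 < s * dps a x y"
    if \<delta>: "0 < \<delta>" and s: "s = 1 \<or> s = -1"
  proof -
    \<comment> \<open>The angle that turns \<open>d * cis \<theta> ^ n\<close> into the positive or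
      the negative real number of modulus \<open>cmod d\<close>.\<close>
    define \<theta> where "\<theta> = (if s = 1 then - Arg d / real n else (pi - Arg d) / real n)"
    have dth: "d * cis \<theta> ^ n = complex_of_real (s * cmod d)"
    proof -
      have "d * cis \<theta> ^ n = complex_of_real (cmod d) * (cis (Arg d) * cis (real n * \<theta>))"
        using rcis_cmod_Arg[of d] by (simp add: rcis_def Complex.DeMoivre flip: mult.assoc)
      also have "cis (Arg d) * cis (real n * \<theta>) = complex_of_real s"
        using s n by (auto simp: cis_mult \<theta>_def)
      finally show ?thesis by simp
    qed
    define t where "t = min (\<delta> / 2) (min \<rho> (cmod d / (2 * M)))"
    have t: "0 < t" "t < \<delta>" "t \<le> \<rho>" "M * t < cmod d"
    proof -
      have d0: "0 < cmod d" using d by simp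
      show "0 < t" "t < \<delta>" "t \<le> \<rho>" using \<delta> \<rho> d M by (auto simp: t_def)
      have "t \<le> cmod d / (2 * M)" by (simp add: t_def)
      then have "M * t \<le> cmod d / 2" using M by (simp add: field_simps)
      then show "M * t < cmod d" using d0 by linarith
    qed
    define z where "z = complex_of_real t * cis \<theta>"
    have zC: "Complex (Re z) (Im z) = z" by simp
    have cz: "cmod z = t" using t by (simp add: z_def norm_mult)
    have "d * z ^ n = complex_of_real (t ^ n) * (d * cis \<theta> ^ n)"
      by (simp add: z_def power_mult_distrib mult_ac)
    also have "\<dots> = complex_of_real (t ^ n * (s * cmod d))" unfolding dth by simp
    finally have "Re (d * z ^ n) = t ^ n * (s * cmod d)" by (metis Re_complex_of_real)
    then have *: "\<bar>dps a (Re z) (Im z) - t ^ n * (s * cmod d)\<bar> \<le> M * t ^ Suc n"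
      using M(2)[of "Re z" "Im z"] cz t by simp
    have "M * t ^ Suc n < t ^ n * cmod d" using t by simp
    then have "0 < s * dps a (Re z) (Im z)" using * s by auto
    then show ?thesis using cz t zC by metis
  qed
qed

lemma cmod_Complex_diff: "cmod (Complex (x $ 1 - p $ 1) (x $ 2 - p $ 2)) = dist (x :: real^2) p"
  by (simp add: cmod_def dist_norm norm_vec_def L2_set_def sum_2)

text \<open>The gradient at \<open>p\<close> may be nonzero; the leading degree is then 1.
  Non-vanishing of the germ provides a nonzero coefficient, and the equation near \<open>p\<close>
  becomes a recurrence for the coefficients.\<close>

lemma nodal_critical_point:
  assumes f: "real_analytic_on f V" and p: "p \<in> V"
    and eq: "\<forall>\<^sub>F x in nhds p. laplacian f x + c * f x = 0"
    and nz: "\<not> (\<forall>\<^sub>F x in nhds p. f x = 0)" and fp: "f p = 0"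
  shows "\<exists>\<epsilon>>0. \<forall>x\<in>ball p \<epsilon>. x \<noteq> p \<longrightarrow> grad f x \<noteq> 0"
    and "s = 1 \<or> s = -1 \<Longrightarrow> \<not> (\<forall>\<^sub>F x in nhds p. s * f x \<le> 0)"
proof -
  obtain a \<rho> where t: "taylor_at f p a \<rho>" using f p real_analytic_on_iff_taylor by blast
  have \<rho>: "0 < \<rho>" using taylor_at_pos[OF t] .
  have rec: "dps_dx (dps_dx a) i j + dps_dy (dps_dy a) i j + c * a i j = 0" for i j
    using taylor_at_zero_coeff[OF taylor_at_helmholtz[OF t, of "\<rho> / 2" c] eq] \<rho> by simp
  have a0: "a 0 0 = 0"
    using taylor_at_box[OF t center_in_box_at[OF \<rho>]] fp by simp
  have "\<exists>i j. a i j \<noteq> 0"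
  proof (rule ccontr)
    assume "\<not> ?thesis"
    then have "f x = 0" if "x \<in> box_at p \<rho>" for x
      using taylor_at_box[OF t that] by (simp add: dps_def case_prod_unfold)
    then show False using nz open_box_at center_in_box_at[OF \<rho>] unfolding eventually_nhds by blast
  qed
  then obtain i0 j0 where ij: "a i0 j0 \<noteq> 0" by blast
  note * = dps_nodal_critical[OF taylor_at_conv[OF t] rec ij a0]
  have vec: "\<exists>v::real^2. v $ 1 - p $ 1 = x \<and> v $ 2 - p $ 2 = y" for x y
    by (rule exI[of _ "p + vector [x, y]"]) (simp add: vector_2)
  have box: "x \<in> box_at p \<rho>" if "dist x p < \<rho>" for x
    using that ball_subset_box_at[of p \<rho>] by (auto simp: dist_commute)
  obtain \<epsilon> where \<epsilon>: "\<epsilon> > 0" "\<And>x y. (x, y) \<noteq> (0, 0) \<Longrightarrow> cmod (Complex x y) < \<epsilon> \<Longrightarrow>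
      dps (dps_dx a) x y \<noteq> 0 \<or> dps (dps_dy a) x y \<noteq> 0" using *(1) by blast
  show "\<exists>\<epsilon>>0. \<forall>x\<in>ball p \<epsilon>. x \<noteq> p \<longrightarrow> grad f x \<noteq> 0"
  proof (intro exI[of _ "min \<epsilon> \<rho>"] conjI ballI impI)
    fix x assume x: "x \<in> ball p (min \<epsilon> \<rho>)" "x \<noteq> p"
    have "(x $ 1 - p $ 1, x $ 2 - p $ 2) \<noteq> (0, 0)"
      using x(2) by (auto simp: vec_eq_iff forall_2)
    moreover have "cmod (Complex (x $ 1 - p $ 1) (x $ 2 - p $ 2)) < \<epsilon>"
      using x by (simp add: cmod_Complex_diff dist_commute)
    ultimately have "partial_deriv 1 f x \<noteq> 0 \<or> partial_deriv 2 f x \<noteq> 0"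
      using \<epsilon>(2) taylor_at_partial_deriv[OF t box, of x] x by (simp add: dist_commute)
    then show "grad f x \<noteq> 0" by (auto simp: grad_def vec_eq_iff)
  qed (use \<epsilon> \<rho> in auto)
  show "\<not> (\<forall>\<^sub>F x in nhds p. s * f x \<le> 0)" if s: "s = 1 \<or> s = -1"
  proof
    assume "\<forall>\<^sub>F x in nhds p. s * f x \<le> 0"
    then obtain d where d: "d > 0" "\<And>x. dist x p < d \<Longrightarrow> s * f x \<le> 0"
      unfolding eventually_nhds_metric by blast
    have "0 < min d \<rho>" using d \<rho> by simp
    from *(2)[OF this s] obtain x y where xy: "cmod (Complex x y) < min d \<rho>" "0 < s * dps a x y" by blast
    obtain v :: "real^2" where v: "v $ 1 - p $ 1 = x" "v $ 2 - p $ 2 = y" using vec by blast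
    show False using d(2)[of v] taylor_at_box[OF t box, of v] xy cmod_Complex_diff[of v p] v by simp
  qed
qed

section \<open>Valleys of critical points\<close>

lemma dps_continuous_on:
  fixes S :: "('a::{real_normed_field,banach} \<times> 'a) set"
  assumes "dps_conv b \<rho>" "\<And>p. p \<in> S \<Longrightarrow> norm (fst p) < \<rho> \<and> norm (snd p) < \<rho>"
  shows "continuous_on S (\<lambda>p. dps b (fst p) (snd p))"
proof (rule continuous_at_imp_continuous_on, rule ballI)
  fix p assume "p \<in> S"
  then show "isCont (\<lambda>p. dps b (fst p) (snd p)) p"
    using has_derivative_continuous[OF dps_has_derivative[OF assms(1), of "fst p" "snd p"]] assms(2) by simp
qed

text \<open>The inverse function theorem is applied to the map sending \<open>(z, w)\<close> to
  \<open>(z, dps G z w)\<close>; \<open>Y z\<close> is the second component of the local inverse at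
  \<open>(z, 0)\<close>.\<close>

lemma holomorphic_implicit_function:
  assumes G: "dps_conv G \<rho>" and G0: "G 0 0 = 0" and G1: "dps_dy G 0 0 \<noteq> 0"
  obtains \<delta> \<eta> Y Y' where "0 < \<delta>" "0 < \<eta>" "\<delta> \<le> \<eta>" "\<eta> < \<rho>" "Y 0 = (0::complex)"
    "\<And>z. cmod z < \<delta> \<Longrightarrow> (Y has_field_derivative Y' z) (at z)"
    "\<And>z. cmod z < \<delta> \<Longrightarrow> cmod (Y z) < \<eta> \<and> dps G z (Y z) = 0"
    "\<And>z w. cmod z < \<delta> \<Longrightarrow> cmod w < \<eta> \<Longrightarrow> dps G z w = 0 \<Longrightarrow> w = Y z"
proof -
  have \<rho>: "0 < \<rho>" using G by (simp add: dps_conv_def)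
  define \<sigma> where "\<sigma> = \<rho> / 2"
  have \<sigma>: "0 < \<sigma>" "\<sigma> < \<rho>" using \<rho> by (auto simp: \<sigma>_def)
  define U where "U = (ball 0 \<sigma> :: complex set) \<times> (ball 0 \<sigma> :: complex set)"
  have U: "open U" "(0, 0) \<in> U" using \<sigma> by (auto simp: U_def open_Times)
  define f where "f = (\<lambda>p::complex\<times>complex. (fst p, dps G (fst p) (snd p)))"
  define Gz Gw where "Gz = (\<lambda>p::complex\<times>complex. dps (dps_dx G) (fst p) (snd p))"
    and "Gw = (\<lambda>p::complex\<times>complex. dps (dps_dy G) (fst p) (snd p))"
  have bl: "bounded_linear (\<lambda>h::complex\<times>complex. (fst h, A * fst h + B * snd h))" for A B
    by (intro bounded_linear_Pair bounded_linear_add bounded_linear_fst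
        bounded_linear_const_mult bounded_linear_snd)
  define f' where "f' = (\<lambda>p. Blinfun (\<lambda>h::complex\<times>complex. (fst h, Gz p * fst h + Gw p * snd h)))"
  have f'_apply: "blinfun_apply (f' p) h = (fst h, Gz p * fst h + Gw p * snd h)" for p h
    unfolding f'_def by (simp add: bounded_linear_Blinfun_apply[OF bl])
  have der: "(f has_derivative blinfun_apply (f' p)) (at p)" if "p \<in> U" for p
  proof -
    have "((\<lambda>q. dps G (fst q) (snd q)) has_derivative
      (\<lambda>h. dps (dps_dx G) (fst p) (snd p) * fst h + dps (dps_dy G) (fst p) (snd p) * snd h)) (at (fst p, snd p))"
      by (rule dps_has_derivative[OF G]) (use that \<sigma> in \<open>auto simp: U_def\<close>)
    then have "(f has_derivative (\<lambda>h. (fst h, Gz p * fst h + Gw p * snd h))) (at p)"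
      unfolding f_def Gz_def Gw_def by (intro has_derivative_Pair) (auto intro!: derivative_eq_intros)
    then show ?thesis by (simp add: f'_apply[abs_def])
  qed
  have cont: "continuous_on U f'"
  proof (rule continuous_on_blinfun_componentwise)
    fix i :: "complex \<times> complex"
    have "continuous_on U Gz" "continuous_on U Gw" unfolding Gz_def Gw_def
      using dps_conv_dx[OF G \<sigma>] dps_conv_dy[OF G \<sigma>] by (auto intro!: dps_continuous_on[where \<rho>=\<sigma>] simp: U_def)
    then show "continuous_on U (\<lambda>x. blinfun_apply (f' x) i)"
      unfolding f'_apply by (intro continuous_intros)
  qed
  have Gw0: "Gw (0, 0) \<noteq> 0" using G1 by (simp add: Gw_def)
  define invf where "invf = Blinfun (\<lambda>h::complex\<times>complex. (fst h, (- Gz (0, 0) / Gw (0, 0)) * fst h + (1 / Gw (0, 0)) * snd h))"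
  have invf_apply: "blinfun_apply invf h = (fst h, (- Gz (0, 0) / Gw (0, 0)) * fst h + (1 / Gw (0, 0)) * snd h)" for h
    unfolding invf_def by (simp only: bounded_linear_Blinfun_apply[OF bl])
  have inv: "invf o\<^sub>L f' (0, 0) = id_blinfun"
    by (rule blinfun_eqI) (use Gw0 in \<open>auto simp: invf_apply f'_apply field_simps\<close>)
  obtain U' V g g' where U': "open U'" "U' \<subseteq> U" "(0, 0) \<in> U'" and V: "open V" "f (0, 0) \<in> V"
    and hom: "homeomorphism U' V f g"
    and g': "\<And>y. y \<in> V \<Longrightarrow> (g has_derivative (g' y)) (at y)"
      "\<And>y. y \<in> V \<Longrightarrow> g' y = Hilbert_Choice.inv (blinfun_apply (f'(g y)))"
      "\<And>y. y \<in> V \<Longrightarrow> bij (blinfun_apply (f'(g y)))"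
    using inverse_function_theorem[OF U(1) der cont U(2) inv] by metis
  have f0: "f (0, 0) = (0, 0)" using G0 by (simp add: f_def)
  have gf: "g (f p) = p" if "p \<in> U'" for p using hom that by (simp add: homeomorphism_def)
  have fg: "f (g q) = q" if "q \<in> V" for q using hom that by (simp add: homeomorphism_def)
  obtain e where e: "0 < e" "ball (0, 0) e \<subseteq> U'" using U' open_contains_ball by blast
  \<comment> \<open>Half of \<open>e\<close>, since the distance of a pair from the origin is
    estimated by the sum of the two moduli.\<close>
  define \<eta> where "\<eta> = min e \<sigma> / 2"
  have \<eta>: "0 < \<eta>" "\<eta> < \<sigma>" using e \<sigma> by (auto simp: \<eta>_def)
  have inU': "(z, w) \<in> U'" if "cmod z < \<eta>" "cmod w < \<eta>" for z w
  proof -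
    have "dist (0, 0) (z, w) \<le> cmod z + cmod w"
      using sqrt_sum_squares_le_sum[of "cmod z" "cmod w"] by (simp add: dist_Pair_Pair)
    also have "\<dots> < e" using that \<eta> by (auto simp: \<eta>_def)
    finally show ?thesis using e by auto
  qed
  define Y where "Y = (\<lambda>z. snd (g (z, 0)))"
  have V0: "(0, 0) \<in> V" using V f0 by simp
  have "isCont g (0, 0)" using g'(1)[OF V0] has_derivative_continuous by blast
  moreover have "g (0, 0) = (0, 0)" using gf[OF U'(3)] f0 by simp
  ultimately obtain d1 where d1: "0 < d1" "\<And>q. dist q (0, 0) < d1 \<Longrightarrow> dist (g q) (0, 0) < \<eta>"
    unfolding continuous_at_eps_delta using \<eta> by metis
  obtain d2 where d2: "0 < d2" "ball (0, 0) d2 \<subseteq> V" using V V0 open_contains_ball by blast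
  define \<delta> where "\<delta> = min d1 (min d2 \<eta>)"
  have \<delta>: "0 < \<delta>" "\<delta> \<le> \<eta>" "\<delta> \<le> d1" "\<delta> \<le> d2" using d1 d2 \<eta> by (auto simp: \<delta>_def)
  have inV: "(z, 0) \<in> V" if "cmod z < \<delta>" for z
  proof -
    have "dist (0, 0) (z, 0::complex) < d2" using that \<delta> by (simp add: dist_Pair_Pair dist_norm)
    then show ?thesis using d2 by (meson in_mono mem_ball)
  qed
  have gY: "g (z, 0) = (z, Y z)" and GY: "dps G z (Y z) = 0" if "cmod z < \<delta>" for z
  proof -
    have "f (g (z, 0)) = (z, 0)" using fg inV that by blast
    then have 1: "fst (g (z, 0)) = z" "dps G (fst (g (z, 0))) (snd (g (z, 0))) = 0" by (auto simp: f_def)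
    then show "g (z, 0) = (z, Y z)" "dps G z (Y z) = 0" by (auto simp: Y_def prod_eq_iff)
  qed
  have Yb: "cmod (Y z) < \<eta>" if "cmod z < \<delta>" for z
  proof -
    have "dist (g (z, 0)) (0, 0) < \<eta>"
      using that \<delta> by (intro d1) (simp add: dist_Pair_Pair dist_norm)
    then show ?thesis
      using norm_snd_le[of "Y z" z] by (simp add: gY[OF that] dist_norm flip: zero_prod_def)
  qed
  \<comment> \<open>Implicit differentiation. The inverse function theorem gives only a real-linear
    derivative; that it is multiplication by this complex number makes \<open>Y\<close>
    holomorphic.\<close>
  define Y' where "Y' = (\<lambda>z. - Gz (z, Y z) / Gw (z, Y z))"
  have derY: "(Y has_field_derivative Y' z) (at z)" if z: "cmod z < \<delta>" for z
  proof -
    let ?L = "blinfun_apply (f' (z, Y z))"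
    have b: "bij ?L" using g'(3)[OF inV[OF z]] gY[OF z] by simp
    have Gw: "Gw (z, Y z) \<noteq> 0"
    proof
      assume "Gw (z, Y z) = 0"
      then have "?L (0, 1) = ?L (0, 0)" by (simp add: f'_apply)
      then show False using b unfolding bij_def inj_def by (metis prod.inject zero_neq_one)
    qed
    have "((\<lambda>z. (z, 0::complex)) has_derivative (\<lambda>h. (h, 0))) (at z)"
      by (auto intro!: derivative_eq_intros)
    from has_derivative_compose[OF this, of g "g' (z, 0)"] g'(1)[OF inV[OF z]]
    have "((\<lambda>z. g (z, 0)) has_derivative (\<lambda>h. g' (z, 0) (h, 0))) (at z)" by simp
    then have "(Y has_derivative (\<lambda>h. snd (g' (z, 0) (h, 0)))) (at z)"
      unfolding Y_def by (rule has_derivative_snd)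
    moreover have "snd (g' (z, 0) (h, 0)) = Y' z * h" for h
    proof -
      have "?L (h, Y' z * h) = (h, 0)" using Gw by (simp add: f'_apply Y'_def)
      then have "Hilbert_Choice.inv ?L (h, 0) = (h, Y' z * h)"
        using b by (metis bij_inv_eq_iff)
      then show ?thesis using g'(2)[OF inV[OF z]] gY[OF z] by simp
    qed
    ultimately show ?thesis by (simp add: has_field_derivative_def)
  qed
  have uniq: "w = Y z" if "cmod z < \<delta>" "cmod w < \<eta>" "dps G z w = 0" for z w
  proof -
    have "g (f (z, w)) = (z, w)" using that \<delta> by (intro gf inU') auto
    then show ?thesis using that by (simp add: f_def Y_def)
  qed
  have "Y 0 = 0" using \<open>g (0, 0) = (0, 0)\<close> by (simp add: Y_def)
  with \<delta> \<eta> \<sigma> derY Yb GY uniq show ?thesis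
    by (intro that[of \<delta> \<eta> Y Y']) auto
qed

text \<open>Subtracting the parabola \<open>c / 2 * y\<close> squared leaves a convex function,
  which lies above its tangents.\<close>

lemma strongly_convex_above_tangent:
  fixes k :: "real \<Rightarrow> real"
  assumes S: "convex S" and k: "\<And>y. y \<in> S \<Longrightarrow> (k has_real_derivative k' y) (at y)"
    and k': "\<And>y. y \<in> S \<Longrightarrow> (k' has_real_derivative k'' y) (at y)"
    and c: "\<And>y. y \<in> S \<Longrightarrow> c \<le> k'' y" and xy: "x \<in> S" "y \<in> S"
  shows "k x + k' x * (y - x) + c / 2 * (y - x)\<^sup>2 \<le> k y"
proof -
  have "(k' x - c * x) * (y - x) \<le> (k y - c / 2 * y\<^sup>2) - (k x - c / 2 * x\<^sup>2)"
  proof (rule f''_imp_f'[where f="\<lambda>y. k y - c / 2 * y\<^sup>2" and f'="\<lambda>y. k' y - c * y" and f''="\<lambda>y. k'' y - c"])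
    show "((\<lambda>y. k y - c / 2 * y\<^sup>2) has_real_derivative k' y - c * y) (at y)" if "y \<in> S" for y
      using k[OF that] by (auto intro!: derivative_eq_intros)
    show "((\<lambda>y. k' y - c * y) has_real_derivative k'' y - c) (at y)" if "y \<in> S" for y
      using k'[OF that] by (auto intro!: derivative_eq_intros)
  qed (use S c xy in auto)
  then show ?thesis by (simp add: power2_eq_square algebra_simps)
qed

text \<open>If critical points accumulate, then they do so along an analytic arc, the zero set of the
  partial derivative in the second variable; by the identity theorem the function is constant on that arc, and
  strict convexity across the arc turns it into a valley.\<close>

lemma dps_valley:
  assumes a: "dps_conv a \<rho>" and G0: "dps_dy a 0 0 = 0" and pos: "dps_dy (dps_dy a) 0 0 > 0"
    and acc: "\<And>\<delta>. 0 < \<delta> \<Longrightarrow> \<exists>x y::real. (x, y) \<noteq> (0, 0) \<and> \<bar>x\<bar> < \<delta> \<and> \<bar>y\<bar> < \<delta> \<and>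
      dps (dps_dx a) x y = 0 \<and> dps (dps_dy a) x y = 0"
  shows "\<exists>\<epsilon>>0. \<exists>c>0. \<forall>x y. \<bar>x\<bar> < \<epsilon> \<longrightarrow> \<bar>y\<bar> < \<epsilon> \<longrightarrow>
    a 0 0 \<le> dps a x y \<and> c * (dps a x y - a 0 0) \<le> (dps (dps_dy a) x y)\<^sup>2"
proof -
  have \<rho>: "0 < \<rho>" using a by (simp add: dps_conv_def)
  have Fc: "dps_conv (dps_dx a) (\<rho> / 2)" and Gc: "dps_conv (dps_dy a) (\<rho> / 2)"
    using dps_conv_dx[OF a] dps_conv_dy[OF a] \<rho> by auto
  have G1c: "dps_conv (dps_dy (dps_dy a)) (\<rho> / 4)"
    using dps_conv_dy[OF Gc, of "\<rho> / 4"] \<rho> by auto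
  obtain \<delta> \<eta> Y Y' where \<delta>: "0 < \<delta>" "0 < \<eta>" "\<delta> \<le> \<eta>" "\<eta> < \<rho> / 2" and Y0: "Y 0 = 0"
    and Y': "\<And>z. cmod z < \<delta> \<Longrightarrow> (Y has_field_derivative Y' z) (at z)"
    and Y: "\<And>z. cmod z < \<delta> \<Longrightarrow> cmod (Y z) < \<eta> \<and> dps (dps_dy a) z (Y z) = 0"
    and uniq: "\<And>z w. cmod z < \<delta> \<Longrightarrow> cmod w < \<eta> \<Longrightarrow> dps (dps_dy a) z w = 0 \<Longrightarrow> w = Y z"
    apply (rule holomorphic_implicit_function[OF Gc G0 less_imp_neq[OF pos, symmetric]])
    subgoal premises prems for \<delta> \<eta> Y Y' by (rule prems(1)[OF prems(2-9)])
    done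
  \<comment> \<open>The other partial derivative, restricted to the arc. It is holomorphic, and the
    accumulating critical points are zeros of it.\<close>
  define H where "H = (\<lambda>z. dps (dps_dx a) z (Y z))"
  have "H z = 0" if "cmod z < \<delta>" for z
  proof (rule analytic_continuation[where f=H and S="ball 0 \<delta>" and U="{z \<in> ball 0 \<delta>. H z = 0}" and \<xi>=0])
    show "H holomorphic_on ball 0 \<delta>"
    proof (rule holomorphic_onI)
      fix z :: complex assume "z \<in> ball 0 \<delta>"
      then have z: "cmod z < \<delta>" by simp
      have "cmod z < \<rho> / 2" "cmod (Y z) < \<rho> / 2" using Y[OF z] z \<delta> by auto
      from dps_comp_field_derivative[OF Fc this Y'[OF z]]
      show "H field_differentiable at z within ball 0 \<delta>"
        unfolding H_def by (meson field_differentiable_def field_differentiable_at_within)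
    qed
    show "0 islimpt {z \<in> ball 0 \<delta>. H z = 0}"
    proof (rule islimpt_approachable[THEN iffD2], safe)
      fix e :: real assume "0 < e"
      then obtain x y :: real where xy: "(x, y) \<noteq> (0, 0)" "\<bar>x\<bar> < min e \<delta>" "\<bar>y\<bar> < min e \<delta>"
        "dps (dps_dx a) x y = 0" "dps (dps_dy a) x y = 0" using acc[of "min e \<delta>"] \<delta> by auto
      have small: "\<bar>x\<bar> \<le> \<rho> / 2" "\<bar>y\<bar> \<le> \<rho> / 2" using xy \<delta> by auto
      \<comment> \<open>By uniqueness each critical point close to the origin lies on the arc; since
        \<open>Y 0 = 0\<close>, its first coordinate is nonzero, so the zeros of \<open>H\<close>
        really accumulate at 0.\<close>
      have yY: "complex_of_real y = Y (complex_of_real x)"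
        by (rule uniq) (use xy \<delta> dps_of_real[OF Gc small, where ?'a=complex] in auto)
      have "x \<noteq> 0" using yY xy(1) Y0 by auto
      moreover have "H (complex_of_real x) = 0"
        using dps_of_real[OF Fc small, where ?'a=complex] xy yY by (simp add: H_def)
      ultimately show "\<exists>x'\<in>{z \<in> ball 0 \<delta>. H z = 0}. x' \<noteq> 0 \<and> dist x' 0 < e"
        using xy by (intro bexI[of _ "complex_of_real x"]) auto
    qed
  qed (use that \<delta> in auto)
  then have H0: "dps (dps_dx a) z (Y z) = 0" if "cmod z < \<delta>" for z using that by (simp add: H_def)
  \<comment> \<open>Along the arc both partial derivatives vanish, hence so does the derivative of
    the restriction.\<close>
  have const: "dps a z (Y z) = complex_of_real (a 0 0)" if "cmod z < \<delta>" for z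
  proof -
    have "((\<lambda>z. dps a z (Y z)) has_field_derivative 0) (at z within ball 0 \<delta>)" if "z \<in> ball 0 \<delta>" for z
    proof -
      have z: "cmod z < \<delta>" using that by simp
      have "cmod z < \<rho>" "cmod (Y z) < \<rho>" using Y[OF z] z \<delta> \<rho> by auto
      from dps_comp_field_derivative[OF a this Y'[OF z]] show ?thesis
        using H0[OF z] Y[OF z] by (auto intro: has_field_derivative_at_within)
    qed
    then obtain C where "\<And>z. z \<in> ball 0 \<delta> \<Longrightarrow> dps a z (Y z) = C"
      using has_field_derivative_zero_constant[of "ball 0 \<delta>" "\<lambda>z. dps a z (Y z)"] by auto
    from this[of z] this[of 0] show ?thesis using that \<delta> Y0 by simp
  qed
  \<comment> \<open>The coefficients are real, so the conjugate of \<open>Y x\<close> is a root over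
    the same real \<open>x\<close>; uniqueness makes it equal to \<open>Y x\<close>, and the arc is
    real over real points.\<close>
  have real_root: "\<exists>y0. \<bar>y0\<bar> \<le> cmod (Y (complex_of_real x)) \<and> dps (dps_dy a) x y0 = 0 \<and> dps a x y0 = a 0 0" if x: "\<bar>x\<bar> < \<delta>" for x :: real
  proof -
    define w where "w = Y (complex_of_real x)"
    have cx: "cmod (complex_of_real x) < \<delta>" using x by simp
    have w: "cmod w < \<eta>" "dps (dps_dy a) (complex_of_real x) w = 0" using Y[OF cx] by (auto simp: w_def)
    have "dps (dps_dy a) (cnj (complex_of_real x)) (cnj w) = 0"
      using w cx \<delta> by (subst dps_cnj[OF Gc]) auto
    then have "cnj w = Y (complex_of_real x)"
      using w(1) by (intro uniq[OF cx]) auto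
    then have "cnj w = w" unfolding w_def .
    then have "Im w = 0" by (simp add: complex_eq_iff)
    then have wr: "w = complex_of_real (Re w)" by (simp add: complex_eq_iff)
    have b: "\<bar>Re w\<bar> \<le> cmod w" by (rule abs_Re_le_cmod)
    have "complex_of_real (dps (dps_dy a) x (Re w)) = 0"
      using w(2) wr dps_of_real[OF Gc, of x "Re w", where ?'a=complex] x b w(1) \<delta> by simp
    moreover have "complex_of_real (dps a x (Re w)) = complex_of_real (a 0 0)"
      using const[OF cx] wr dps_of_real[OF a, of x "Re w", where ?'a=complex] x b w(1) \<delta> \<rho> by (simp add: w_def)
    ultimately show ?thesis using b unfolding w_def by (intro exI[of _ "Re (Y (complex_of_real x))"]) auto
  qed
  define c where "c = dps_dy (dps_dy a) 0 0 / 2"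
  have c: "0 < c" using pos by (simp add: c_def)
  have "continuous_on (ball 0 (\<rho> / 4) \<times> ball 0 (\<rho> / 4)) (\<lambda>p::real\<times>real. dps (dps_dy (dps_dy a)) (fst p) (snd p))"
    by (rule dps_continuous_on[OF G1c]) auto
  then have "isCont (\<lambda>p::real\<times>real. dps (dps_dy (dps_dy a)) (fst p) (snd p)) (0, 0)"
    by (rule continuous_on_interior) (use \<rho> in \<open>simp add: interior_Times\<close>)
  then obtain d where d: "0 < d" "\<And>p::real\<times>real. dist p (0, 0) < d \<Longrightarrow>
      dist (dps (dps_dy (dps_dy a)) (fst p) (snd p)) (dps (dps_dy (dps_dy a)) 0 0) < c"
    unfolding continuous_at_eps_delta using c by (metis fst_conv snd_conv)
  define \<kappa> where "\<kappa> = min (d / 2) (\<rho> / 4)"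
  have \<kappa>: "0 < \<kappa>" "\<kappa> \<le> d / 2" "\<kappa> \<le> \<rho> / 4" using d \<rho> by (auto simp: \<kappa>_def)
  have conv: "c \<le> dps (dps_dy (dps_dy a)) x y" if "\<bar>x\<bar> < \<kappa>" "\<bar>y\<bar> < \<kappa>" for x y :: real
  proof -
    have "dist (x, y) (0, 0) \<le> \<bar>x\<bar> + \<bar>y\<bar>"
      by (simp add: dist_Pair_Pair sqrt_sum_squares_le_sum_abs)
    also have "\<dots> < d" using that \<kappa> by linarith
    finally have "dist (dps (dps_dy (dps_dy a)) x y) (dps (dps_dy (dps_dy a)) 0 0) < c" using d(2)[of "(x, y)"] by simp
    then have "dps_dy (dps_dy a) 0 0 - c < dps (dps_dy (dps_dy a)) x y"
      unfolding dist_real_def abs_diff_less_iff dps_0_0 by simp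
    then show ?thesis unfolding c_def by (simp add: field_simps)
  qed
  have "isCont Y 0" using Y'[of 0] \<delta> DERIV_isCont by auto
  then obtain \<delta>' where \<delta>': "0 < \<delta>'" "\<And>z. cmod z < \<delta>' \<Longrightarrow> cmod (Y z) < \<kappa>"
    unfolding continuous_at_eps_delta using \<kappa>(1) Y0 by (metis dist_0_norm dist_commute)
  define \<epsilon> where "\<epsilon> = min \<kappa> (min \<delta> \<delta>')"
  have \<epsilon>: "0 < \<epsilon>" "\<epsilon> \<le> \<kappa>" "\<epsilon> \<le> \<delta>" "\<epsilon> \<le> \<delta>'" using \<kappa> \<delta> \<delta>' by (auto simp: \<epsilon>_def)
  have "a 0 0 \<le> dps a x y \<and> 2 * c * (dps a x y - a 0 0) \<le> (dps (dps_dy a) x y)\<^sup>2"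
    if xy: "\<bar>x\<bar> < \<epsilon>" "\<bar>y\<bar> < \<epsilon>" for x y :: real
  proof
    have "\<bar>x\<bar> < \<delta>" using xy \<epsilon> by linarith
    from real_root[OF this] obtain y0 where y0: "\<bar>y0\<bar> \<le> cmod (Y (complex_of_real x))"
      "dps (dps_dy a) x y0 = 0" "dps a x y0 = a 0 0" by blast
    have y0\<kappa>: "\<bar>y0\<bar> < \<kappa>"
      using y0(1) \<delta>'(2)[of "complex_of_real x"] xy \<epsilon> by auto
    have x\<kappa>: "\<bar>x\<bar> < \<kappa>" using xy \<epsilon> by linarith
    have tangent: "dps a x s + dps (dps_dy a) x s * (t - s) + c / 2 * (t - s)\<^sup>2 \<le> dps a x t"
      if "\<bar>s\<bar> < \<kappa>" "\<bar>t\<bar> < \<kappa>" for s t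
    proof (rule strongly_convex_above_tangent[where S="{-\<kappa><..<\<kappa>}" and k''="dps (dps_dy (dps_dy a)) x"])
      show "((\<lambda>y. dps a x y) has_real_derivative dps (dps_dy a) x y) (at y)" if "y \<in> {-\<kappa><..<\<kappa>}" for y
        by (rule dps_snd_derivative[OF a]) (use that x\<kappa> \<kappa> \<rho> in auto)
      show "((\<lambda>y. dps (dps_dy a) x y) has_real_derivative dps (dps_dy (dps_dy a)) x y) (at y)"
        if "y \<in> {-\<kappa><..<\<kappa>}" for y
        by (rule dps_snd_derivative[OF Gc]) (use that x\<kappa> \<kappa> \<rho> in auto)
    qed (use that x\<kappa> conv in auto)
    have y\<kappa>: "\<bar>y\<bar> < \<kappa>" using xy \<epsilon> by linarith
    have "a 0 0 + c / 2 * (y - y0)\<^sup>2 \<le> dps a x y" using tangent[OF y0\<kappa> y\<kappa>] y0 by simp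
    moreover have "0 \<le> c / 2 * (y - y0)\<^sup>2" using c by simp
    ultimately show "a 0 0 \<le> dps a x y" by linarith
    define g where "g = dps (dps_dy a) x y"
    define s where "s = y0 - y"
    have 1: "dps a x y - a 0 0 \<le> - g * s - c / 2 * s\<^sup>2"
      using tangent[OF y\<kappa> y0\<kappa>] y0 by (simp add: g_def s_def)
    \<comment> \<open>Completing the square: \<open>- g * s - c / 2 * s\<^sup>2\<close> never
      exceeds \<open>g\<^sup>2 / (2 * c)\<close>.\<close>
    have "0 \<le> (g + c * s)\<^sup>2" by simp
    then have "2 * c * (- g * s - c / 2 * s\<^sup>2) \<le> g\<^sup>2" by (simp add: power2_eq_square algebra_simps)
    moreover have "2 * c * (dps a x y - a 0 0) \<le> 2 * c * (- g * s - c / 2 * s\<^sup>2)"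
      using 1 c by (intro mult_left_mono) auto
    ultimately show "2 * c * (dps a x y - a 0 0) \<le> (dps (dps_dy a) x y)\<^sup>2" by (simp add: g_def)
  qed
  moreover have "0 < 2 * c" using c by simp
  ultimately show ?thesis using \<epsilon>(1) by blast
qed

text \<open>A positive Laplacian makes at least one pure second derivative positive; if it is the
  first one, the coordinates are exchanged. The conclusion is an inequality of Polyak-Lojasiewicz
  type.\<close>

lemma valley:
  assumes f: "real_analytic_on f V" and p: "p \<in> V" and g0: "grad f p = 0" and lap: "laplacian f p > 0"
    and acc: "\<And>\<epsilon>. 0 < \<epsilon> \<Longrightarrow> \<exists>x\<in>ball p \<epsilon>. x \<noteq> p \<and> grad f x = 0"
  shows "\<exists>\<epsilon>>0. \<exists>c>0. \<forall>x\<in>ball p \<epsilon>. f p \<le> f x \<and> c * (f x - f p) \<le> (norm (grad f x))\<^sup>2"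
proof -
  obtain a \<rho> where t: "taylor_at f p a \<rho>" using f p real_analytic_on_iff_taylor by blast
  note a = taylor_at_conv[OF t]
  have \<rho>: "0 < \<rho>" using taylor_at_pos[OF t] .
  note pb = center_in_box_at[OF \<rho>, of p]
  note pd = taylor_at_partial_deriv[OF t]
  have p2: "partial_deriv 1 f p = 0" "partial_deriv 2 f p = 0"
    using g0 by (auto simp: grad_def vec_eq_iff forall_2)
  have h0: "dps_dx a 0 0 = 0" "dps_dy a 0 0 = 0" using pd[OF pb] p2 by simp_all
  have fp: "f p = a 0 0" using taylor_at_box[OF t pb] by simp
  from lap laplacian_taylor[OF t] have "dps_dx (dps_dx a) 0 0 > 0 \<or> dps_dy (dps_dy a) 0 0 > 0" by linarith
  moreover have acc': "\<exists>x y::real. (x, y) \<noteq> (0, 0) \<and> \<bar>x\<bar> < \<delta> \<and> \<bar>y\<bar> < \<delta> \<and>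
      dps (dps_dx a) x y = 0 \<and> dps (dps_dy a) x y = 0" if "0 < \<delta>" for \<delta>
  proof -
    obtain x where x: "x \<in> ball p (min \<delta> \<rho>)" "x \<noteq> p" "grad f x = 0" using acc[of "min \<delta> \<rho>"] \<rho> \<open>0 < \<delta>\<close> by auto
    then have "x \<in> box_at p \<delta>" "x \<in> box_at p \<rho>"
      using ball_subset_box_at[of p \<delta>] ball_subset_box_at[of p \<rho>] by auto
    moreover have "partial_deriv 1 f x = 0" "partial_deriv 2 f x = 0"
      using x(3) by (auto simp: grad_def vec_eq_iff forall_2)
    moreover have "(x $ 1 - p $ 1, x $ 2 - p $ 2) \<noteq> (0, 0)"
      using x(2) by (auto simp: vec_eq_iff forall_2)
    ultimately show ?thesis
      using pd[of x] by (intro exI[of _ "x $ 1 - p $ 1"] exI[of _ "x $ 2 - p $ 2"]) (auto simp: box_at_def)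
  qed
  moreover have "\<exists>\<epsilon>>0. \<exists>c>0. \<forall>x y. \<bar>x\<bar> < \<epsilon> \<longrightarrow> \<bar>y\<bar> < \<epsilon> \<longrightarrow>
    a 0 0 \<le> dps a x y \<and> c * (dps a x y - a 0 0) \<le> (dps (dps_dy a) x y)\<^sup>2"
    if "dps_dy (dps_dy a) 0 0 > 0"
    by (rule dps_valley[OF a h0(2) that acc'])
  moreover have "\<exists>\<epsilon>>0. \<exists>c>0. \<forall>x y. \<bar>x\<bar> < \<epsilon> \<longrightarrow> \<bar>y\<bar> < \<epsilon> \<longrightarrow>
    a 0 0 \<le> dps a x y \<and> c * (dps a x y - a 0 0) \<le> (dps (dps_dx a) x y)\<^sup>2"
    if "dps_dx (dps_dx a) 0 0 > 0"
  proof -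
    define b where "b = (\<lambda>i j. a j i)"
    have b: "dps_conv b \<rho>" unfolding b_def using a by (rule iffD2[OF dps_conv_swap])
    have e: "dps_dy b = (\<lambda>i j. dps_dx a j i)" "dps_dx b = (\<lambda>i j. dps_dy a j i)"
      "dps_dy (dps_dy b) = (\<lambda>i j. dps_dx (dps_dx a) j i)"
      by (auto simp: b_def dps_dx_def dps_dy_def fun_eq_iff)
    have db: "dps b x y = dps a y x" "dps (dps_dy b) x y = dps (dps_dx a) y x"
        "dps (dps_dx b) x y = dps (dps_dy a) y x" for x y :: real
      unfolding e unfolding b_def by (rule dps_swap)+
    have acc'': "\<exists>x y::real. (x, y) \<noteq> (0, 0) \<and> \<bar>x\<bar> < \<delta> \<and> \<bar>y\<bar> < \<delta> \<and>
      dps (dps_dx b) x y = 0 \<and> dps (dps_dy b) x y = 0" if "0 < \<delta>" for \<delta>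
      using acc'[OF that] unfolding db by (metis prod.inject)
    have "\<exists>\<epsilon>>0. \<exists>c>0. \<forall>x y. \<bar>x\<bar> < \<epsilon> \<longrightarrow> \<bar>y\<bar> < \<epsilon> \<longrightarrow>
      b 0 0 \<le> dps b x y \<and> c * (dps b x y - b 0 0) \<le> (dps (dps_dy b) x y)\<^sup>2"
    proof (rule dps_valley[OF b _ _ acc''])
      show "dps_dy b 0 0 = 0" by (simp add: e h0)
      show "0 < dps_dy (dps_dy b) 0 0" using that unfolding e(3) .
    qed
    then show ?thesis unfolding db unfolding b_def by blast
  qed
  ultimately obtain \<epsilon> c where \<epsilon>: "0 < \<epsilon>" "0 < c" and
    *: "\<And>x y. \<bar>x\<bar> < \<epsilon> \<Longrightarrow> \<bar>y\<bar> < \<epsilon> \<Longrightarrow> a 0 0 \<le> dps a x y \<and>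
      (c * (dps a x y - a 0 0) \<le> (dps (dps_dx a) x y)\<^sup>2 \<or> c * (dps a x y - a 0 0) \<le> (dps (dps_dy a) x y)\<^sup>2)"
    by metis
  show ?thesis
  proof (rule exI[of _ "min \<epsilon> \<rho>"], intro conjI, goal_cases)
    case 2
    show ?case
    proof (intro exI[of _ c] conjI ballI)
    fix x assume x: "x \<in> ball p (min \<epsilon> \<rho>)"
    then have xb: "x \<in> box_at p \<epsilon>" "x \<in> box_at p \<rho>"
      using ball_subset_box_at[of p \<epsilon>] ball_subset_box_at[of p \<rho>] by auto
    have n: "(norm (grad f x))\<^sup>2 = (partial_deriv 1 f x)\<^sup>2 + (partial_deriv 2 f x)\<^sup>2"
      by (simp add: norm_vec_def L2_set_def sum_2 grad_def)
    have q: "(partial_deriv 1 f x)\<^sup>2 \<ge> 0" "(partial_deriv 2 f x)\<^sup>2 \<ge> 0" by auto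
    have "f p \<le> f x \<and> (c * (f x - f p) \<le> (partial_deriv 1 f x)\<^sup>2 \<or> c * (f x - f p) \<le> (partial_deriv 2 f x)\<^sup>2)"
      using *[of "x $ 1 - p $ 1" "x $ 2 - p $ 2"] xb(1)
      unfolding fp taylor_at_box[OF t xb(2)] pd[OF xb(2)] by (simp add: box_at_def)
    then show "f p \<le> f x" "c * (f x - f p) \<le> (norm (grad f x))\<^sup>2" using n q by linarith+
    qed fact
  qed (use \<epsilon> \<rho> in auto)
qed

section \<open>Flows of Lipschitz fields\<close>

definition integral_curve :: "('a::euclidean_space \<Rightarrow> 'a) \<Rightarrow> (real \<Rightarrow> 'a) \<Rightarrow> bool" where
  "integral_curve X \<gamma> \<longleftrightarrow> (\<forall>t\<ge>0. (\<gamma> has_vector_derivative X (\<gamma> t)) (at t within {0..}))"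

text \<open>Only forward time is modelled. Backward trajectories are treated as forward trajectories
  of the problem for \<open>- u\<close>.\<close>

definition is_flow :: "('a::euclidean_space \<Rightarrow> 'a) \<Rightarrow> (real \<Rightarrow> 'a \<Rightarrow> 'a) \<Rightarrow> bool" where
  "is_flow X \<phi> \<longleftrightarrow> (\<forall>x. \<phi> 0 x = x \<and> integral_curve X (\<lambda>t. \<phi> t x))"

lemma integral_has_vector_derivative_at_least:
  fixes f :: "real \<Rightarrow> 'a::euclidean_space"
  assumes "continuous_on {0..} f" "0 \<le> t"
  shows "((\<lambda>u. integral {0..u} f) has_vector_derivative f t) (at t within {0..})"
proof -
  have "((\<lambda>u. integral {0..u} f) has_vector_derivative f t) (at t within {0..t + 1})"
    using assms by (intro integral_has_vector_derivative) (auto intro: continuous_on_subset)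
  moreover have "at t within {0..t + 1} = at t within {0..}"
    by (rule at_within_nhd[where S="{..<t + 1}"]) auto
  ultimately show ?thesis by simp
qed

lemma integral_curve_continuous:
  assumes "integral_curve X \<gamma>"
  shows "continuous_on {0..} \<gamma>"
  using assms unfolding integral_curve_def
  by (auto intro!: has_vector_derivative_continuous simp: continuous_on_eq_continuous_within)

lemma integral_curve_at:
  assumes "integral_curve X \<gamma>" "0 < t"
  shows "(\<gamma> has_vector_derivative X (\<gamma> t)) (at t)"
proof -
  have "at t within {0..} = at t"
    by (rule at_within_interior) (use assms in simp)
  then show ?thesis using assms by (metis integral_curve_def less_imp_le)
qed

text \<open>Picard's operator is a contraction for the weighted norm
  \<open>sup\<^sub>t exp (- 2 L t) \<bar>\<gamma> t\<bar>\<close>, which yields a solution for all times at once.\<close>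

lemma integral_curve_exists:
  fixes X :: "'a::euclidean_space \<Rightarrow> 'a"
  assumes lip: "L-lipschitz_on UNIV X" and L: "0 < L" and B: "\<And>x. norm (X x) \<le> B"
  obtains \<gamma> where "\<gamma> 0 = x" "integral_curve X \<gamma>"
proof -
  have X: "continuous_on UNIV X" using lip lipschitz_on_continuous_on by blast
  have lipX: "norm (X y - X z) \<le> L * norm (y - z)" for y z
    using lipschitz_onD[OF lip, of y z] by (simp add: dist_norm)
  \<comment> \<open>A function \<open>g\<close> stands for the weighted curve; undoing the weight
    gives the point at which the field is evaluated.\<close>
  define f where "f = (\<lambda>(g :: real \<Rightarrow>\<^sub>C 'a) s. X (exp (2 * L * s) *\<^sub>R g s))"
  define F where "F = (\<lambda>(g :: real \<Rightarrow>\<^sub>C 'a) \<tau>. integral {0..\<tau>} (f g))"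
  \<comment> \<open>The value at negative times is frozen by \<open>max 0 t\<close>, because bounded
    continuous functions are taken on the whole line.\<close>
  define P where "P = (\<lambda>g t. exp (- 2 * L * max 0 t) *\<^sub>R (x + F g (max 0 t)))"
  have fc: "continuous_on S (f g)" for g S
    unfolding f_def by (intro continuous_on_compose2[OF X] continuous_intros) auto
  have Fd: "(F g has_vector_derivative f g t) (at t within {0..})" if "0 \<le> t" for g t
    unfolding F_def using integral_has_vector_derivative_at_least[OF fc that] .
  have Fc: "continuous_on {0..} (F g)" for g
    using Fd by (auto intro!: has_vector_derivative_continuous simp: continuous_on_eq_continuous_within)
  have Fat: "(F g has_vector_derivative f g t) (at t)" if "0 < t" for g t
  proof -
    have "at t within {0..} = at t" by (rule at_within_interior) (use that in simp)
    then show ?thesis using Fd[of t g] that by simp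
  qed
  have fB: "norm (f g s) \<le> B" for g s by (simp add: f_def B)
  have F0: "F g 0 = 0" for g by (simp add: F_def)
  have Fb: "norm (F g \<tau>) \<le> B * \<tau>" if "0 \<le> \<tau>" for g \<tau>
  proof (cases "\<tau> = 0")
    case False
    then have "norm (F g \<tau> - F g 0) \<le> B * \<tau> - B * 0"
      using that fB
      by (intro differentiable_bound_general[where f'="f g" and \<phi>'="\<lambda>_. B"])
        (auto intro!: continuous_intros continuous_on_subset[OF Fc] Fat derivative_eq_intros
          simp: has_real_derivative_iff_has_vector_derivative[symmetric])
    then show ?thesis by (simp add: F0)
  qed (simp add: F0)
  have B0: "0 \<le> B" using norm_ge_zero[of "X 0"] B[of 0] by linarith
  have Pb: "P g \<in> bcontfun" for g
  proof (rule bcontfun_normI)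
    show "continuous_on UNIV (P g)" unfolding P_def
      by (intro continuous_intros continuous_on_compose2[OF Fc]) auto
    fix t :: real
    define \<tau> where "\<tau> = max 0 t"
    have \<tau>: "0 \<le> \<tau>" by (simp add: \<tau>_def)
    have "exp (- 2 * L * \<tau>) * \<tau> \<le> 1 / (2 * L)"
    proof -
      have "2 * L * \<tau> \<le> exp (2 * L * \<tau>)" using exp_ge_add_one_self[of "2 * L * \<tau>"] by linarith
      then show ?thesis using L by (simp add: exp_minus field_simps)
    qed
    then have 1: "exp (- 2 * L * \<tau>) * (B * \<tau>) \<le> B * (1 / (2 * L))"
      using B0 by (metis mult.left_commute mult_left_mono)
    have "norm (P g t) \<le> exp (- 2 * L * \<tau>) * (norm x + B * \<tau>)"
      unfolding P_def \<tau>_def[symmetric]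
      using norm_triangle_ineq[of x "F g \<tau>"] Fb[OF \<tau>, of g] by simp
    also have "\<dots> = exp (- 2 * L * \<tau>) * norm x + exp (- 2 * L * \<tau>) * (B * \<tau>)" by (simp add: algebra_simps)
    also have "\<dots> \<le> 1 * norm x + B * (1 / (2 * L))"
      using 1 L \<tau> by (intro add_mono mult_right_mono) auto
    finally show "norm (P g t) \<le> 1 * norm x + B * (1 / (2 * L))" .
  qed
  define \<Phi> where "\<Phi> = (\<lambda>g. Bcontfun (P g))"
  have \<Phi>: "apply_bcontfun (\<Phi> g) t = P g t" for g t unfolding \<Phi>_def by (simp add: Bcontfun_inverse[OF Pb])
  have "\<exists>!g\<in>UNIV. \<Phi> g = g"
  proof (rule Banach_fix[where c="1/2"])
    fix g h :: "real \<Rightarrow>\<^sub>C 'a"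
    show "dist (\<Phi> g) (\<Phi> h) \<le> 1 / 2 * dist g h"
    proof (rule dist_bound)
      fix t :: real
      define \<tau> where "\<tau> = max 0 t"
      have \<tau>: "0 \<le> \<tau>" by (simp add: \<tau>_def)
      \<comment> \<open>Integrating \<open>L * exp (2 * L * s)\<close> yields half of
        \<open>exp (2 * L * \<tau>)\<close>; the weight \<open>2 * L\<close> thus produces the
        contraction factor 1/2.\<close>
      have "norm ((F g \<tau> - F h \<tau>) - (F g 0 - F h 0)) \<le> dist g h / 2 * exp (2 * L * \<tau>) - dist g h / 2 * exp (2 * L * 0)"
      proof (cases "\<tau> = 0")
        case False
        show ?thesis
        proof (rule differentiable_bound_general[where f'="\<lambda>s. f g s - f h s" and \<phi>'="\<lambda>s. L * (exp (2 * L * s) * dist g h)"])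
          show "0 < \<tau>" using False \<tau> by simp
          show "continuous_on {0..\<tau>} (\<lambda>\<tau>. F g \<tau> - F h \<tau>)"
            by (intro continuous_intros continuous_on_subset[OF Fc]) auto
          show "continuous_on {0..\<tau>} (\<lambda>\<tau>. dist g h / 2 * exp (2 * L * \<tau>))" by (intro continuous_intros)
          fix s assume s: "0 < s" "s < \<tau>"
          show "((\<lambda>\<tau>. F g \<tau> - F h \<tau>) has_vector_derivative f g s - f h s) (at s)"
            using Fat[OF s(1)] by (intro has_vector_derivative_diff)
          show "((\<lambda>\<tau>. dist g h / 2 * exp (2 * L * \<tau>)) has_vector_derivative L * (exp (2 * L * s) * dist g h)) (at s)"
            unfolding has_real_derivative_iff_has_vector_derivative[symmetric]
            by (auto intro!: derivative_eq_intros)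
          have "norm (f g s - f h s) \<le> L * norm (exp (2 * L * s) *\<^sub>R g s - exp (2 * L * s) *\<^sub>R h s)"
            unfolding f_def by (rule lipX)
          also have "\<dots> = L * (exp (2 * L * s) * dist (g s) (h s))"
            by (simp add: dist_norm flip: scaleR_diff_right)
          also have "\<dots> \<le> L * (exp (2 * L * s) * dist g h)"
            using L by (intro mult_left_mono dist_bounded) auto
          finally show "norm (f g s - f h s) \<le> L * (exp (2 * L * s) * dist g h)" .
        qed
      qed simp
      then have "norm (F g \<tau> - F h \<tau>) \<le> dist g h / 2 * exp (2 * L * \<tau>)"
      proof -
        have "norm (F g \<tau> - F h \<tau>) \<le> dist g h / 2 * exp (2 * L * \<tau>) - dist g h / 2"
          using \<open>norm ((F g \<tau> - F h \<tau>) - (F g 0 - F h 0)) \<le> _\<close> by (simp add: F0)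
        then show ?thesis using zero_le_dist[of g h] by linarith
      qed
      then have "exp (- 2 * L * \<tau>) * norm (F g \<tau> - F h \<tau>) \<le> exp (- 2 * L * \<tau>) * (dist g h / 2 * exp (2 * L * \<tau>))"
        by (intro mult_left_mono) auto
      also have "\<dots> = 1 / 2 * dist g h" by (simp add: exp_minus field_simps)
      finally show "dist (\<Phi> g t) (\<Phi> h t) \<le> 1 / 2 * dist g h"
        by (simp add: \<Phi> P_def \<tau>_def dist_norm flip: scaleR_diff_right)
    qed
  qed (auto intro: complete_UNIV)
  then obtain g where g: "\<Phi> g = g" by blast
  define \<gamma> where "\<gamma> = (\<lambda>t. x + F g t)"
  have g\<gamma>: "exp (2 * L * t) *\<^sub>R g t = \<gamma> t" if "0 \<le> t" for t
  proof -
    have "g t = P g t" using \<Phi>[of g t] g by simp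
    then show ?thesis using that by (simp add: P_def \<gamma>_def flip: exp_add)
  qed
  show ?thesis
  proof (rule that)
    show "\<gamma> 0 = x" by (simp add: \<gamma>_def F0)
    show "integral_curve X \<gamma>" unfolding integral_curve_def
    proof (intro allI impI)
      fix t :: real assume t: "0 \<le> t"
      have "(\<gamma> has_vector_derivative f g t) (at t within {0..})"
        unfolding \<gamma>_def using has_vector_derivative_add[OF has_vector_derivative_const Fd[OF t]] by simp
      then show "(\<gamma> has_vector_derivative X (\<gamma> t)) (at t within {0..})"
        by (simp add: f_def g\<gamma>[OF t])
    qed
  qed
qed

lemma flow_exists:
  fixes X :: "'a::euclidean_space \<Rightarrow> 'a"
  assumes "L-lipschitz_on UNIV X" "0 < L" "\<And>x. norm (X x) \<le> B"
  obtains \<phi> where "is_flow X \<phi>"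
proof -
  have "\<forall>x. \<exists>\<gamma>. \<gamma> 0 = x \<and> integral_curve X \<gamma>"
    using integral_curve_exists[OF assms] by metis
  then obtain \<Gamma> where "\<And>x. \<Gamma> x 0 = x \<and> integral_curve X (\<Gamma> x)" by metis
  then show ?thesis by (intro that[of "\<lambda>t x. \<Gamma> x t"]) (simp add: is_flow_def)
qed

text \<open>Gronwall for the squared distance, whose derivative lies between \<open>- 2 * L\<close>
  and \<open>2 * L\<close> times itself. The second estimate is uniqueness backward in time.\<close>

lemma integral_curves_dist:
  fixes X :: "'a::euclidean_space \<Rightarrow> 'a"
  assumes lip: "L-lipschitz_on UNIV X" and c: "integral_curve X \<gamma>" "integral_curve X \<delta>" and t: "0 \<le> t"
  shows "dist (\<gamma> t) (\<delta> t) \<le> exp (L * t) * dist (\<gamma> 0) (\<delta> 0)"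
    and "dist (\<gamma> 0) (\<delta> 0) \<le> exp (L * t) * dist (\<gamma> t) (\<delta> t)"
proof -
  define f where "f = (\<lambda>t. (\<gamma> t - \<delta> t) \<bullet> (\<gamma> t - \<delta> t))"
  have f: "f t = (dist (\<gamma> t) (\<delta> t))\<^sup>2" for t by (simp add: f_def dist_norm power2_norm_eq_inner)
  define D where "D = (\<lambda>s. 2 * ((\<gamma> s - \<delta> s) \<bullet> (X (\<gamma> s) - X (\<delta> s))))"
  have df: "(f has_real_derivative D s) (at s)" if "0 < s" for s
  proof -
    have "((\<lambda>s. \<gamma> s - \<delta> s) has_vector_derivative X (\<gamma> s) - X (\<delta> s)) (at s)"
      using integral_curve_at[OF c(1) that] integral_curve_at[OF c(2) that] by (rule has_vector_derivative_diff)
    then have 1: "((\<lambda>s. \<gamma> s - \<delta> s) has_derivative (\<lambda>h. h *\<^sub>R (X (\<gamma> s) - X (\<delta> s)))) (at s)"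
      by (simp add: has_vector_derivative_def)
    from has_derivative_inner[OF 1 1] show ?thesis
      unfolding f_def has_field_derivative_def
      by (rule has_derivative_eq_rhs) (auto simp: D_def inner_commute algebra_simps)
  qed
  have D: "\<bar>D s\<bar> \<le> 2 * L * f s" for s
  proof -
    have "\<bar>(\<gamma> s - \<delta> s) \<bullet> (X (\<gamma> s) - X (\<delta> s))\<bar> \<le> norm (\<gamma> s - \<delta> s) * norm (X (\<gamma> s) - X (\<delta> s))"
      by (rule Cauchy_Schwarz_ineq2)
    also have "\<dots> \<le> norm (\<gamma> s - \<delta> s) * (L * norm (\<gamma> s - \<delta> s))"
      using lipschitz_onD[OF lip, of "\<gamma> s" "\<delta> s"] by (intro mult_left_mono) (auto simp: dist_norm)
    finally show ?thesis by (simp add: D_def f dist_norm power2_eq_square mult_ac)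
  qed
  have fc: "continuous_on {0..t} f"
    unfolding f_def using integral_curve_continuous[OF c(1)] integral_curve_continuous[OF c(2)]
    by (intro continuous_intros) (auto intro: continuous_on_subset)
  have "exp (- (2 * L * t)) * f t \<le> exp (- (2 * L * 0)) * f 0"
  proof (rule DERIV_nonpos_imp_decreasing_open[OF t])
    fix s assume s: "0 < s" "s < t"
    have "((\<lambda>s. exp (- (2 * L * s)) * f s) has_real_derivative exp (- (2 * L * s)) * (D s - 2 * L * f s)) (at s)"
      using df[OF s(1)] by (auto intro!: derivative_eq_intros simp: algebra_simps)
    moreover have "exp (- (2 * L * s)) * (D s - 2 * L * f s) \<le> 0"
      using D[of s] by (intro mult_nonneg_nonpos) auto
    ultimately show "\<exists>y. ((\<lambda>s. exp (- (2 * L * s)) * f s) has_real_derivative y) (at s) \<and> y \<le> 0" by blast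
  qed (intro continuous_intros fc)
  then have "f t \<le> exp (2 * L * t) * f 0" by (simp add: exp_minus field_simps)
  also have "\<dots> = (exp (L * t) * dist (\<gamma> 0) (\<delta> 0))\<^sup>2"
    by (simp add: f power_mult_distrib exp_double[symmetric] mult.assoc)
  finally show "dist (\<gamma> t) (\<delta> t) \<le> exp (L * t) * dist (\<gamma> 0) (\<delta> 0)"
    unfolding f by (rule power2_le_imp_le) simp
  have "exp (2 * L * 0) * f 0 \<le> exp (2 * L * t) * f t"
  proof (rule DERIV_nonneg_imp_increasing_open[OF t])
    fix s assume s: "0 < s" "s < t"
    have "((\<lambda>s. exp (2 * L * s) * f s) has_real_derivative exp (2 * L * s) * (D s + 2 * L * f s)) (at s)"
      using df[OF s(1)] by (auto intro!: derivative_eq_intros simp: algebra_simps)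
    moreover have "exp (2 * L * s) * (D s + 2 * L * f s) \<ge> 0"
      using D[of s] by (intro mult_nonneg_nonneg) auto
    ultimately show "\<exists>y. ((\<lambda>s. exp (2 * L * s) * f s) has_real_derivative y) (at s) \<and> 0 \<le> y" by blast
  qed (intro continuous_intros fc)
  then have "f 0 \<le> exp (2 * L * t) * f t" by simp
  also have "\<dots> = (exp (L * t) * dist (\<gamma> t) (\<delta> t))\<^sup>2"
    by (simp add: f power_mult_distrib exp_double[symmetric] mult.assoc)
  finally show "dist (\<gamma> 0) (\<delta> 0) \<le> exp (L * t) * dist (\<gamma> t) (\<delta> t)"
    unfolding f by (rule power2_le_imp_le) simp
qed

lemma flow_curve: "is_flow X \<phi> \<Longrightarrow> integral_curve X (\<lambda>t. \<phi> t x)"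
  and flow_0 [simp]: "is_flow X \<phi> \<Longrightarrow> \<phi> 0 x = x"
  by (simp_all add: is_flow_def)

lemma flow_unique:
  assumes "L-lipschitz_on UNIV X" "is_flow X \<phi>" "integral_curve X \<gamma>" "\<gamma> 0 = x" "0 \<le> t"
  shows "\<gamma> t = \<phi> t x"
  using integral_curves_dist(1)[OF assms(1) assms(3) flow_curve[OF assms(2)] assms(5), of x] assms by simp

lemma flow_dist:
  assumes "L-lipschitz_on UNIV X" "is_flow X \<phi>" "0 \<le> t"
  shows "dist (\<phi> t x) (\<phi> t y) \<le> exp (L * t) * dist x y"
  using integral_curves_dist(1)[OF assms(1) flow_curve[OF assms(2)] flow_curve[OF assms(2)] assms(3), of x y] assms by simp

lemma flow_continuous_space:
  assumes "L-lipschitz_on UNIV X" "is_flow X \<phi>" "0 \<le> t"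
  shows "continuous_on UNIV (\<phi> t)"
  by (rule lipschitz_on_continuous_on[where L="exp (L * t)"])
     (use flow_dist[OF assms] in \<open>auto simp: lipschitz_on_def\<close>)

lemma integral_curve_shift:
  assumes "integral_curve X \<gamma>" "0 \<le> s"
  shows "integral_curve X (\<lambda>t. \<gamma> (s + t))"
  unfolding integral_curve_def
proof (intro allI impI)
  fix t :: real assume t: "0 \<le> t"
  have "((\<lambda>t. s + t) has_vector_derivative 1) (at t within {0..})"
    by (auto intro!: derivative_eq_intros)
  moreover have "(\<gamma> has_vector_derivative X (\<gamma> (s + t))) (at (s + t) within (\<lambda>t. s + t) ` {0..})"
  proof (rule has_vector_derivative_within_subset)
    show "(\<gamma> has_vector_derivative X (\<gamma> (s + t))) (at (s + t) within {0..})"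
      using assms t unfolding integral_curve_def by simp
  qed (use assms in auto)
  ultimately show "((\<lambda>t. \<gamma> (s + t)) has_vector_derivative X (\<gamma> (s + t))) (at t within {0..})"
    using vector_diff_chain_within[of "\<lambda>t. s + t" 1 t "{0..}" \<gamma>] by (simp add: o_def)
qed

lemma flow_add:
  assumes "L-lipschitz_on UNIV X" "is_flow X \<phi>" "0 \<le> s" "0 \<le> t"
  shows "\<phi> (s + t) x = \<phi> t (\<phi> s x)"
  using flow_unique[OF assms(1,2) integral_curve_shift[OF flow_curve[OF assms(2)] assms(3)] _ assms(4), of x "\<phi> s x"]
  by simp

text \<open>A zero of the field carries a constant curve; backward uniqueness forbids another
  trajectory to reach it in finite time.\<close>

lemma flow_nonzero:
  assumes "L-lipschitz_on UNIV X" "is_flow X \<phi>" "0 \<le> t" "X x \<noteq> 0"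
  shows "X (\<phi> t x) \<noteq> 0"
proof
  assume 0: "X (\<phi> t x) = 0"
  then have "integral_curve X (\<lambda>_. \<phi> t x)" by (simp add: integral_curve_def)
  from integral_curves_dist(2)[OF assms(1) flow_curve[OF assms(2)] this assms(3), of x]
  have "x = \<phi> t x" using assms(2) by simp
  with 0 assms(4) show False by simp
qed

section \<open>Dirichlet eigenfunctions\<close>

lemma real_analytic_uminus:
  assumes "real_analytic_on f S"
  shows "real_analytic_on (\<lambda>x. - f x) S"
  unfolding real_analytic_on_def
proof
  fix p assume "p \<in> S"
  then obtain r a where r: "r > 0" and hs: "\<And>x. x \<in> ball p r \<Longrightarrow>
      ((\<lambda>(i, j). a i j * (x $ 1 - p $ 1) ^ i * (x $ 2 - p $ 2) ^ j) has_sum f x) UNIV"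
    using assms unfolding real_analytic_on_def by blast
  have "((\<lambda>(i, j). - a i j * (x $ 1 - p $ 1) ^ i * (x $ 2 - p $ 2) ^ j) has_sum - f x) UNIV"
    if "x \<in> ball p r" for x
    using has_sum_cmult_right[OF hs[OF that], of "-1"] by (simp add: case_prod_unfold)
  then show "\<exists>r>0. \<exists>a. \<forall>x\<in>ball p r.
      ((\<lambda>(i, j). a i j * (x $ 1 - p $ 1) ^ i * (x $ 2 - p $ 2) ^ j) has_sum - f x) UNIV"
    using r by (intro exI[of _ r] conjI exI[of _ "\<lambda>i j. - a i j"]) auto
qed

lemma real_analytic_differentiable:
  "real_analytic_on f S \<Longrightarrow> x \<in> S \<Longrightarrow> f differentiable (at x)"
  using real_analytic_has_derivative differentiable_def by blast

lemma real_analytic_continuous_on: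
  "real_analytic_on f S \<Longrightarrow> continuous_on S f"
  by (intro continuous_at_imp_continuous_on ballI)
     (metis real_analytic_has_derivative has_derivative_continuous)

lemma partial_deriv_uminus:
  assumes "f differentiable (at x)"
  shows "partial_deriv i (\<lambda>x. - f x) x = - partial_deriv i f x"
proof -
  have "((\<lambda>x. - f x) has_derivative (\<lambda>h. - frechet_derivative f (at x) h)) (at x)"
    using assms by (intro has_derivative_minus) (simp add: frechet_derivative_works)
  from frechet_derivative_at[OF this, symmetric] show ?thesis by (simp add: partial_deriv_def)
qed

text \<open>Holds without differentiability: \<open>frechet_derivative\<close> is a choice among the
  derivatives, and both functions have the same ones.\<close>

lemma partial_deriv_cong:
  assumes "open S" "x \<in> S" "\<And>y. y \<in> S \<Longrightarrow> f y = g y"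
  shows "partial_deriv i f x = partial_deriv i g x"
proof -
  have "(f has_derivative f') (at x) \<longleftrightarrow> (g has_derivative f') (at x)" for f'
    using has_derivative_transform_within_open[of f f' x UNIV S g]
      has_derivative_transform_within_open[of g f' x UNIV S f] assms by metis
  then show ?thesis by (simp add: partial_deriv_def frechet_derivative_def)
qed

lemma grad_uminus:
  assumes "real_analytic_on f V" "x \<in> V"
  shows "grad (\<lambda>x. - f x) x = - grad f x"
  using partial_deriv_uminus[OF real_analytic_differentiable[OF assms]]
  by (simp add: grad_def vec_eq_iff)

lemma laplacian_uminus:
  assumes f: "real_analytic_on f V" and V: "open V" "x \<in> V"
  shows "laplacian (\<lambda>x. - f x) x = - laplacian f x"
proof -
  have "partial_deriv i (partial_deriv i (\<lambda>x. - f x)) x = - partial_deriv i (partial_deriv i f) x" for i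
  proof -
    have "partial_deriv i (partial_deriv i (\<lambda>x. - f x)) x = partial_deriv i (\<lambda>y. - partial_deriv i f y) x"
      by (rule partial_deriv_cong[OF V]) (rule partial_deriv_uminus[OF real_analytic_differentiable[OF f]])
    also have "\<dots> = - partial_deriv i (partial_deriv i f) x"
      by (rule partial_deriv_uminus[OF real_analytic_differentiable[OF real_analytic_partial[OF f] V(2)]])
    finally show ?thesis .
  qed
  then show ?thesis by (simp add: laplacian_def sum_negf)
qed

section \<open>Second-order conditions at a maximum\<close>

lemma second_derivative_test:
  fixes k k' :: "real \<Rightarrow> real"
  assumes "0 < \<epsilon>" and k: "\<And>s. \<bar>s\<bar> < \<epsilon> \<Longrightarrow> (k has_real_derivative k' s) (at s)"
    and k': "(k' has_real_derivative l) (at 0)" and mx: "\<And>s. \<bar>s\<bar> < \<epsilon> \<Longrightarrow> k s \<le> k 0"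
  shows "l \<le> 0"
proof (rule ccontr)
  assume "\<not> l \<le> 0"
  then obtain d where d: "0 < d" "\<And>h. 0 < h \<Longrightarrow> h < d \<Longrightarrow> k' 0 < k' h"
    using DERIV_pos_inc_right[OF k'] by auto
  have "k' 0 = 0"
    by (rule DERIV_local_max[OF k[of 0] assms(1)]) (use mx assms(1) in auto)
  define s where "s = min d \<epsilon> / 2"
  have s: "0 < s" "s < d" "s < \<epsilon>" using d assms(1) by (auto simp: s_def)
  have "k 0 < k s"
  proof (rule DERIV_pos_imp_increasing_open[OF s(1)])
    show "\<exists>y. (k has_real_derivative y) (at x) \<and> 0 < y" if "0 < x" "x < s" for x
      using k[of x] d(2)[of x] s that \<open>k' 0 = 0\<close> by auto
    show "continuous_on {0..s} k"
      by (intro continuous_at_imp_continuous_on ballI) (use k s DERIV_isCont in force)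
  qed
  then show False using mx[of s] s by simp
qed

lemma dps_max_second_derivative:
  assumes a: "dps_conv a \<rho>" and \<epsilon>: "0 < \<epsilon>"
    and mx: "\<And>s::real. \<bar>s\<bar> < \<epsilon> \<Longrightarrow> dps a 0 s + \<eta> * (q + s)\<^sup>2 \<le> a 0 0 + \<eta> * q\<^sup>2"
  shows "dps_dy (dps_dy a) 0 0 + 2 * \<eta> \<le> 0"
proof (rule second_derivative_test[where \<epsilon>="min \<epsilon> (\<rho> / 2)"])
  have \<rho>: "0 < \<rho>" using a by (simp add: dps_conv_def)
  have a': "dps_conv (dps_dy a) (\<rho> / 2)" using dps_conv_dy[OF a, of "\<rho> / 2"] \<rho> by simp
  show "0 < min \<epsilon> (\<rho> / 2)" using \<epsilon> \<rho> by simp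
  show "((\<lambda>s. dps a 0 s + \<eta> * (q + s)\<^sup>2) has_real_derivative dps (dps_dy a) 0 s + 2 * \<eta> * (q + s)) (at s)"
    if "\<bar>s\<bar> < min \<epsilon> (\<rho> / 2)" for s :: real
    using that \<rho> by (auto intro!: derivative_eq_intros dps_snd_derivative[OF a])
  show "((\<lambda>s. dps (dps_dy a) 0 s + 2 * \<eta> * (q + s)) has_real_derivative
      dps_dy (dps_dy a) 0 0 + 2 * \<eta>) (at 0)"
    using dps_snd_derivative[OF a', of 0 0] \<rho> by (auto intro!: derivative_eq_intros)
  show "dps a 0 s + \<eta> * (q + s)\<^sup>2 \<le> dps a 0 0 + \<eta> * (q + 0)\<^sup>2" if "\<bar>s\<bar> < min \<epsilon> (\<rho> / 2)" for s :: real
    using mx that by simp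
qed

text \<open>The added paraboloid has Laplacian \<open>4 * \<eta>\<close>. A positive \<eta> gives
  the strict inequality needed in a maximum principle; \<open>\<eta> = 0\<close> is the plain
  second-order condition.\<close>

lemma laplacian_at_max:
  assumes f: "real_analytic_on f V" and p: "p \<in> V"
    and mx: "\<forall>\<^sub>F y in nhds p. f y + \<eta> * (y \<bullet> y) \<le> f p + \<eta> * (p \<bullet> p)"
  shows "laplacian f p \<le> - 4 * \<eta>"
proof -
  obtain a \<rho> where t: "taylor_at f p a \<rho>" using f p real_analytic_on_iff_taylor by blast
  note a = taylor_at_conv[OF t]
  have \<rho>: "0 < \<rho>" using taylor_at_pos[OF t] .
  have fp: "f p = a 0 0" using taylor_at_box[OF t center_in_box_at[OF \<rho>]] by simp
  obtain e where e: "0 < e" "\<And>y. dist y p < e \<Longrightarrow> f y + \<eta> * (y \<bullet> y) \<le> f p + \<eta> * (p \<bullet> p)"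
    using mx unfolding eventually_nhds_metric by blast
  have *: "dps a s s' + \<eta> * ((p $ 1 + s)\<^sup>2 + (p $ 2 + s')\<^sup>2) \<le> a 0 0 + \<eta> * ((p $ 1)\<^sup>2 + (p $ 2)\<^sup>2)"
    if "\<bar>s\<bar> + \<bar>s'\<bar> < min e \<rho>" for s s'
  proof -
    define y where "y = p + vector [s, s']"
    have y: "y $ 1 = p $ 1 + s" "y $ 2 = p $ 2 + s'" by (auto simp: y_def vector_2)
    have "dist y p < min e \<rho>"
      using norm_le_2[of "y - p"] y that by (simp add: dist_norm)
    then have "f y + \<eta> * (y \<bullet> y) \<le> f p + \<eta> * (p \<bullet> p)" "y \<in> box_at p \<rho>"
      using e(2) ball_subset_box_at[of p \<rho>] by (auto simp: dist_commute)
    then show ?thesis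
      using taylor_at_box[OF t, of y] y fp by (simp add: inner_vec_def sum_2 power2_eq_square)
  qed
  have "dps_dy (dps_dy a) 0 0 + 2 * \<eta> \<le> 0"
  proof (rule dps_max_second_derivative[OF a, of "min e \<rho>"])
    show "dps a 0 s + \<eta> * (p $ 2 + s)\<^sup>2 \<le> a 0 0 + \<eta> * (p $ 2)\<^sup>2" if "\<bar>s\<bar> < min e \<rho>" for s :: real
      using *[of 0 s] that by (simp add: algebra_simps)
  qed (use e \<rho> in auto)
  moreover have "dps_dx (dps_dx a) 0 0 + 2 * \<eta> \<le> 0"
  proof -
    have "dps_dy (dps_dy (\<lambda>i j. a j i)) 0 0 + 2 * \<eta> \<le> 0"
    proof (rule dps_max_second_derivative[OF iffD2[OF dps_conv_swap a], of "min e \<rho>"])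
      show "dps (\<lambda>i j. a j i) 0 s + \<eta> * (p $ 1 + s)\<^sup>2 \<le> a 0 0 + \<eta> * (p $ 1)\<^sup>2" if "\<bar>s\<bar> < min e \<rho>" for s :: real
        using *[of s 0] that by (simp add: dps_swap[of a] algebra_simps)
    qed (use e \<rho> in auto)
    then show ?thesis by (simp add: dps_dy_def dps_dx_def)
  qed
  ultimately show ?thesis using laplacian_taylor[OF t] by linarith
qed

section \<open>Lipschitz bounds and the cut-off gradient field\<close>

lemma scalar_analytic_locally_lipschitz:
  assumes f: "real_analytic_on f V" and V: "open V" "x \<in> V"
  shows "\<exists>r>0. \<exists>L. \<forall>y\<in>cball x r. \<forall>z\<in>cball x r. \<bar>f y - f z\<bar> \<le> L * norm (y - z)"
proof -
  obtain r where r: "0 < r" "cball x r \<subseteq> V" using V open_contains_cball by blast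
  define h where "h = (\<lambda>y. \<bar>partial_deriv 1 f y\<bar> + \<bar>partial_deriv 2 f y\<bar>)"
  have "continuous_on (cball x r) h" unfolding h_def
    by (intro continuous_intros continuous_on_subset[OF real_analytic_continuous_on[OF real_analytic_partial[OF f]] r(2)])
  then have "bounded (h ` cball x r)"
    by (intro compact_imp_bounded compact_continuous_image) auto
  then obtain L where L: "\<And>y. y \<in> cball x r \<Longrightarrow> h y \<le> L"
    unfolding bounded_iff by (metis abs_ge_self image_eqI order_trans real_norm_def)
  have "norm (f y - f z) \<le> L * norm (y - z)" if yz: "y \<in> cball x r" "z \<in> cball x r" for y z
  proof (rule differentiable_bound[where f'="\<lambda>y h. grad f y \<bullet> h", OF convex_cball _ _ yz])
    fix y assume y: "y \<in> cball x r"
    show "(f has_derivative (\<bullet>) (grad f y)) (at y within cball x r)"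
      using has_derivative_at_withinI[OF real_analytic_has_derivative[OF f]] y r by blast
    have "norm (grad f y) \<le> h y" using norm_le_2[of "grad f y"] by (simp add: grad_def h_def)
    also have "\<dots> \<le> L" using L y by blast
    finally have "norm (grad f y) \<le> L" .
    then show "onorm ((\<bullet>) (grad f y)) \<le> L"
      by (intro onorm_le) (metis Cauchy_Schwarz_ineq2 mult_right_mono norm_ge_zero order_trans real_norm_def)
  qed
  then show ?thesis using r by (intro exI[of _ r] conjI exI[of _ L]) auto
qed

text \<open>\<open>K\<close> need not be convex, so the mean value inequality works only on small
  balls; compactness turns the local Lipschitz constants into one.\<close>

lemma grad_lipschitz_compact:
  assumes f: "real_analytic_on f V" and V: "open V" and K: "compact K" "K \<subseteq> V"
  obtains L where "L-lipschitz_on K (grad f)"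
proof -
  have "\<exists>r>0. \<exists>L. \<forall>y\<in>cball x r. \<forall>z\<in>cball x r. norm (grad f y - grad f z) \<le> L * norm (y - z)" if x: "x \<in> V" for x
  proof -
    obtain r1 L1 where 1: "r1 > 0" "\<And>y z. y \<in> cball x r1 \<Longrightarrow> z \<in> cball x r1 \<Longrightarrow>
        \<bar>partial_deriv 1 f y - partial_deriv 1 f z\<bar> \<le> L1 * norm (y - z)"
      using scalar_analytic_locally_lipschitz[OF real_analytic_partial[OF f] V x] by metis
    obtain r2 L2 where 2: "r2 > 0" "\<And>y z. y \<in> cball x r2 \<Longrightarrow> z \<in> cball x r2 \<Longrightarrow>
        \<bar>partial_deriv 2 f y - partial_deriv 2 f z\<bar> \<le> L2 * norm (y - z)"
      using scalar_analytic_locally_lipschitz[OF real_analytic_partial[OF f] V x] by metis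
    have "norm (grad f y - grad f z) \<le> (L1 + L2) * norm (y - z)"
      if "y \<in> cball x (min r1 r2)" "z \<in> cball x (min r1 r2)" for y z
      using norm_le_2[of "grad f y - grad f z"] 1(2)[of y z] 2(2)[of y z] that
      by (simp add: grad_def algebra_simps)
    then show ?thesis using 1 2 by (intro exI[of _ "min r1 r2"] conjI exI[of _ "L1 + L2"]) auto
  qed
  note loc = this
  have "local_lipschitz {0::real} K (\<lambda>_. grad f)"
  proof (rule local_lipschitzI)
    fix t :: real and x assume "x \<in> K"
    then obtain r L where r: "r > 0" "\<And>y z. y \<in> cball x r \<Longrightarrow> z \<in> cball x r \<Longrightarrow>
        norm (grad f y - grad f z) \<le> L * norm (y - z)" using loc K by blast
    have "(max 0 L)-lipschitz_on (cball x r \<inter> K) (grad f)"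
    proof (rule lipschitz_onI)
      fix y z assume yz: "y \<in> cball x r \<inter> K" "z \<in> cball x r \<inter> K"
      have "L * norm (y - z) \<le> max 0 L * norm (y - z)" by (intro mult_right_mono) auto
      then show "dist (grad f y) (grad f z) \<le> max 0 L * dist y z"
        using r(2)[of y z] yz by (auto simp: dist_norm)
    qed simp
    then show "\<exists>u>0. \<exists>L. \<forall>t\<in>cball t u \<inter> {0}. L-lipschitz_on (cball x u \<inter> K) (grad f)" using r by blast
  qed
  from local_lipschitz_compact_implies_lipschitz[OF this K(1)] that show ?thesis
    by (metis compact_sing continuous_on_const singletonI)
qed

text \<open>The gradient field is cut off outside a neighbourhood of the closure, so that its flow exists
  for all times and still follows the extension of the function beyond the boundary.\<close>

lemma cutoff_gradient_field:
  assumes f: "real_analytic_on f V" and V: "open V" and K: "compact K" "K \<noteq> {}" "K \<subseteq> V"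
  obtains X \<kappa> L B where "L-lipschitz_on UNIV X" "0 < L" "\<And>x. norm (X x) \<le> B"
    "\<And>x. X x = - (\<kappa> x *\<^sub>R grad f x)" "\<And>x. (0::real) \<le> \<kappa> x" "\<And>x. x \<in> K \<Longrightarrow> \<kappa> x = 1"
    "\<And>x. \<kappa> x \<noteq> 0 \<Longrightarrow> x \<in> V"
proof -
  have "closed (- V)" "K \<inter> (- V) = {}" using V K by auto
  from separate_compact_closed[OF K(1) this] obtain d where d: "0 < d" "\<And>x y. x \<in> K \<Longrightarrow> y \<in> - V \<Longrightarrow> d \<le> dist x y"
    by blast
  define \<delta> where "\<delta> = d / 2"
  have \<delta>: "0 < \<delta>" "\<delta> < d" using d by (auto simp: \<delta>_def)
  define K' where "K' = {x. infdist x K \<le> \<delta>}"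
  have K': "compact K'" unfolding K'_def using K \<delta> by (intro compact_infdist_le)
  have "x \<in> V" if "x \<in> K'" for x
  proof (rule ccontr)
    assume "x \<notin> V"
    obtain k where "k \<in> K" "infdist x K = dist x k"
      using infdist_attains_inf[OF compact_imp_closed[OF K(1)] K(2)] by blast
    then show False using d(2)[of k x] \<open>x \<notin> V\<close> that \<delta> by (auto simp: K'_def dist_commute)
  qed
  then have K'V: "K' \<subseteq> V" by blast
  obtain L1 where L1: "L1-lipschitz_on K' (grad f)" using grad_lipschitz_compact[OF f V K' K'V] by blast
  have L10: "0 \<le> L1" using L1 by (simp add: lipschitz_on_def)
  have "bounded (grad f ` K')"
    using lipschitz_on_continuous_on[OF L1] K' by (intro compact_imp_bounded compact_continuous_image)
  then obtain M where M: "0 < M" "\<And>x. x \<in> K' \<Longrightarrow> norm (grad f x) \<le> M"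
    unfolding bounded_pos by auto
  \<comment> \<open>Falls linearly with the distance from \<open>K\<close>, from 1 on
    \<open>K\<close> to 0 at distance \<delta>, hence is Lipschitz with constant
    \<open>1 / \<delta>\<close>.\<close>
  define \<kappa> where "\<kappa> = (\<lambda>x. max 0 (1 - infdist x K / \<delta>))"
  have \<kappa>01: "0 \<le> \<kappa> x" "\<kappa> x \<le> 1" for x using \<delta> infdist_nonneg[of x K] by (auto simp: \<kappa>_def)
  have \<kappa>K': "x \<in> K'" if "\<kappa> x \<noteq> 0" for x
    using that \<delta> by (auto simp: \<kappa>_def K'_def max_def field_simps split: if_splits)
  have \<kappa>lip: "\<bar>\<kappa> x - \<kappa> y\<bar> \<le> dist x y / \<delta>" for x y
  proof -
    have "\<bar>\<kappa> x - \<kappa> y\<bar> \<le> \<bar>infdist x K / \<delta> - infdist y K / \<delta>\<bar>" by (auto simp: \<kappa>_def)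
    also have "\<dots> = \<bar>infdist x K - infdist y K\<bar> / \<delta>" using \<delta> by (simp add: diff_divide_distrib[symmetric])
    also have "\<dots> \<le> dist x y / \<delta>" using \<delta> infdist_triangle_abs by (intro divide_right_mono) auto
    finally show ?thesis .
  qed
  define X where "X = (\<lambda>x. - (\<kappa> x *\<^sub>R grad f x))"
  define L where "L = L1 + M / \<delta>"
  have L0: "0 < L" using L10 M \<delta> by (simp add: L_def add_nonneg_pos)
  \<comment> \<open>The gradient is controlled on \<open>K'\<close> only. If \<open>y\<close> lies
    outside, its cut-off factor is 0, and the Lipschitz bound of \<kappa> alone suffices.\<close>
  have half: "norm (X x - X y) \<le> L * dist x y" if x: "x \<in> K'" for x y
  proof (cases "y \<in> K'")
    case True
    have "X x - X y = - (\<kappa> y *\<^sub>R (grad f x - grad f y) + (\<kappa> x - \<kappa> y) *\<^sub>R grad f x)"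
      by (simp add: X_def algebra_simps)
    then have "norm (X x - X y) = norm (\<kappa> y *\<^sub>R (grad f x - grad f y) + (\<kappa> x - \<kappa> y) *\<^sub>R grad f x)"
      by (simp only: norm_minus_cancel)
    then have "norm (X x - X y) \<le> \<kappa> y * norm (grad f x - grad f y) + \<bar>\<kappa> x - \<kappa> y\<bar> * norm (grad f x)"
      using norm_triangle_ineq[of "\<kappa> y *\<^sub>R (grad f x - grad f y)" "(\<kappa> x - \<kappa> y) *\<^sub>R grad f x"] \<kappa>01(1)[of y]
      by simp
    also have "\<dots> \<le> 1 * (L1 * dist x y) + dist x y / \<delta> * M"
      using \<kappa>01 \<kappa>lip M(2)[OF x] lipschitz_onD[OF L1 x True] \<delta>
      by (intro add_mono mult_mono) (auto simp: dist_norm)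
    finally show ?thesis by (simp add: L_def algebra_simps)
  next
    case False
    then have y: "\<kappa> y = 0" using \<kappa>K' by blast
    have "norm (X x - X y) = \<bar>\<kappa> x - \<kappa> y\<bar> * norm (grad f x)" using y by (simp add: X_def)
    also have "\<dots> \<le> dist x y / \<delta> * M" using \<kappa>lip M(2)[OF x] \<delta> by (intro mult_mono) auto
    also have "\<dots> \<le> L * dist x y" using L10 by (simp add: L_def algebra_simps)
    finally show ?thesis .
  qed
  have out: "X x = 0" if "x \<notin> K'" for x using \<kappa>K'[of x] that by (auto simp: X_def)
  have lip: "L-lipschitz_on UNIV X"
  proof (rule lipschitz_onI)
    fix x y :: "real^2"
    consider "x \<in> K'" | "y \<in> K'" | "x \<notin> K'" "y \<notin> K'" by blast
    then show "dist (X x) (X y) \<le> L * dist x y"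
    proof cases
      case 3
      then show ?thesis using out L0 by simp
    qed (use half[of x y] half[of y x] in \<open>auto simp: dist_norm norm_minus_commute\<close>)
  qed (use L0 in simp)
  have B: "norm (X x) \<le> M" for x
  proof (cases "x \<in> K'")
    case True
    have "norm (X x) = \<kappa> x * norm (grad f x)" using \<kappa>01(1)[of x] by (simp add: X_def)
    also have "\<dots> \<le> 1 * M" using \<kappa>01 M(2)[OF True] by (intro mult_mono) auto
    finally show ?thesis by simp
  qed (use out M in auto)
  show ?thesis
  proof (rule that[OF lip L0 B])
    show "\<kappa> x = 1" if "x \<in> K" for x using that by (simp add: \<kappa>_def)
    show "\<kappa> x \<noteq> 0 \<Longrightarrow> x \<in> V" for x using \<kappa>K' K'V by blast
  qed (use \<kappa>01 in \<open>auto simp: X_def\<close>)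
qed

section \<open>Consequences of the eigenvalue equation at critical points\<close>

locale dirichlet_problem =
  fixes \<Omega> V :: "(real^2) set" and u :: "real^2 \<Rightarrow> real" and ev :: real
  assumes open_dom: "open \<Omega>" and connected_dom: "connected \<Omega>" and nonempty_dom: "\<Omega> \<noteq> {}"
    and bounded_dom: "bounded \<Omega>" and open_nbhd: "open V" and closure_dom_subset: "closure \<Omega> \<subseteq> V"
    and analytic: "real_analytic_on u V" and eigen: "dirichlet_eigenfunction \<Omega> ev u"
begin

lemma problem_uminus: "dirichlet_problem \<Omega> V (\<lambda>x. - u x) ev"
proof
  show "dirichlet_eigenfunction \<Omega> ev (\<lambda>x. - u x)"
    using eigen laplacian_uminus[OF analytic open_nbhd] closure_dom_subset closure_subset[of \<Omega>]
    unfolding dirichlet_eigenfunction_def by auto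
qed (use open_dom connected_dom nonempty_dom bounded_dom open_nbhd closure_dom_subset real_analytic_uminus[OF analytic] in auto)

lemma dom_subset: "\<Omega> \<subseteq> V"
  using closure_dom_subset closure_subset by blast

lemma boundary_zero: "x \<in> closure \<Omega> \<Longrightarrow> x \<notin> \<Omega> \<Longrightarrow> u x = 0"
  using eigen open_dom by (auto simp: dirichlet_eigenfunction_def frontier_def interior_open)

lemma compact_closure_dom: "compact (closure \<Omega>)"
  using bounded_dom by simp

lemma continuous_on_u: "S \<subseteq> V \<Longrightarrow> continuous_on S u"
  using real_analytic_continuous_on[OF analytic] continuous_on_subset by blast

lemma u_has_derivative: "x \<in> V \<Longrightarrow> (u has_derivative (\<bullet>) (grad u x)) (at x)"
  using real_analytic_has_derivative[OF analytic] by blast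

lemma continuous_on_grad: "S \<subseteq> V \<Longrightarrow> continuous_on S (grad u)"
  unfolding grad_def
  using real_analytic_continuous_on[OF real_analytic_partial[OF analytic]]
  by (auto intro!: continuous_intros intro: continuous_on_subset)

lemma helmholtz: "x \<in> \<Omega> \<Longrightarrow> laplacian u x = - (ev * u x)"
  using eigen by (force simp: dirichlet_eigenfunction_def)

lemma helmholtz_near: "p \<in> closure \<Omega> \<Longrightarrow> \<forall>\<^sub>F x in nhds p. laplacian u x + ev * u x = 0"
  by (rule real_analytic_zero_closure[OF real_analytic_helmholtz[OF analytic] open_dom closure_dom_subset])
     (auto simp: helmholtz)

lemma not_locally_zero: "p \<in> closure \<Omega> \<Longrightarrow> \<not> (\<forall>\<^sub>F x in nhds p. u x = 0)"
  using real_analytic_identity[OF analytic open_dom connected_dom closure_dom_subset] eigen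
  by (auto simp: dirichlet_eigenfunction_def)

text \<open>Maximum principle: for \<open>ev \<le> 0\<close> the Laplacian would be non-negative
  where \<open>u\<close> is positive, which contradicts an interior maximum of \<open>u\<close> plus
  a small paraboloid.\<close>

lemma ev_pos_if_positive:
  assumes x: "x \<in> \<Omega>" "u x > 0"
  shows "0 < ev"
proof (rule ccontr)
  assume "\<not> 0 < ev"
  obtain R where R: "0 < R" "\<And>y. y \<in> closure \<Omega> \<Longrightarrow> norm y \<le> R"
    using compact_imp_bounded[OF compact_closure_dom] unfolding bounded_pos by blast
  \<comment> \<open>So small that the paraboloid adds at most \<open>u x / 2\<close> on the closure;
    the maximum point then has \<open>u p > 0\<close> and is not on the boundary.\<close>
  define \<eta> where "\<eta> = u x / (2 * R\<^sup>2)"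
  have \<eta>: "0 < \<eta>" using x R by (simp add: \<eta>_def)
  define w where "w = (\<lambda>y. u y + \<eta> * (y \<bullet> y))"
  have "continuous_on (closure \<Omega>) w" unfolding w_def
    by (intro continuous_intros continuous_on_u closure_dom_subset)
  then obtain p where p: "p \<in> closure \<Omega>" "\<And>y. y \<in> closure \<Omega> \<Longrightarrow> w y \<le> w p"
  proof -
    have "closure \<Omega> \<noteq> {}" using nonempty_dom by simp
    from continuous_attains_sup[OF compact_closure_dom this \<open>continuous_on (closure \<Omega>) w\<close>] that
    show ?thesis by blast
  qed
  have "u x \<le> w x" using \<eta> by (simp add: w_def)
  also have "\<dots> \<le> w p" using p(2) x closure_subset by blast
  finally have "u x \<le> u p + \<eta> * (p \<bullet> p)" by (simp add: w_def)
  moreover have "\<eta> * (p \<bullet> p) \<le> u x / 2"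
  proof -
    have "p \<bullet> p \<le> R\<^sup>2" using power_mono[OF R(2)[OF p(1)] norm_ge_zero, of 2] by (simp add: power2_norm_eq_inner)
    then have "\<eta> * (p \<bullet> p) \<le> \<eta> * R\<^sup>2" using \<eta> by (intro mult_left_mono) auto
    also have "\<dots> = u x / 2" using R by (simp add: \<eta>_def)
    finally show ?thesis .
  qed
  ultimately have up: "0 < u p" using x by linarith
  then have "p \<in> \<Omega>" using boundary_zero p(1) by force
  have "\<forall>\<^sub>F y in nhds p. u y + \<eta> * (y \<bullet> y) \<le> u p + \<eta> * (p \<bullet> p)"
    unfolding eventually_nhds using \<open>p \<in> \<Omega>\<close> open_dom p(2) closure_subset
    by (intro exI[of _ \<Omega>]) (auto simp: w_def)
  from laplacian_at_max[OF analytic _ this] have "laplacian u p \<le> - 4 * \<eta>"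
    using \<open>p \<in> \<Omega>\<close> dom_subset by blast
  moreover have "0 \<le> - (ev * u p)" using up \<open>\<not> 0 < ev\<close> by (simp add: mult_nonpos_nonneg)
  ultimately show False using \<eta> helmholtz[OF \<open>p \<in> \<Omega>\<close>] by linarith
qed

lemma ev_pos: "0 < ev"
proof -
  interpret n: dirichlet_problem \<Omega> V "\<lambda>x. - u x" ev by (rule problem_uminus)
  obtain x where "x \<in> \<Omega>" "u x \<noteq> 0" using eigen by (auto simp: dirichlet_eigenfunction_def)
  then show ?thesis using ev_pos_if_positive n.ev_pos_if_positive by (metis neg_0_less_iff_less linorder_neqE_linordered_idom)
qed

lemma grad_neg: "x \<in> closure \<Omega> \<Longrightarrow> grad (\<lambda>x. - u x) x = - grad u x"
  using grad_uminus[OF analytic] closure_dom_subset by blast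

lemma critical_zero:
  assumes r: "r \<in> closure \<Omega>" "u r = 0"
  shows "\<exists>\<epsilon>>0. \<forall>x\<in>ball r \<epsilon>. x \<noteq> r \<longrightarrow> grad u x \<noteq> 0"
    and "\<not> (\<forall>\<^sub>F y in nhds r. u y \<le> u r)" and "\<not> (\<forall>\<^sub>F y in nhds r. u r \<le> u y)"
proof -
  have "r \<in> V" using r closure_dom_subset by blast
  note * = nodal_critical_point[OF analytic this helmholtz_near[OF r(1)] not_locally_zero[OF r(1)] r(2)]
  show "\<exists>\<epsilon>>0. \<forall>x\<in>ball r \<epsilon>. x \<noteq> r \<longrightarrow> grad u x \<noteq> 0" by (rule *(1))
  show "\<not> (\<forall>\<^sub>F y in nhds r. u y \<le> u r)" "\<not> (\<forall>\<^sub>F y in nhds r. u r \<le> u y)"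
    using *(2)[of 1] *(2)[of "-1"] r(2) by simp_all
qed

lemma neg_not_max:
  assumes r: "r \<in> closure \<Omega>" "u r < 0"
  shows "\<not> (\<forall>\<^sub>F y in nhds r. u y \<le> u r)"
proof
  assume *: "\<forall>\<^sub>F y in nhds r. u y \<le> u r"
  have r\<Omega>: "r \<in> \<Omega>" using boundary_zero r by force
  then have "laplacian u r \<le> 0"
    using laplacian_at_max[OF analytic, of r 0] * dom_subset by auto
  moreover have "ev * u r < 0" using r ev_pos by (simp add: mult_pos_neg)
  ultimately show False using helmholtz[OF r\<Omega>] by linarith
qed

text \<open>Where \<open>u\<close> is negative its Laplacian is positive, so \<open>valley\<close>
  applies as soon as critical points accumulate.\<close>

lemma critical_neg_cases:
  assumes r: "r \<in> closure \<Omega>" "u r < 0" "grad u r = 0"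
  shows "(\<exists>\<epsilon>>0. \<forall>x\<in>ball r \<epsilon>. x \<noteq> r \<longrightarrow> grad u x \<noteq> 0) \<or>
    (\<exists>\<epsilon>>0. \<exists>c>0. \<forall>x\<in>ball r \<epsilon>. u r \<le> u x \<and> c * (u x - u r) \<le> (norm (grad u x))\<^sup>2)"
proof (rule disjCI)
  assume *: "\<not> (\<exists>\<epsilon>>0. \<exists>c>0. \<forall>x\<in>ball r \<epsilon>. u r \<le> u x \<and> c * (u x - u r) \<le> (norm (grad u x))\<^sup>2)"
  have r\<Omega>: "r \<in> \<Omega>" using boundary_zero r by force
  have "ev * u r < 0" using r ev_pos by (simp add: mult_pos_neg)
  then have "laplacian u r > 0" using helmholtz[OF r\<Omega>] by simp
  then show "\<exists>\<epsilon>>0. \<forall>x\<in>ball r \<epsilon>. x \<noteq> r \<longrightarrow> grad u x \<noteq> 0"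
    using valley[OF analytic _ r(3)] r\<Omega> dom_subset * by blast
qed

lemma pos_not_min:
  assumes "r \<in> closure \<Omega>" "0 < u r"
  shows "\<not> (\<forall>\<^sub>F y in nhds r. u r \<le> u y)"
proof -
  interpret n: dirichlet_problem \<Omega> V "\<lambda>x. - u x" ev by (rule problem_uminus)
  show ?thesis using n.neg_not_max[OF assms(1)] assms(2) by simp
qed

text \<open>Negation turns the valley into a ridge, of which only the local maximum is kept.\<close>

lemma critical_pos_cases:
  assumes r: "r \<in> closure \<Omega>" "0 < u r" "grad u r = 0"
  shows "(\<exists>\<epsilon>>0. \<forall>x\<in>ball r \<epsilon>. x \<noteq> r \<longrightarrow> grad u x \<noteq> 0) \<or> (\<forall>\<^sub>F x in nhds r. u x \<le> u r)"
proof -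
  interpret n: dirichlet_problem \<Omega> V "\<lambda>x. - u x" ev by (rule problem_uminus)
  have "- u r < 0" "grad (\<lambda>x. - u x) r = 0" using r grad_neg[OF r(1)] by auto
  from n.critical_neg_cases[OF r(1) this] show ?thesis
  proof (elim disjE exE conjE)
    fix \<epsilon> assume \<epsilon>: "0 < \<epsilon>" "\<forall>x\<in>ball r \<epsilon>. x \<noteq> r \<longrightarrow> grad (\<lambda>x. - u x) x \<noteq> 0"
    have "r \<in> V" using r closure_dom_subset by blast
    then obtain \<epsilon>' where \<epsilon>': "0 < \<epsilon>'" "ball r \<epsilon>' \<subseteq> V" using open_nbhd open_contains_ball by blast
    have "grad u x \<noteq> 0" if "x \<in> ball r (min \<epsilon> \<epsilon>')" "x \<noteq> r" for x
      using \<epsilon>(2) that \<epsilon>' grad_uminus[OF analytic, of x] by auto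
    then show ?thesis using \<epsilon> \<epsilon>' by (intro disjI1 exI[of _ "min \<epsilon> \<epsilon>'"]) auto
  next
    fix \<epsilon> c assume "0 < \<epsilon>"
      "\<forall>x\<in>ball r \<epsilon>. - u r \<le> - u x \<and> c * (- u x - - u r) \<le> (norm (grad (\<lambda>x. - u x) x))\<^sup>2"
    then show ?thesis unfolding eventually_nhds
      by (intro disjI2 exI[of _ "ball r \<epsilon>"]) auto
  qed
qed

end

section \<open>The gradient flow\<close>

locale dirichlet_flow = dirichlet_problem +
  fixes X :: "real^2 \<Rightarrow> real^2" and \<kappa> :: "real^2 \<Rightarrow> real" and L :: real
    and \<phi> :: "real \<Rightarrow> real^2 \<Rightarrow> real^2"
  assumes lip: "L-lipschitz_on UNIV X" and flow: "is_flow X \<phi>"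
    and X_eq: "X x = - (\<kappa> x *\<^sub>R grad u x)" and \<kappa>_nonneg: "0 \<le> \<kappa> x"
    and \<kappa>_dom: "x \<in> closure \<Omega> \<Longrightarrow> \<kappa> x = 1" and \<kappa>_supp: "\<kappa> x \<noteq> 0 \<Longrightarrow> x \<in> V"
begin

definition regular :: "(real^2) set" where
  "regular = {x \<in> closure \<Omega>. grad u x \<noteq> 0}"

lemma X_dom: "x \<in> closure \<Omega> \<Longrightarrow> X x = - grad u x"
  by (simp add: X_eq \<kappa>_dom)

lemma flow_continuous: "0 \<le> t \<Longrightarrow> continuous_on S (\<phi> t)"
  using flow_continuous_space[OF lip flow] continuous_on_subset by blast

lemma flow_continuous_time: "S \<subseteq> {0..} \<Longrightarrow> continuous_on S (\<lambda>t. \<phi> t x)"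
  using integral_curve_continuous[OF flow_curve[OF flow]] continuous_on_subset by blast

text \<open>The field never becomes zero along the trajectory. This also keeps the trajectory inside
  the support of the cut-off, hence in \<open>V\<close>, even after it has left the closure of the
  domain.\<close>

lemma regular_flow:
  assumes "x \<in> regular" "0 \<le> t"
  shows "\<phi> t x \<in> V" "grad u (\<phi> t x) \<noteq> 0" "0 < \<kappa> (\<phi> t x)"
proof -
  have "X x \<noteq> 0" using assms X_dom by (auto simp: regular_def)
  then have "X (\<phi> t x) \<noteq> 0" by (rule flow_nonzero[OF lip flow assms(2)])
  then have *: "\<kappa> (\<phi> t x) \<noteq> 0" "grad u (\<phi> t x) \<noteq> 0" by (auto simp: X_eq)
  then show "\<phi> t x \<in> V" "grad u (\<phi> t x) \<noteq> 0" "0 < \<kappa> (\<phi> t x)"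
    using \<kappa>_supp \<kappa>_nonneg[of "\<phi> t x"] by auto
qed

lemma u_flow_continuous:
  assumes "x \<in> regular" "S \<subseteq> {0..}"
  shows "continuous_on S (\<lambda>t. u (\<phi> t x))"
  by (rule continuous_on_compose2[OF continuous_on_u[OF order_refl] flow_continuous_time])
     (use assms regular_flow in auto)

lemma u_flow_derivative:
  assumes "x \<in> regular" "0 < t"
  shows "((\<lambda>t. u (\<phi> t x)) has_real_derivative - (\<kappa> (\<phi> t x) * (norm (grad u (\<phi> t x)))\<^sup>2)) (at t)"
proof -
  have "((\<lambda>t. \<phi> t x) has_derivative (\<lambda>h. h *\<^sub>R X (\<phi> t x))) (at t)"
    using integral_curve_at[OF flow_curve[OF flow] assms(2)] by (simp add: has_vector_derivative_def)
  moreover have "(u has_derivative (\<bullet>) (grad u (\<phi> t x))) (at (\<phi> t x))"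
    using regular_flow[of x t] assms by (intro u_has_derivative) auto
  ultimately have "((\<lambda>t. u (\<phi> t x)) has_derivative (\<lambda>h. grad u (\<phi> t x) \<bullet> (h *\<^sub>R X (\<phi> t x)))) (at t)"
    by (rule has_derivative_compose)
  then show ?thesis unfolding has_field_derivative_def
    by (rule has_derivative_eq_rhs) (auto simp: X_eq power2_norm_eq_inner)
qed

lemma u_flow_decreasing:
  assumes "x \<in> regular" "0 \<le> s" "s < t"
  shows "u (\<phi> t x) < u (\<phi> s x)"
proof (rule DERIV_neg_imp_decreasing_open[OF assms(3)])
  fix \<tau> assume \<tau>: "s < \<tau>" "\<tau> < t"
  have "- (\<kappa> (\<phi> \<tau> x) * (norm (grad u (\<phi> \<tau> x)))\<^sup>2) < 0"
    using regular_flow[OF assms(1), of \<tau>] \<tau> assms by simp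
  then show "\<exists>y. ((\<lambda>t. u (\<phi> t x)) has_real_derivative y) (at \<tau>) \<and> y < 0"
    using u_flow_derivative[OF assms(1), of \<tau>] \<tau> assms by auto
qed (use assms in \<open>auto intro: u_flow_continuous\<close>)

lemma u_flow_antimono:
  assumes "x \<in> regular" "0 \<le> s" "s \<le> t"
  shows "u (\<phi> t x) \<le> u (\<phi> s x)"
  using u_flow_decreasing[OF assms(1,2), of t] assms(3) by (cases "s = t") auto

section \<open>Trapped trajectories and their limit points\<close>

definition trapped :: "real^2 \<Rightarrow> bool" where
  "trapped x \<longleftrightarrow> (\<forall>t\<ge>0. \<phi> t x \<in> closure \<Omega>)"

text \<open>On the closure of the domain the cut-off is inactive, so a gradient curve there is an
  integral curve of \<open>X\<close>, and uniqueness identifies it with the flow line.\<close>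

lemma stable_set_iff:
  assumes "x \<in> closure \<Omega>"
  shows "x \<in> stable_set \<Omega> u r \<longleftrightarrow> trapped x \<and> ((\<lambda>t. \<phi> t x) \<longlongrightarrow> r) at_top"
proof
  assume "x \<in> stable_set \<Omega> u r"
  then obtain \<gamma> where \<gamma>: "gradient_curve \<Omega> u {0..} x \<gamma>" "(\<gamma> \<longlongrightarrow> r) at_top"
    by (auto simp: stable_set_def)
  have "integral_curve X \<gamma>" "\<gamma> 0 = x"
    using \<gamma>(1) X_dom by (auto simp: gradient_curve_def integral_curve_def)
  then have eq: "\<gamma> t = \<phi> t x" if "0 \<le> t" for t
    using flow_unique[OF lip flow] that by blast
  have "trapped x" unfolding trapped_def
    using \<gamma>(1) eq by (auto simp: gradient_curve_def)
  moreover have "((\<lambda>t. \<phi> t x) \<longlongrightarrow> r) at_top"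
    using \<gamma>(2) by (rule Lim_transform_eventually)
      (use eq in \<open>auto intro: eventually_at_top_linorderI[of 0]\<close>)
  ultimately show "trapped x \<and> ((\<lambda>t. \<phi> t x) \<longlongrightarrow> r) at_top" ..
next
  assume *: "trapped x \<and> ((\<lambda>t. \<phi> t x) \<longlongrightarrow> r) at_top"
  have "gradient_curve \<Omega> u {0..} x (\<lambda>t. \<phi> t x)"
    unfolding gradient_curve_def
  proof (intro conjI ballI)
    fix t :: real assume "t \<in> {0..}"
    then have t: "0 \<le> t" by simp
    then show c: "\<phi> t x \<in> closure \<Omega>" using * by (simp add: trapped_def)
    show "((\<lambda>t. \<phi> t x) has_vector_derivative - grad u (\<phi> t x)) (at t within {0..})"
      using flow_curve[OF flow, of x, unfolded integral_curve_def, rule_format, OF t] X_dom[OF c] by simp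
  qed (use flow in simp)
  then show "x \<in> stable_set \<Omega> u r" using * assms by (auto simp: stable_set_def)
qed

text \<open>Membership of \<open>q\<close> in the omega-limit set of the trajectory of
  \<open>x\<close>.\<close>

definition limit_point :: "real^2 \<Rightarrow> real^2 \<Rightarrow> bool" where
  "limit_point x q \<longleftrightarrow> (\<forall>\<epsilon>>0. \<forall>T. \<exists>t\<ge>T. 0 \<le> t \<and> dist (\<phi> t x) q < \<epsilon>)"

lemma limit_pointD:
  assumes "limit_point x q" "0 < \<epsilon>"
  obtains t where "T \<le> t" "0 \<le> t" "dist (\<phi> t x) q < \<epsilon>"
  using assms unfolding limit_point_def by blast

text \<open>\<open>K\<close> is arbitrary because it serves twice: as the closure of the domain, and
  as a small sphere that is met at arbitrarily late times.\<close>

lemma limit_point_compact: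
  assumes K: "compact K" and s: "\<And>n::nat. real n \<le> s n \<and> \<phi> (s n) x \<in> K"
  shows "\<exists>q\<in>K. limit_point x q"
proof -
  obtain q k where q: "q \<in> K" "strict_mono (k :: nat \<Rightarrow> nat)" "((\<lambda>n. \<phi> (s n) x) \<circ> k) \<longlonglongrightarrow> q"
    using K s unfolding compact_def by metis
  have "limit_point x q" unfolding limit_point_def
  proof (intro allI impI)
    fix \<epsilon> T :: real assume "0 < \<epsilon>"
    then obtain N where N: "\<And>n. n \<ge> N \<Longrightarrow> dist (\<phi> (s (k n)) x) q < \<epsilon>"
      using q(3) by (auto simp: lim_sequentially)
    obtain M :: nat where M: "T \<le> real M" using real_arch_simple by blast
    let ?n = "max N M"
    have "real ?n \<le> real (k ?n)" using seq_suble[OF q(2)] by simp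
    also have "\<dots> \<le> s (k ?n)" using s by blast
    finally have "real ?n \<le> s (k ?n)" .
    then show "\<exists>t\<ge>T. 0 \<le> t \<and> dist (\<phi> t x) q < \<epsilon>"
      using N[of ?n] M by (intro exI[of _ "s (k ?n)"]) auto
  qed
  then show ?thesis using q(1) by blast
qed

lemma limit_point_closed:
  assumes "limit_point x q" "closed K" "\<And>t. T \<le> t \<Longrightarrow> 0 \<le> t \<Longrightarrow> \<phi> t x \<in> K"
  shows "q \<in> K"
proof -
  have "\<exists>y\<in>K. dist y q < \<epsilon>" if "0 < \<epsilon>" for \<epsilon>
    using limit_pointD[OF assms(1) that, of T] assms(3) by metis
  then show ?thesis using closure_approachable[of q K] assms(2) by simp
qed

lemma trapped_limit_point:
  assumes "trapped x"
  shows "\<exists>q\<in>closure \<Omega>. limit_point x q"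
  by (rule limit_point_compact[OF compact_closure_dom, of real]) (use assms in \<open>auto simp: trapped_def\<close>)

lemma limit_point_in_closure: "trapped x \<Longrightarrow> limit_point x q \<Longrightarrow> q \<in> closure \<Omega>"
  by (rule limit_point_closed[of x q _ 0]) (auto simp: trapped_def)

lemma tendsto_limit_point:
  assumes "((\<lambda>t. \<phi> t x) \<longlongrightarrow> r) at_top"
  shows "limit_point x r"
  unfolding limit_point_def
proof (intro allI impI)
  fix \<epsilon> T :: real assume "0 < \<epsilon>"
  with assms obtain N where "\<And>t. N \<le> t \<Longrightarrow> dist (\<phi> t x) r < \<epsilon>"
    unfolding tendsto_iff eventually_at_top_linorder by blast
  then show "\<exists>t\<ge>T. 0 \<le> t \<and> dist (\<phi> t x) r < \<epsilon>"
    by (intro exI[of _ "max 0 (max N T)"]) auto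
qed

text \<open>Strictness comes from one more unit of time: if \<open>u\<close> had reached the level
  of \<open>q\<close>, it would soon be below it for good, and the trajectory could not return close
  to \<open>q\<close>.\<close>

lemma limit_point_u_less:
  assumes x: "x \<in> regular" and q: "limit_point x q" "q \<in> closure \<Omega>" and t: "0 \<le> t"
  shows "u q < u (\<phi> t x)"
proof (rule ccontr)
  assume "\<not> u q < u (\<phi> t x)"
  moreover have "u (\<phi> (t + 1) x) < u (\<phi> t x)" using u_flow_decreasing[OF x t] by simp
  ultimately have *: "u (\<phi> (t + 1) x) < u q" by linarith
  have "isCont u q"
    using continuous_on_u[OF order_refl] open_nbhd q closure_dom_subset by (auto simp: continuous_on_eq_continuous_at)
  then obtain d where d: "0 < d" "\<And>y. dist y q < d \<Longrightarrow> dist (u y) (u q) < u q - u (\<phi> (t + 1) x)"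
    unfolding continuous_at_eps_delta using * by (metis diff_gt_0_iff_gt)
  obtain s where s: "t + 1 \<le> s" "dist (\<phi> s x) q < d" using limit_pointD[OF q(1) d(1)] by metis
  have "u (\<phi> s x) \<le> u (\<phi> (t + 1) x)" using u_flow_antimono[OF x _ s(1)] t by simp
  then show False using d(2)[OF s(2)] by (simp add: dist_real_def)
qed

text \<open>A Lyapunov argument: from a regular \<open>q\<close> unit time leads strictly below
  \<open>u q\<close>, and by continuity this is so from all nearby points, among them points of the
  trajectory.\<close>

lemma limit_point_critical:
  assumes x: "x \<in> regular" and q: "limit_point x q" "q \<in> closure \<Omega>"
  shows "grad u q = 0"
proof (rule ccontr)
  assume "grad u q \<noteq> 0"
  then have qr: "q \<in> regular" using q by (simp add: regular_def)
  have less: "u (\<phi> 1 q) < u q" using u_flow_decreasing[OF qr, of 0 1] flow by simp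
  have "open {y \<in> \<phi> 1 -` V. u (\<phi> 1 y) < u q}"
  proof -
    have o: "open (\<phi> 1 -` V)" using flow_continuous[of 1 UNIV] open_nbhd by (auto intro: open_vimage)
    have "continuous_on (\<phi> 1 -` V) (\<lambda>y. u (\<phi> 1 y))"
      by (rule continuous_on_compose2[OF continuous_on_u[OF order_refl] flow_continuous]) auto
    from continuous_open_preimage[OF this o, of "{..<u q}"]
    have "open (\<phi> 1 -` V \<inter> (\<lambda>y. u (\<phi> 1 y)) -` {..<u q})" by simp
    also have "\<phi> 1 -` V \<inter> (\<lambda>y. u (\<phi> 1 y)) -` {..<u q} = {y \<in> \<phi> 1 -` V. u (\<phi> 1 y) < u q}" by auto
    finally show ?thesis .
  qed
  moreover have "q \<in> {y \<in> \<phi> 1 -` V. u (\<phi> 1 y) < u q}"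
    using less regular_flow(1)[OF qr, of 1] by simp
  ultimately obtain d where d: "0 < d" "\<And>y. dist q y < d \<Longrightarrow> u (\<phi> 1 y) < u q"
    unfolding open_contains_ball by (force simp: subset_iff)
  obtain t where t: "0 \<le> t" "dist (\<phi> t x) q < d" using limit_pointD[OF q(1) d(1)] by metis
  have "u (\<phi> (t + 1) x) < u q"
    using d(2)[of "\<phi> t x"] t flow_add[OF lip flow, of t 1 x] by (simp add: dist_commute)
  then show False using limit_point_u_less[OF x q, of "t + 1"] t by simp
qed

text \<open>Without convergence the trajectory would cross a small sphere around \<open>q\<close> at
  arbitrarily late times and so have a limit point on it, which would be a second critical point
  close to \<open>q\<close>.\<close>

lemma isolated_limit_point_tendsto:
  assumes x: "x \<in> regular" "trapped x" and q: "limit_point x q"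
    and iso: "0 < \<epsilon>" "\<And>y. y \<in> ball q \<epsilon> \<Longrightarrow> y \<noteq> q \<Longrightarrow> grad u y \<noteq> 0"
  shows "((\<lambda>t. \<phi> t x) \<longlongrightarrow> q) at_top"
proof (rule ccontr)
  assume "\<not> ?thesis"
  then obtain e0 where e0: "0 < e0" "\<not> (\<forall>\<^sub>F t in at_top. dist (\<phi> t x) q < e0)"
    by (auto simp: tendsto_iff)
  define e where "e = min e0 (\<epsilon> / 2)"
  have e: "0 < e" "e \<le> e0" "e < \<epsilon>" using e0 iso by (auto simp: e_def)
  have "\<exists>s. real n \<le> s \<and> \<phi> s x \<in> sphere q e" for n :: nat
  proof -
    obtain t where t: "real n \<le> t" "e0 \<le> dist (\<phi> t x) q"
      using e0(2) unfolding eventually_at_top_linorder by (meson not_less)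
    obtain t' where t': "t \<le> t'" "dist (\<phi> t' x) q < e" using limit_pointD[OF q e(1)] by metis
    have "continuous_on {t..t'} (\<lambda>t. dist (\<phi> t x) q)"
      by (intro continuous_intros flow_continuous_time) (use t in auto)
    then obtain s where "t \<le> s" "s \<le> t'" "dist (\<phi> s x) q = e"
      using IVT2'[of "\<lambda>t. dist (\<phi> t x) q" t' e t] t t' e by auto
    then show ?thesis using t by (intro exI[of _ s]) (auto simp: dist_commute)
  qed
  then obtain s where s: "\<And>n::nat. real n \<le> s n \<and> \<phi> (s n) x \<in> sphere q e" by metis
  have "compact (sphere q e)" by simp
  from limit_point_compact[OF this s] obtain q' where q': "q' \<in> sphere q e" "limit_point x q'" by blast
  have "grad u q' = 0"
    using limit_point_critical[OF x(1) q'(2)] limit_point_in_closure[OF x(2) q'(2)] by blast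
  moreover have "q' \<in> ball q \<epsilon>" "q' \<noteq> q" using q'(1) e by auto
  ultimately show False using iso(2) by blast
qed

lemma u_isCont: "q \<in> V \<Longrightarrow> isCont u q"
  using continuous_on_u[OF order_refl] open_nbhd by (auto simp: continuous_on_eq_continuous_at)

lemma limit_point_not_max:
  assumes "x \<in> regular" "limit_point x q" "q \<in> closure \<Omega>"
  shows "\<not> (\<forall>\<^sub>F y in nhds q. u y \<le> u q)"
proof
  assume "\<forall>\<^sub>F y in nhds q. u y \<le> u q"
  then obtain d where d: "0 < d" "\<And>y. dist y q < d \<Longrightarrow> u y \<le> u q" unfolding eventually_nhds_metric by blast
  obtain t where "0 \<le> t" "dist (\<phi> t x) q < d" using limit_pointD[OF assms(2) d(1)] by metis
  then show False using d(2) limit_point_u_less[OF assms] by force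
qed

lemma saddle_iff:
  "r \<in> saddle_points \<Omega> u \<longleftrightarrow> r \<in> closure \<Omega> \<and> grad u r = 0 \<and>
     \<not> (\<forall>\<^sub>F y in nhds r. u y \<le> u r) \<and> \<not> (\<forall>\<^sub>F y in nhds r. u r \<le> u y)"
  by (auto simp: saddle_points_def critical_points_def maximum_points_def minimum_points_def)

lemma nonneg_limit_saddle:
  assumes x: "x \<in> regular" "trapped x" and q: "limit_point x q" "0 \<le> u q"
  shows "q \<in> saddle_points \<Omega> u" "x \<in> stable_set \<Omega> u q"
proof -
  have qc: "q \<in> closure \<Omega>" using limit_point_in_closure[OF x(2) q(1)] .
  have g: "grad u q = 0" using limit_point_critical[OF x(1) q(1) qc] .
  have nmax: "\<not> (\<forall>\<^sub>F y in nhds q. u y \<le> u q)" using limit_point_not_max[OF x(1) q(1) qc] .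
  have "(\<exists>\<epsilon>>0. \<forall>y\<in>ball q \<epsilon>. y \<noteq> q \<longrightarrow> grad u y \<noteq> 0) \<and> \<not> (\<forall>\<^sub>F y in nhds q. u q \<le> u y)"
  proof (cases "u q = 0")
    case True
    then show ?thesis using critical_zero[OF qc] by blast
  next
    case False
    then have "0 < u q" using q by simp
    then show ?thesis using critical_pos_cases[OF qc _ g] pos_not_min[OF qc] nmax by blast
  qed
  then obtain \<epsilon> where \<epsilon>: "0 < \<epsilon>" "\<And>y. y \<in> ball q \<epsilon> \<Longrightarrow> y \<noteq> q \<Longrightarrow> grad u y \<noteq> 0"
    and nmin: "\<not> (\<forall>\<^sub>F y in nhds q. u q \<le> u y)" by blast
  show "q \<in> saddle_points \<Omega> u" using saddle_iff qc g nmax nmin by blast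
  show "x \<in> stable_set \<Omega> u q"
    using isolated_limit_point_tendsto[OF x q(1) \<epsilon>] x stable_set_iff[of x q] by (auto simp: regular_def)
qed

text \<open>A critical point in the closure that is not isolated among the critical points is the
  bottom of a valley or a local maximum, hence no saddle.\<close>

lemma saddle_isolated:
  assumes r: "r \<in> saddle_points \<Omega> u"
  shows "\<exists>\<epsilon>>0. \<forall>y\<in>ball r \<epsilon>. y \<noteq> r \<longrightarrow> grad u y \<noteq> 0"
proof -
  have r': "r \<in> closure \<Omega>" "grad u r = 0" "\<not> (\<forall>\<^sub>F y in nhds r. u y \<le> u r)"
    "\<not> (\<forall>\<^sub>F y in nhds r. u r \<le> u y)" using r saddle_iff by auto
  consider "u r = 0" | "u r < 0" | "0 < u r" by linarith
  then show ?thesis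
  proof cases
    case 1
    then show ?thesis using critical_zero[OF r'(1)] by blast
  next
    case 2
    have "\<not> (\<forall>x\<in>ball r \<epsilon>. u r \<le> u x)" if "0 < \<epsilon>" for \<epsilon>
      using r'(4) that unfolding eventually_nhds by (metis centre_in_ball open_ball)
    then show ?thesis using critical_neg_cases[OF r'(1) 2 r'(2)] by blast
  next
    case 3
    then show ?thesis using critical_pos_cases[OF r'(1) 3 r'(2)] r'(3) by blast
  qed
qed

text \<open>Balls of half the isolation radius are pairwise disjoint, and the plane admits only
  countably many disjoint nonempty open sets.\<close>

lemma countable_saddles: "countable (saddle_points \<Omega> u)"
proof -
  obtain \<epsilon> where \<epsilon>: "\<And>r. r \<in> saddle_points \<Omega> u \<Longrightarrow> 0 < \<epsilon> r"
    "\<And>r y. r \<in> saddle_points \<Omega> u \<Longrightarrow> y \<in> ball r (\<epsilon> r) \<Longrightarrow> y \<noteq> r \<Longrightarrow> grad u y \<noteq> 0"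
    using saddle_isolated by metis
  have sep: "\<epsilon> r \<le> dist r s" if "r \<in> saddle_points \<Omega> u" "s \<in> saddle_points \<Omega> u" "r \<noteq> s" for r s
    using \<epsilon>(2)[OF that(1), of s] that saddle_iff by force
  define B where "B = (\<lambda>r. ball r (\<epsilon> r / 2))"
  have disj: "disjnt (B r) (B s)" if "r \<in> saddle_points \<Omega> u" "s \<in> saddle_points \<Omega> u" "r \<noteq> s" for r s
  proof -
    have "False" if "y \<in> B r" "y \<in> B s" for y
      using that sep[of r s] sep[of s r] \<open>r \<in> _\<close> \<open>s \<in> _\<close> \<open>r \<noteq> s\<close> dist_triangle[of r s y]
      by (simp add: B_def dist_commute)
    then show ?thesis by (auto simp: disjnt_def)
  qed
  have "countable (B ` saddle_points \<Omega> u)"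
    by (rule countable_disjoint_open_subsets) (use disj in \<open>auto simp: B_def pairwise_def\<close>)
  moreover have "inj_on B (saddle_points \<Omega> u)"
  proof (rule inj_onI, rule ccontr)
    fix r s assume "r \<in> saddle_points \<Omega> u" "s \<in> saddle_points \<Omega> u" "B r = B s" "r \<noteq> s"
    then show False using disj[of r s] \<epsilon>(1)[of r] \<epsilon>(1)[of s] by (auto simp: disjnt_def B_def)
  qed
  ultimately show ?thesis using countable_image_inj_on by blast
qed

end

section \<open>Fates of trajectories\<close>

context dirichlet_flow
begin

lemma u_flow_open:
  assumes "x \<in> regular" "0 \<le> t" "open W" "\<phi> t x \<in> W" "u (\<phi> t x) < m"
  obtains N where "open N" "x \<in> N" "\<And>y. y \<in> N \<Longrightarrow> \<phi> t y \<in> W \<and> u (\<phi> t y) < m"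
proof -
  have oV: "open (V \<inter> u -` {..<m})"
    using continuous_open_preimage[OF continuous_on_u[OF order_refl] open_nbhd] by simp
  have "open (\<phi> t -` (W \<inter> (V \<inter> u -` {..<m})))"
    using flow_continuous[OF assms(2), of UNIV] assms(3) oV by (intro open_vimage) auto
  then show ?thesis
    using that[of "\<phi> t -` (W \<inter> (V \<inter> u -` {..<m}))"] assms regular_flow(1)[OF assms(1,2)] by auto
qed

text \<open>The sphere is a barrier: \<open>u\<close> is at least \<open>m\<close> on it, but below
  \<open>m\<close> along the trajectory from time \<open>t0\<close> on.\<close>

lemma confined_near_strict_min:
  assumes e: "0 < e" and sph: "\<And>z. z \<in> sphere q e \<Longrightarrow> m \<le> u z"
    and y: "y \<in> regular" and t: "0 \<le> t0" "t0 \<le> t" and start: "\<phi> t0 y \<in> ball q e" "u (\<phi> t0 y) < m"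
  shows "\<phi> t y \<in> ball q e"
proof (rule ccontr)
  assume "\<not> ?thesis"
  then have far: "e \<le> dist (\<phi> t y) q" by (simp add: dist_commute)
  have "continuous_on {t0..t} (\<lambda>t. dist (\<phi> t y) q)"
    by (intro continuous_intros flow_continuous_time) (use t in auto)
  then obtain s where s: "t0 \<le> s" "s \<le> t" "dist (\<phi> s y) q = e"
    using IVT'[of "\<lambda>t. dist (\<phi> t y) q" t0 e t] far t start by (auto simp: dist_commute)
  then have "m \<le> u (\<phi> s y)" by (intro sph) (simp add: dist_commute)
  also have "\<dots> \<le> u (\<phi> t0 y)" using u_flow_antimono[OF y t(1) s(1)] .
  finally show False using start by simp
qed

text \<open>In a valley the gradient inequality bounds the length of the trajectory
  by a multiple of the square root of the height above the bottom.\<close>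

lemma confined_in_valley:
  assumes \<epsilon>: "0 < \<epsilon>" "0 < c" and dom: "ball q \<epsilon> \<subseteq> \<Omega>"
    and val: "\<And>z. z \<in> ball q \<epsilon> \<Longrightarrow> u q \<le> u z \<and> c * (u z - u q) \<le> (norm (grad u z))\<^sup>2"
    and y: "y \<in> regular" and t: "0 \<le> t0" "t0 \<le> t"
    and start: "\<phi> t0 y \<in> ball q (\<epsilon> / 2)" "u (\<phi> t0 y) < u q + c * \<epsilon>\<^sup>2 / 64"
  shows "\<phi> t y \<in> ball q (3 / 4 * \<epsilon>)"
proof (rule ccontr)
  assume "\<not> ?thesis"
  then have far: "3 / 4 * \<epsilon> \<le> dist (\<phi> t y) q" by (simp add: dist_commute)
  let ?d = "\<lambda>s. dist (\<phi> s y) q"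
  have cd: "continuous_on {t0..s} ?d" for s
    by (intro continuous_intros flow_continuous_time) (use t in auto)
  have d0: "?d t0 < \<epsilon> / 2" using start by (simp add: dist_commute)
  \<comment> \<open>The infimum of this compact set is the first time at radius
    \<open>3 / 4 * \<epsilon>\<close>; before it the trajectory stays where the valley inequality
    holds.\<close>
  define T where "T = {t0..t} \<inter> ?d -` {3 / 4 * \<epsilon>}"
  have "closed T" unfolding T_def by (rule continuous_closed_preimage[OF cd]) auto
  then have "compact T" unfolding T_def by (simp add: compact_eq_bounded_closed bounded_Int)
  moreover have "T \<noteq> {}"
    using IVT'[of ?d t0 "3 / 4 * \<epsilon>" t, OF _ far t(2) cd] d0 \<epsilon> by (auto simp: T_def)
  ultimately obtain s where s: "s \<in> T" "\<And>r. r \<in> T \<Longrightarrow> s \<le> r" using compact_attains_inf[of T] by blast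
  then have st: "t0 \<le> s" "s \<le> t" "?d s = 3 / 4 * \<epsilon>" by (auto simp: T_def)
  then have ts: "t0 < s" using d0 \<epsilon> by (cases "t0 = s") auto
  have inside: "?d r < 3 / 4 * \<epsilon>" if r: "t0 \<le> r" "r < s" for r
  proof (rule ccontr)
    assume "\<not> ?thesis"
    then obtain r' where "t0 \<le> r'" "r' \<le> r" "?d r' = 3 / 4 * \<epsilon>"
      using IVT'[of ?d t0 "3 / 4 * \<epsilon>" r, OF _ _ r(1) cd] d0 \<epsilon> by auto
    then have "r' \<in> T" using r st by (auto simp: T_def)
    from s(2)[OF this] show False using \<open>r' \<le> r\<close> r by simp
  qed
  have us: "u q \<le> u (\<phi> s y)" using val[of "\<phi> s y"] st(3) \<epsilon> by (simp add: dist_commute)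
  \<comment> \<open>Differentiating gives \<open>\<psi>'\<close>, and the valley inequality says
    that \<open>\<psi>'\<close> is at least the speed; so the increase of \<psi> bounds the length
    of the path.\<close>
  define \<psi> where "\<psi> = (\<lambda>r. - (2 / sqrt c) * sqrt (u (\<phi> r y) - u q))"
  define \<psi>' where "\<psi>' = (\<lambda>r. (norm (grad u (\<phi> r y)))\<^sup>2 / (sqrt c * sqrt (u (\<phi> r y) - u q)))"
  have "norm (\<phi> s y - \<phi> t0 y) \<le> \<psi> s - \<psi> t0"
  proof (rule differentiable_bound_general[where f'="\<lambda>r. X (\<phi> r y)" and \<phi>'=\<psi>', OF ts])
    show "continuous_on {t0..s} (\<lambda>r. \<phi> r y)" by (rule flow_continuous_time) (use t in auto)
    show "continuous_on {t0..s} \<psi>" unfolding \<psi>_def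
      by (intro continuous_intros u_flow_continuous y) (use t in auto)
    fix r assume r: "t0 < r" "r < s"
    then have r0: "0 < r" using t by simp
    show "((\<lambda>r. \<phi> r y) has_vector_derivative X (\<phi> r y)) (at r)"
      by (rule integral_curve_at[OF flow_curve[OF flow] r0])
    have rb: "\<phi> r y \<in> ball q \<epsilon>" using inside[of r] r \<epsilon> by (simp add: dist_commute)
    have "\<phi> r y \<in> closure \<Omega>" using rb dom closure_subset by blast
    then have X: "norm (X (\<phi> r y)) = norm (grad u (\<phi> r y))" "\<kappa> (\<phi> r y) = 1"
      using X_dom \<kappa>_dom by auto
    have pos: "0 < u (\<phi> r y) - u q" using u_flow_decreasing[OF y _ r(2)] r0 us by simp
    have "(\<psi> has_real_derivative \<psi>' r) (at r)"
      unfolding \<psi>_def \<psi>'_def using pos \<epsilon> X(2)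
      by (auto intro!: derivative_eq_intros u_flow_derivative[OF y r0] simp: field_simps)
    then show "(\<psi> has_vector_derivative \<psi>' r) (at r)"
      by (simp add: has_real_derivative_iff_has_vector_derivative)
    have "sqrt c * sqrt (u (\<phi> r y) - u q) \<le> norm (grad u (\<phi> r y))"
      using real_sqrt_le_mono[OF conjunct2[OF val[OF rb]]] by (simp add: real_sqrt_mult)
    then have "norm (grad u (\<phi> r y)) * (sqrt c * sqrt (u (\<phi> r y) - u q)) \<le> (norm (grad u (\<phi> r y)))\<^sup>2"
      unfolding power2_eq_square by (intro mult_left_mono) auto
    then show "norm (X (\<phi> r y)) \<le> \<psi>' r"
      unfolding X(1) \<psi>'_def using pos \<epsilon> by (simp add: pos_le_divide_eq)
  qed
  also have "\<dots> \<le> 2 / sqrt c * sqrt (u (\<phi> t0 y) - u q)"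
    using us \<epsilon> by (simp add: \<psi>_def)
  \<comment> \<open>The constant 64 is chosen to make this \<open>\<epsilon> / 4\<close>, the gap
    between the radii \<open>\<epsilon> / 2\<close> and \<open>3 / 4 * \<epsilon>\<close>.\<close>
  also have "\<dots> < 2 / sqrt c * (sqrt c * \<epsilon> / 8)"
  proof -
    have "sqrt (u (\<phi> t0 y) - u q) < sqrt (c * \<epsilon>\<^sup>2 / 64)" using start by (intro real_sqrt_less_mono) simp
    also have "\<dots> = sqrt c * \<epsilon> / 8" using \<epsilon> by (simp add: real_sqrt_mult real_sqrt_divide)
    finally show ?thesis using \<epsilon> by (intro mult_strict_left_mono) auto
  qed
  also have "\<dots> = \<epsilon> / 4" using \<epsilon> by simp
  finally have "dist (\<phi> s y) (\<phi> t0 y) < \<epsilon> / 4" by (simp add: dist_norm)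
  then show False using st(3) d0 dist_triangle[of "\<phi> s y" q "\<phi> t0 y"] by linarith
qed

lemma stable_limit_closed:
  assumes "y \<in> regular" "y \<in> stable_set \<Omega> u r" "closed K" "\<And>t. T \<le> t \<Longrightarrow> 0 \<le> t \<Longrightarrow> \<phi> t y \<in> K"
  shows "r \<in> K"
  using assms stable_set_iff[of y r] limit_point_closed[OF tendsto_limit_point assms(3,4)]
  by (auto simp: regular_def)

lemma nonsaddle_limit_avoids_saddles:
  assumes x: "x \<in> regular" "trapped x" and q: "limit_point x q" "u q < 0" "q \<notin> saddle_points \<Omega> u"
  obtains N where "open N" "x \<in> N"
    "\<And>y r. y \<in> N \<Longrightarrow> y \<in> regular \<Longrightarrow> r \<in> saddle_points \<Omega> u \<Longrightarrow> y \<notin> stable_set \<Omega> u r"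
proof -
  have qc: "q \<in> closure \<Omega>" using limit_point_in_closure[OF x(2) q(1)] .
  have g: "grad u q = 0" using limit_point_critical[OF x(1) q(1) qc] .
  have q\<Omega>: "q \<in> \<Omega>" using boundary_zero[OF qc] q(2) by force
  then obtain \<epsilon>0 where \<epsilon>0: "0 < \<epsilon>0" "ball q \<epsilon>0 \<subseteq> \<Omega>" using open_dom open_contains_ball by blast
  have "\<forall>\<^sub>F y in nhds q. u q \<le> u y"
    using q(3) saddle_iff[of q] qc g neg_not_max[OF qc q(2)] by blast
  then obtain \<epsilon>1 where \<epsilon>1: "0 < \<epsilon>1" "\<And>y. dist y q < \<epsilon>1 \<Longrightarrow> u q \<le> u y" unfolding eventually_nhds_metric by blast
  \<comment> \<open>Entry for both cases: some finite time brings \<open>x\<close> close to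
    \<open>q\<close> and below the level \<open>m\<close>, and by continuity at a fixed time all
    points near \<open>x\<close> as well.\<close>
  have start: "\<exists>t0\<ge>0. \<exists>N. open N \<and> x \<in> N \<and> (\<forall>y\<in>N. \<phi> t0 y \<in> ball q e \<and> u (\<phi> t0 y) < m)"
    if em: "0 < e" "u q < m" for e m
  proof -
    have "isCont u q" using u_isCont q\<Omega> dom_subset by blast
    then obtain d where d: "0 < d" "\<And>y. dist y q < d \<Longrightarrow> dist (u y) (u q) < m - u q"
      unfolding continuous_at_eps_delta using em(2) by (metis diff_gt_0_iff_gt)
    obtain t0 where t0: "0 \<le> t0" "dist (\<phi> t0 x) q < min d e"
      using limit_pointD[OF q(1), of "min d e" 0] d(1) em(1) by auto
    then have "\<phi> t0 x \<in> ball q e" "u (\<phi> t0 x) < m"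
      using d(2)[of "\<phi> t0 x"] by (auto simp: dist_commute dist_real_def)
    from u_flow_open[OF x(1) t0(1) open_ball this] t0(1) show ?thesis by metis
  qed
  from critical_neg_cases[OF qc q(2) g] show ?thesis
  proof (elim disjE exE conjE)
    fix \<epsilon> assume \<epsilon>: "0 < \<epsilon>" "\<forall>x\<in>ball q \<epsilon>. x \<noteq> q \<longrightarrow> grad u x \<noteq> 0"
    define e where "e = min \<epsilon> (min \<epsilon>0 \<epsilon>1) / 2"
    have e: "0 < e" "e < \<epsilon>" "e < \<epsilon>0" "e < \<epsilon>1" using \<epsilon> \<epsilon>0 \<epsilon>1 by (auto simp: e_def)
    have sV: "sphere q e \<subseteq> V" using \<epsilon>0 e dom_subset by (force simp: subset_iff)
    have "sphere q e \<noteq> {}" using e by simp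
    then obtain z where z: "z \<in> sphere q e" "\<And>y. y \<in> sphere q e \<Longrightarrow> u z \<le> u y"
      using continuous_attains_inf[OF compact_sphere _ continuous_on_u[OF sV]] by blast
    \<comment> \<open>Otherwise \<open>z\<close> would itself be a local minimum and therefore
      critical, against isolation; so the minimum at \<open>q\<close> is strict on the
      sphere.\<close>
    have "u z \<noteq> u q"
    proof
      assume "u z = u q"
      then have "\<forall>y\<in>ball q \<epsilon>1. u z \<le> u y" using \<epsilon>1(2) by (auto simp: dist_commute)
      moreover have "z \<in> ball q \<epsilon>1" using z(1) e by simp
      ultimately have "(\<bullet>) (grad u z) = (\<lambda>v. 0)"
        using differential_zero_maxmin[OF _ open_ball u_has_derivative, of z q \<epsilon>1] z(1) sV by blast
      from fun_cong[OF this, of "grad u z"] have "grad u z = 0" by simp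
      moreover have "z \<in> ball q \<epsilon>" "z \<noteq> q" using z(1) e by auto
      ultimately show False using \<epsilon>(2) by blast
    qed
    moreover have "u q \<le> u z" using z(1) e by (intro \<epsilon>1(2)) (simp add: dist_commute)
    ultimately have "u q < u z" by simp
    from start[OF e(1) this] obtain t0 N where t0: "0 \<le> t0" and N: "open N" "x \<in> N"
      "\<And>y. y \<in> N \<Longrightarrow> \<phi> t0 y \<in> ball q e \<and> u (\<phi> t0 y) < u z" by blast
    show ?thesis
    proof (rule that[OF N(1,2)], rule notI)
      fix y r assume y: "y \<in> N" "y \<in> regular" and r: "r \<in> saddle_points \<Omega> u" "y \<in> stable_set \<Omega> u r"
      have "\<phi> t y \<in> cball q e" if "t0 \<le> t" for t
        using confined_near_strict_min[of e q "u z", OF e(1) z(2) y(2) t0 that] N(3)[OF y(1)] by auto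
      then have "r \<in> cball q e" by (intro stable_limit_closed[OF y(2) r(2) closed_cball]) auto
      then have "r = q" using \<epsilon>(2) r(1) saddle_iff e by force
      then show False using r(1) q(3) by simp
    qed
  next
    fix \<epsilon> c assume c: "0 < \<epsilon>" "0 < c" "\<forall>x\<in>ball q \<epsilon>. u q \<le> u x \<and> c * (u x - u q) \<le> (norm (grad u x))\<^sup>2"
    define e where "e = min \<epsilon> \<epsilon>0"
    have e: "0 < e" "ball q e \<subseteq> \<Omega>" using c \<epsilon>0 by (auto simp: e_def)
    have val: "u q \<le> u z \<and> c * (u z - u q) \<le> (norm (grad u z))\<^sup>2" if "z \<in> ball q e" for z
      using c(3) that by (auto simp: e_def)
    have "0 < e / 2" "u q < u q + c * e\<^sup>2 / 64" using e c by auto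
    from start[OF this] obtain t0 N where t0: "0 \<le> t0" and N: "open N" "x \<in> N"
      "\<And>y. y \<in> N \<Longrightarrow> \<phi> t0 y \<in> ball q (e / 2) \<and> u (\<phi> t0 y) < u q + c * e\<^sup>2 / 64" by blast
    show ?thesis
    proof (rule that[OF N(1,2)], rule notI)
      fix y r assume y: "y \<in> N" "y \<in> regular" and r: "r \<in> saddle_points \<Omega> u" "y \<in> stable_set \<Omega> u r"
      have "\<phi> t y \<in> cball q (3 / 4 * e)" if "t0 \<le> t" for t
        using confined_in_valley[OF e(1) c(2) e(2) val y(2) t0 that] N(3)[OF y(1)] by auto
      then have "r \<in> cball q (3 / 4 * e)" by (intro stable_limit_closed[OF y(2) r(2) closed_cball]) auto
      then have rb: "r \<in> ball q e" using e by simp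
      \<comment> \<open>By the valley inequality critical points in the valley lie on its bottom;
        they are local minima and hence no saddles.\<close>
      have "c * (u r - u q) \<le> 0" using val[OF rb] r(1) saddle_iff by simp
      then have "u r \<le> u q" using c by (simp add: mult_le_0_iff)
      then have "\<forall>z\<in>ball q e. u r \<le> u z" using val by force
      then have "\<forall>\<^sub>F z in nhds r. u r \<le> u z"
        unfolding eventually_nhds using rb open_ball by blast
      then show False using r(1) saddle_iff by blast
    qed
  qed
qed

text \<open>For \<epsilon> below the isolation radius these sets, over all \<open>n\<close>, exhaust
  the regular part of the stable set of a saddle \<open>r\<close>. Each is closed, the form needed
  for the Baire argument.\<close>

definition stays_near :: "(real^2 \<Rightarrow> real) \<Rightarrow> real^2 \<Rightarrow> nat \<Rightarrow> (real^2) set" where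
  "stays_near \<epsilon> r n =
    {y. (\<forall>t\<ge>0. \<phi> t y \<in> closure \<Omega>) \<and> (\<forall>t\<ge>real n. \<phi> t y \<in> cball r (\<epsilon> r))}"

lemma closed_stays_near: "closed (stays_near \<epsilon> r n)"
proof -
  have "stays_near \<epsilon> r n = (\<Inter>t\<in>{0..}. \<phi> t -` closure \<Omega>) \<inter> (\<Inter>t\<in>{real n..}. \<phi> t -` cball r (\<epsilon> r))"
    by (auto simp: stays_near_def)
  moreover have "closed (\<phi> t -` K)" if "0 \<le> t" "closed K" for t K
    using flow_continuous[OF that(1), of UNIV] that(2) by (intro closed_vimage)
  ultimately show ?thesis by (auto intro!: closed_Int closed_INT)
qed

text \<open>By the Baire category theorem: where the stable sets of the countably many saddles are dense,
  nothing escapes them, since every other fate of a trajectory is stable under perturbation.\<close>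

lemma locally_uniform_fate:
  assumes B: "open B" "B \<noteq> {}" "B \<subseteq> \<Omega>" "B \<subseteq> regular"
  obtains B' where "open B'" "B' \<noteq> {}" "B' \<subseteq> B"
    "\<And>r. r \<in> saddle_points \<Omega> u \<Longrightarrow> B' \<inter> stable_set \<Omega> u r = {} \<or> B' \<subseteq> stable_set \<Omega> u r"
proof (cases "\<exists>B'. open B' \<and> B' \<noteq> {} \<and> B' \<subseteq> B \<and> (\<forall>r\<in>saddle_points \<Omega> u. B' \<inter> stable_set \<Omega> u r = {})")
  case True
  then show ?thesis using that by blast
next
  case False
  then have dense: "\<exists>r\<in>saddle_points \<Omega> u. \<exists>y\<in>W. y \<in> stable_set \<Omega> u r"
    if "open W" "W \<noteq> {}" "W \<subseteq> B" for W using that by blast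
  have all: "\<exists>r\<in>saddle_points \<Omega> u. x \<in> stable_set \<Omega> u r" if xB: "x \<in> B" for x
  proof -
    have xr: "x \<in> regular" using B xB by blast
    \<comment> \<open>Leaving the closure is an open condition, so it would hold on an open set
      without points of stable sets, against density.\<close>
    have "trapped x"
    proof (rule ccontr)
      assume "\<not> trapped x"
      then obtain t where t: "0 \<le> t" "\<phi> t x \<notin> closure \<Omega>" by (auto simp: trapped_def)
      let ?W = "B \<inter> \<phi> t -` (- closure \<Omega>)"
      have "open ?W" using B flow_continuous[OF t(1), of UNIV] by (intro open_Int open_vimage) auto
      moreover have "?W \<noteq> {}" using xB t by blast
      ultimately obtain r y where "y \<in> ?W" "y \<in> stable_set \<Omega> u r" using dense[of ?W] by blast
      then show False using stable_set_iff[of y r] t B(4) by (auto simp: trapped_def regular_def)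
    qed
    then obtain q where q: "q \<in> closure \<Omega>" "limit_point x q" using trapped_limit_point by blast
    show ?thesis
    proof (cases "0 \<le> u q")
      case True
      then show ?thesis using nonneg_limit_saddle[OF xr \<open>trapped x\<close> q(2)] by blast
    next
      case False
      then have uq: "u q < 0" by simp
      have "q \<in> saddle_points \<Omega> u"
      proof (rule ccontr)
        assume "q \<notin> saddle_points \<Omega> u"
        then obtain N where N: "open N" "x \<in> N" "\<And>y r. y \<in> N \<Longrightarrow> y \<in> regular \<Longrightarrow>
            r \<in> saddle_points \<Omega> u \<Longrightarrow> y \<notin> stable_set \<Omega> u r"
          using nonsaddle_limit_avoids_saddles[OF xr \<open>trapped x\<close> q(2) uq] by blast
        have "open (B \<inter> N)" "B \<inter> N \<noteq> {}" using B N xB by auto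
        from dense[OF this] N(3) B(4) show False by blast
      qed
      moreover obtain \<epsilon> where "0 < \<epsilon>" "\<And>y. y \<in> ball q \<epsilon> \<Longrightarrow> y \<noteq> q \<Longrightarrow> grad u y \<noteq> 0"
        using saddle_isolated[OF calculation] by blast
      then have "x \<in> stable_set \<Omega> u q"
        using isolated_limit_point_tendsto[OF xr \<open>trapped x\<close> q(2)] \<open>trapped x\<close> xr
          stable_set_iff[of x q] by (auto simp: regular_def)
      ultimately show ?thesis by blast
    qed
  qed
  obtain \<epsilon>' where \<epsilon>': "\<And>r. r \<in> saddle_points \<Omega> u \<Longrightarrow> 0 < \<epsilon>' r"
    "\<And>r y. r \<in> saddle_points \<Omega> u \<Longrightarrow> y \<in> ball r (\<epsilon>' r) \<Longrightarrow> y \<noteq> r \<Longrightarrow> grad u y \<noteq> 0"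
    using saddle_isolated by metis
  \<comment> \<open>Half of the isolation radius, so that the closed ball contains no critical point
    other than \<open>r\<close>.\<close>
  define \<epsilon> where "\<epsilon> = (\<lambda>r. \<epsilon>' r / 2)"
  have stays_stable: "y \<in> stable_set \<Omega> u r"
    if r: "r \<in> saddle_points \<Omega> u" and y: "y \<in> regular" "y \<in> stays_near \<epsilon> r n" for r y n
  proof -
    have tr: "trapped y" using y by (simp add: stays_near_def trapped_def)
    then obtain q where q: "q \<in> closure \<Omega>" "limit_point y q" using trapped_limit_point by blast
    have "q \<in> cball r (\<epsilon> r)"
      by (rule limit_point_closed[OF q(2) closed_cball, of "real n"]) (use y in \<open>auto simp: stays_near_def\<close>)
    then have "q \<in> ball r (\<epsilon>' r)" using \<epsilon>'(1)[OF r] by (simp add: \<epsilon>_def)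
    then have "q = r" using \<epsilon>'(2)[OF r] limit_point_critical[OF y(1) q(2,1)] by blast
    then show ?thesis
      using isolated_limit_point_tendsto[OF y(1) tr, of r "\<epsilon>' r"] \<epsilon>'[OF r] q tr y(1) stable_set_iff[of y r]
      by (auto simp: regular_def)
  qed
  have stable_stays: "\<exists>n. y \<in> stays_near \<epsilon> r n"
    if r: "r \<in> saddle_points \<Omega> u" and y: "y \<in> regular" "y \<in> stable_set \<Omega> u r" for r y
  proof -
    have *: "trapped y" "((\<lambda>t. \<phi> t y) \<longlongrightarrow> r) at_top"
      using y stable_set_iff[of y r] by (auto simp: regular_def)
    have "0 < \<epsilon> r" using \<epsilon>'(1)[OF r] by (simp add: \<epsilon>_def)
    then obtain T where T: "\<And>t. T \<le> t \<Longrightarrow> dist (\<phi> t y) r < \<epsilon> r"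
      using *(2) unfolding tendsto_iff eventually_at_top_linorder by blast
    obtain n :: nat where "T \<le> real n" using real_arch_simple by blast
    then have "y \<in> stays_near \<epsilon> r n"
      using *(1) T unfolding stays_near_def trapped_def by (fastforce simp: dist_commute less_imp_le)
    then show ?thesis by blast
  qed
  obtain x0 \<rho> where \<rho>: "0 < \<rho>" "cball x0 \<rho> \<subseteq> B" using B(1,2) open_contains_cball by blast
  define S where "S = cball x0 \<rho>"
  define \<G> where "\<G> = (\<lambda>(r, n). S - stays_near \<epsilon> r n) ` (saddle_points \<Omega> u \<times> (UNIV :: nat set))"
  have "\<exists>r\<in>saddle_points \<Omega> u. \<exists>n. \<not> S \<subseteq> closure (S - stays_near \<epsilon> r n)"
  \<comment> \<open>If no closed piece had interior in the ball \<open>S\<close>, their complements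
    would be relatively open and dense, and Baire would provide a point of \<open>S\<close> in no
    stable set.\<close>
  proof (rule ccontr)
    assume nd: "\<not> ?thesis"
    have "S \<subseteq> closure (\<Inter>\<G>)"
    proof (rule Baire)
      show "closed S" by (simp add: S_def)
      show "countable \<G>" unfolding \<G>_def using countable_saddles by (intro countable_image countable_SIGMA) auto
      fix T assume "T \<in> \<G>"
      then obtain r n where T: "T = S - stays_near \<epsilon> r n" "r \<in> saddle_points \<Omega> u" by (auto simp: \<G>_def)
      have "openin (top_of_set S) T"
        unfolding T(1) openin_open using closed_stays_near[of \<epsilon> r n] by (intro exI[of _ "- stays_near \<epsilon> r n"]) auto
      then show "openin (top_of_set S) T \<and> S \<subseteq> closure T" using nd T by blast
    qed
    moreover have "x0 \<in> S" using \<rho> by (simp add: S_def)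
    ultimately have "\<Inter>\<G> \<noteq> {}" by (metis closure_empty empty_iff subsetD)
    then obtain y where y: "y \<in> \<Inter>\<G>" by blast
    \<comment> \<open>At least one saddle must exist: the intersection of an empty family would not
      force \<open>y\<close> into \<open>S\<close>.\<close>
    have "x0 \<in> B" using \<rho> by auto
    from all[OF this] obtain r0 where "r0 \<in> saddle_points \<Omega> u" by blast
    then have "S - stays_near \<epsilon> r0 0 \<in> \<G>" by (auto simp: \<G>_def)
    then have "y \<in> B" using y \<rho> by (auto simp: S_def)
    from all[OF this] obtain r where r: "r \<in> saddle_points \<Omega> u" "y \<in> stable_set \<Omega> u r" by blast
    then obtain n where "y \<in> stays_near \<epsilon> r n" using stable_stays \<open>y \<in> B\<close> B(4) by blast
    moreover have "S - stays_near \<epsilon> r n \<in> \<G>" using r by (auto simp: \<G>_def)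
    ultimately show False using y by blast
  qed
  then obtain r n z where r: "r \<in> saddle_points \<Omega> u" and z: "z \<in> S" "z \<notin> closure (S - stays_near \<epsilon> r n)"
    by blast
  \<comment> \<open>The point \<open>z\<close> may lie on the boundary of the closed ball
    \<open>S\<close>; an open set containing it still meets the open ball, and there every point
    belongs to the closed piece.\<close>
  define B' where "B' = ball x0 \<rho> \<inter> - closure (S - stays_near \<epsilon> r n)"
  have "z \<in> closure (ball x0 \<rho>)" using z \<rho> by (simp add: S_def)
  then have ne: "B' \<noteq> {}"
    using open_Int_closure_eq_empty[of "- closure (S - stays_near \<epsilon> r n)" "ball x0 \<rho>"] z unfolding B'_def by auto
  have oB': "open B'" unfolding B'_def by auto
  have B'B: "B' \<subseteq> B" using \<rho> ball_subset_cball[of x0 \<rho>] unfolding B'_def by blast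
  have sub: "B' \<subseteq> stable_set \<Omega> u r"
  proof
    fix y assume y: "y \<in> B'"
    have "y \<in> S" using y by (auto simp: B'_def S_def)
    moreover have "y \<notin> S - stays_near \<epsilon> r n"
      using y closure_subset[of "S - stays_near \<epsilon> r n"] unfolding B'_def by blast
    ultimately have "y \<in> stays_near \<epsilon> r n" by blast
    then show "y \<in> stable_set \<Omega> u r" using stays_stable[OF r] y B'B B(4) by blast
  qed
  show ?thesis
  proof (rule that[OF oB' ne B'B])
    fix r' assume "r' \<in> saddle_points \<Omega> u"
    show "B' \<inter> stable_set \<Omega> u r' = {} \<or> B' \<subseteq> stable_set \<Omega> u r'"
    proof (cases "r' = r")
      case False
      have "False" if y: "y \<in> B'" "y \<in> stable_set \<Omega> u r'" for y
      proof -
        have "y \<in> closure \<Omega>" using y B'B B(4) by (auto simp: regular_def)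
        then have "((\<lambda>t. \<phi> t y) \<longlongrightarrow> r) at_top" "((\<lambda>t. \<phi> t y) \<longlongrightarrow> r') at_top"
          using y sub stable_set_iff by blast+
        then show False using False tendsto_unique[OF trivial_limit_at_top_linorder] by blast
      qed
      then show ?thesis by blast
    qed (use sub in simp)
  qed
qed

lemma stable_set_u_less:
  assumes "x \<in> regular" "x \<in> stable_set \<Omega> u r"
  shows "u r < u x"
proof -
  have *: "trapped x" "limit_point x r"
    using assms stable_set_iff[of x r] tendsto_limit_point by (auto simp: regular_def)
  show ?thesis
    using limit_point_u_less[OF assms(1) *(2) limit_point_in_closure[OF *], of 0] flow by simp
qed

end

section \<open>Nodal and Neumann domains\<close>

context dirichlet_problem
begin

lemma flow_extends: "\<exists>X \<kappa> L \<phi>. dirichlet_flow \<Omega> V u ev X \<kappa> L \<phi>"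
proof -
  have "closure \<Omega> \<noteq> {}" using nonempty_dom by simp
  obtain X \<kappa> L B where X: "L-lipschitz_on UNIV X" "0 < L" "\<And>x. norm (X x) \<le> B"
    "\<And>x. X x = - (\<kappa> x *\<^sub>R grad u x)" "\<And>x. (0::real) \<le> \<kappa> x" "\<And>x. x \<in> closure \<Omega> \<Longrightarrow> \<kappa> x = 1"
    "\<And>x. \<kappa> x \<noteq> 0 \<Longrightarrow> x \<in> V"
    using cutoff_gradient_field[OF analytic open_nbhd compact_closure_dom \<open>closure \<Omega> \<noteq> {}\<close> closure_dom_subset]
    by metis
  obtain \<phi> where "is_flow X \<phi>" using flow_exists[OF X(1,2,3)] by blast
  with X have "dirichlet_flow \<Omega> V u ev X \<kappa> L \<phi>" by unfold_locales auto
  then show ?thesis by blast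
qed

lemma stable_set_less:
  assumes "x \<in> closure \<Omega>" "grad u x \<noteq> 0" "x \<in> stable_set \<Omega> u r"
  shows "u r < u x"
proof -
  obtain X \<kappa> L \<phi> where "dirichlet_flow \<Omega> V u ev X \<kappa> L \<phi>" using flow_extends by blast
  then interpret dirichlet_flow \<Omega> V u ev X \<kappa> L \<phi> .
  show ?thesis using stable_set_u_less assms by (simp add: regular_def)
qed

section \<open>Time reversal and the symmetry between \<open>u\<close> and
  \<open>- u\<close>\<close>

lemma gradient_curve_reverse:
  assumes "gradient_curve \<Omega> u T x \<gamma>"
  shows "gradient_curve \<Omega> (\<lambda>x. - u x) (uminus ` T) x (\<lambda>t. \<gamma> (- t))"
  unfolding gradient_curve_def
proof (intro conjI ballI)
  show "\<gamma> (- 0) = x" using assms by (simp add: gradient_curve_def)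
  fix t assume "t \<in> uminus ` T"
  then have t: "- t \<in> T" by auto
  then show c: "\<gamma> (- t) \<in> closure \<Omega>" using assms by (simp add: gradient_curve_def)
  have "((\<lambda>t. - t) has_vector_derivative - 1) (at t within uminus ` T)"
    by (auto intro!: derivative_eq_intros)
  moreover have "(\<gamma> has_vector_derivative - grad u (\<gamma> (- t))) (at (- t) within uminus ` uminus ` T)"
    using assms t by (simp add: gradient_curve_def image_image)
  ultimately have "(\<gamma> \<circ> uminus has_vector_derivative - 1 *\<^sub>R - grad u (\<gamma> (- t))) (at t within uminus ` T)"
    by (rule vector_diff_chain_within)
  then show "((\<lambda>t. \<gamma> (- t)) has_vector_derivative - grad (\<lambda>x. - u x) (\<gamma> (- t))) (at t within uminus ` T)"
    by (simp add: grad_neg[OF c] o_def)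
qed

lemma unstable_subset_stable_neg: "unstable_set \<Omega> u r \<subseteq> stable_set \<Omega> (\<lambda>x. - u x) r"
proof
  fix x assume "x \<in> unstable_set \<Omega> u r"
  then obtain \<gamma> where \<gamma>: "x \<in> closure \<Omega>" "gradient_curve \<Omega> u {..0} x \<gamma>" "(\<gamma> \<longlongrightarrow> r) at_bot"
    by (auto simp: unstable_set_def)
  have "gradient_curve \<Omega> (\<lambda>x. - u x) {0..} x (\<lambda>t. \<gamma> (- t))"
    using gradient_curve_reverse[OF \<gamma>(2)] by simp
  moreover have "((\<lambda>t. \<gamma> (- t)) \<longlongrightarrow> r) at_top"
    using \<gamma>(3) by (simp add: filterlim_at_bot_mirror)
  ultimately show "x \<in> stable_set \<Omega> (\<lambda>x. - u x) r" using \<gamma>(1) by (auto simp: stable_set_def)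
qed

lemma stable_subset_unstable_neg: "stable_set \<Omega> u r \<subseteq> unstable_set \<Omega> (\<lambda>x. - u x) r"
proof
  fix x assume "x \<in> stable_set \<Omega> u r"
  then obtain \<gamma> where \<gamma>: "x \<in> closure \<Omega>" "gradient_curve \<Omega> u {0..} x \<gamma>" "(\<gamma> \<longlongrightarrow> r) at_top"
    by (auto simp: stable_set_def)
  have "gradient_curve \<Omega> (\<lambda>x. - u x) {..0} x (\<lambda>t. \<gamma> (- t))"
    using gradient_curve_reverse[OF \<gamma>(2)] by simp
  moreover have "((\<lambda>t. \<gamma> (- t)) \<longlongrightarrow> r) at_bot"
    using \<gamma>(3) by (simp add: filterlim_at_top_mirror)
  ultimately show "x \<in> unstable_set \<Omega> (\<lambda>x. - u x) r" using \<gamma>(1) by (auto simp: unstable_set_def)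
qed

lemma stable_neg: "stable_set \<Omega> (\<lambda>x. - u x) r = unstable_set \<Omega> u r"
proof -
  interpret n: dirichlet_problem \<Omega> V "\<lambda>x. - u x" ev by (rule problem_uminus)
  show ?thesis using unstable_subset_stable_neg n.stable_subset_unstable_neg[of r] by auto
qed

lemma unstable_neg: "unstable_set \<Omega> (\<lambda>x. - u x) r = stable_set \<Omega> u r"
proof -
  interpret n: dirichlet_problem \<Omega> V "\<lambda>x. - u x" ev by (rule problem_uminus)
  show ?thesis using stable_subset_unstable_neg n.unstable_subset_stable_neg[of r] by auto
qed

lemma critical_points_neg: "critical_points \<Omega> (\<lambda>x. - u x) = critical_points \<Omega> u"
  using grad_neg by (auto simp: critical_points_def)

lemma saddle_points_neg: "saddle_points \<Omega> (\<lambda>x. - u x) = saddle_points \<Omega> u"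
  by (auto simp: saddle_points_def maximum_points_def minimum_points_def critical_points_neg)

lemma neumann_domains_neg: "neumann_domains \<Omega> (\<lambda>x. - u x) = neumann_domains \<Omega> u"
  by (simp add: neumann_domains_def neumann_line_set_def saddle_lines_def critical_points_neg
      saddle_points_neg stable_neg unstable_neg Un_commute)

section \<open>Nodal domains and their open subsets off the Neumann line set\<close>

lemma nodal_complement: "\<Omega> - nodal_set \<Omega> u = {x \<in> \<Omega>. u x \<noteq> 0}"
proof -
  have "u x = 0" if "x \<in> \<Omega>" "x \<in> closure {x \<in> \<Omega>. u x = 0}" for x
  proof -
    have "open (\<Omega> \<inter> u -` (- {0}))"
      by (rule continuous_open_preimage[OF continuous_on_u[OF dom_subset] open_dom]) auto
    also have "\<Omega> \<inter> u -` (- {0}) = {x \<in> \<Omega>. u x \<noteq> 0}" by auto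
    finally have "open {x \<in> \<Omega>. u x \<noteq> 0}" .
    moreover have "{x \<in> \<Omega>. u x \<noteq> 0} \<inter> closure {x \<in> \<Omega>. u x = 0} = {}"
      using open_Int_closure_eq_empty[OF calculation] by blast
    ultimately show ?thesis using that by blast
  qed
  then show ?thesis
    using closure_subset[of "{x \<in> \<Omega>. u x = 0}"] unfolding nodal_set_def by blast
qed

lemma open_nodal_complement: "open (\<Omega> - nodal_set \<Omega> u)"
  using open_dom by (auto simp: nodal_set_def)

lemma nodal_domain_subset: "A \<in> nodal_domains \<Omega> u \<Longrightarrow> A \<subseteq> {x \<in> \<Omega>. u x \<noteq> 0}"
  unfolding nodal_domains_def nodal_complement by (rule in_components_subset)

lemma open_nodal_domain: "A \<in> nodal_domains \<Omega> u \<Longrightarrow> open A"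
  unfolding nodal_domains_def by (rule open_components[OF open_nodal_complement])

lemma nodal_domain_nonempty: "A \<in> nodal_domains \<Omega> u \<Longrightarrow> A \<noteq> {}"
  unfolding nodal_domains_def by (rule in_components_nonempty)

lemma nodal_domain_sign:
  assumes A: "A \<in> nodal_domains \<Omega> u" and xy: "x \<in> A" "y \<in> A" "u x < 0"
  shows "u y < 0"
proof (rule ccontr)
  assume "\<not> u y < 0"
  note sub = nodal_domain_subset[OF A]
  have con: "connected A" using A in_components_connected by (auto simp: nodal_domains_def)
  have "connected (u ` A)"
    by (intro connected_continuous_image con continuous_on_u) (use sub dom_subset in auto)
  then have "0 \<in> u ` A" using connectedD_interval[of "u ` A" "u x" "u y" 0] xy \<open>\<not> u y < 0\<close> by auto
  then show False using sub by auto
qed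

text \<open>A gradient vanishing on an open set makes the Laplacian zero there, and with
  \<open>ev > 0\<close> the equation forces \<open>u = 0\<close>.\<close>

lemma critical_points_nowhere_dense:
  assumes "open W" "W \<noteq> {}" "W \<subseteq> \<Omega>" "\<And>x. x \<in> W \<Longrightarrow> u x \<noteq> 0"
  shows "\<exists>x\<in>W. grad u x \<noteq> 0"
proof (rule ccontr)
  assume "\<not> ?thesis"
  then have g: "partial_deriv i u x = 0" if "x \<in> W" for i x
    using that by (auto simp: grad_def vec_eq_iff)
  obtain x where x: "x \<in> W" using assms by blast
  have "partial_deriv i (partial_deriv i u) x = partial_deriv i (\<lambda>_. 0) x" for i
    by (rule partial_deriv_cong[OF assms(1) x]) (rule g)
  moreover have "partial_deriv i (\<lambda>_. 0) x = 0" for i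
    by (simp add: partial_deriv_def frechet_derivative_const)
  ultimately have "laplacian u x = 0" by (simp add: laplacian_def)
  then show False using helmholtz[of x] x assms ev_pos by auto
qed

lemma nodal_domain_meets_neumann_domain:
  assumes A: "A \<in> nodal_domains \<Omega> u"
  shows "\<exists>D\<in>neumann_domains \<Omega> u. D \<inter> A \<noteq> {}"
proof -
  obtain X \<kappa> L \<phi> where "dirichlet_flow \<Omega> V u ev X \<kappa> L \<phi>" using flow_extends by blast
  then interpret f: dirichlet_flow \<Omega> V u ev X \<kappa> L \<phi> .
  interpret n: dirichlet_problem \<Omega> V "\<lambda>x. - u x" ev by (rule problem_uminus)
  obtain X' \<kappa>' L' \<phi>' where "dirichlet_flow \<Omega> V (\<lambda>x. - u x) ev X' \<kappa>' L' \<phi>'" using n.flow_extends by blast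
  then interpret b: dirichlet_flow \<Omega> V "\<lambda>x. - u x" ev X' \<kappa>' L' \<phi>' .
  note oA = open_nodal_domain[OF A] and neA = nodal_domain_nonempty[OF A] and subA = nodal_domain_subset[OF A]
  have A\<Omega>: "A \<subseteq> \<Omega>" using subA by blast
  define B where "B = {x \<in> A. grad u x \<noteq> 0}"
  have "open (A \<inter> grad u -` (- {0}))"
    using A\<Omega> dom_subset oA by (intro continuous_open_preimage continuous_on_grad) auto
  moreover have "A \<inter> grad u -` (- {0}) = B" by (auto simp: B_def)
  ultimately have oB: "open B" by simp
  have neB: "B \<noteq> {}" using critical_points_nowhere_dense[OF oA neA A\<Omega>] subA by (auto simp: B_def)
  have B: "B \<subseteq> \<Omega>" "B \<subseteq> f.regular" "B \<subseteq> b.regular"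
    using A\<Omega> closure_subset[of \<Omega>] grad_neg by (auto simp: B_def f.regular_def b.regular_def)
  obtain B1 where B1: "open B1" "B1 \<noteq> {}" "B1 \<subseteq> B" "\<And>r. r \<in> saddle_points \<Omega> u \<Longrightarrow>
      B1 \<inter> stable_set \<Omega> u r = {} \<or> B1 \<subseteq> stable_set \<Omega> u r"
    using f.locally_uniform_fate[OF oB neB B(1,2)] by metis
  \<comment> \<open>A second refinement, by the flow of \<open>- u\<close>, makes the backward fate
    uniform too; both halves of each \<open>L(r)\<close> then contain \<open>B2\<close> or miss
    it.\<close>
  obtain B2 where B2: "open B2" "B2 \<noteq> {}" "B2 \<subseteq> B1" "\<And>r. r \<in> saddle_points \<Omega> u \<Longrightarrow>
      B2 \<inter> unstable_set \<Omega> u r = {} \<or> B2 \<subseteq> unstable_set \<Omega> u r"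
    using b.locally_uniform_fate[OF B1(1,2)] B1(3) B unfolding saddle_points_neg stable_neg
    by (metis (no_types, lifting) subset_trans)
  \<comment> \<open>An open set contained in a set or disjoint from it does not meet its frontier,
    and being open it also misses the closure of the union of frontiers.\<close>
  have fr: "B2 \<inter> frontier (saddle_lines \<Omega> u r) = {}" if r: "r \<in> saddle_points \<Omega> u" for r
  proof -
    have "B2 \<inter> saddle_lines \<Omega> u r = {} \<or> B2 \<subseteq> saddle_lines \<Omega> u r"
      using B1(4)[OF r] B2(3) B2(4)[OF r] unfolding saddle_lines_def by blast
    then show ?thesis
    proof
      assume "B2 \<inter> saddle_lines \<Omega> u r = {}"
      then have "B2 \<inter> closure (saddle_lines \<Omega> u r) = {}" using open_Int_closure_eq_empty[OF B2(1)] by simp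
      then show ?thesis by (auto simp: frontier_def)
    next
      assume "B2 \<subseteq> saddle_lines \<Omega> u r"
      then have "B2 \<subseteq> interior (saddle_lines \<Omega> u r)" using B2(1) interior_maximal by blast
      then show ?thesis by (auto simp: frontier_def)
    qed
  qed
  have "B2 \<inter> ((\<Union>r\<in>saddle_points \<Omega> u. frontier (saddle_lines \<Omega> u r)) - frontier \<Omega>) = {}" using fr by blast
  then have "B2 \<inter> closure ((\<Union>r\<in>saddle_points \<Omega> u. frontier (saddle_lines \<Omega> u r)) - frontier \<Omega>) = {}"
    using open_Int_closure_eq_empty[OF B2(1)] by blast
  moreover have "B2 \<inter> critical_points \<Omega> u = {}"
    using B2(3) B1(3) by (auto simp: B_def critical_points_def)
  ultimately have "B2 \<inter> neumann_line_set \<Omega> u = {}" unfolding neumann_line_set_def by blast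
  moreover obtain x where x: "x \<in> B2" using B2(2) by blast
  ultimately have "x \<in> \<Omega> - neumann_line_set \<Omega> u" using B2(3) B1(3) B(1) by blast
  then obtain D where "D \<in> neumann_domains \<Omega> u" "x \<in> D"
    unfolding neumann_domains_def by (metis Union_components UnionE)
  moreover have "x \<in> A" using x B2(3) B1(3) by (auto simp: B_def)
  ultimately show ?thesis by blast
qed

end

context dirichlet_flow
begin

text \<open>Stated for both directions, leaving and entering; in either case the connected path has
  to cross the boundary, where \<open>u\<close> vanishes.\<close>

lemma flow_exit:
  assumes "0 \<le> s" "s \<le> t" "\<phi> s x \<in> \<Omega> \<longleftrightarrow> \<phi> t x \<notin> \<Omega>"
  obtains \<tau> where "s \<le> \<tau>" "\<tau> \<le> t" "\<phi> \<tau> x \<in> frontier \<Omega>" "u (\<phi> \<tau> x) = 0"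
proof -
  have "connected ((\<lambda>t. \<phi> t x) ` {s..t})"
    by (intro connected_continuous_image flow_continuous_time) (use assms in auto)
  moreover have "\<phi> s x \<in> (\<lambda>t. \<phi> t x) ` {s..t}" "\<phi> t x \<in> (\<lambda>t. \<phi> t x) ` {s..t}" using assms by auto
  ultimately have "(\<lambda>t. \<phi> t x) ` {s..t} \<inter> frontier \<Omega> \<noteq> {}"
    using connected_Int_frontier[of "(\<lambda>t. \<phi> t x) ` {s..t}" \<Omega>] assms(3) by blast
  then obtain \<tau> where "s \<le> \<tau>" "\<tau> \<le> t" "\<phi> \<tau> x \<in> frontier \<Omega>" by auto
  moreover have "u (\<phi> \<tau> x) = 0"
    using calculation eigen by (auto simp: dirichlet_eigenfunction_def)
  ultimately show ?thesis using that by blast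
qed

text \<open>The boundary of the domain and the nodal set lie at level 0, while \<open>u\<close>
  stays negative along the trajectory; it can cross neither.\<close>

lemma negative_nodal_domain_invariant:
  assumes x: "x \<in> regular" and A: "A \<in> nodal_domains \<Omega> u" "\<phi> s x \<in> A" "u (\<phi> s x) < 0"
    and st: "0 \<le> s" "s \<le> t"
  shows "\<phi> t x \<in> A"
proof -
  note subA = nodal_domain_subset[OF A(1)]
  have neg: "u (\<phi> \<tau> x) < 0" if "s \<le> \<tau>" for \<tau>
    using u_flow_antimono[OF x st(1) that] A(3) by simp
  have "\<phi> \<tau> x \<in> \<Omega>" if \<tau>: "s \<le> \<tau>" for \<tau>
  proof (rule ccontr)
    assume "\<phi> \<tau> x \<notin> \<Omega>"
    then obtain \<sigma> where "s \<le> \<sigma>" "u (\<phi> \<sigma> x) = 0"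
      using flow_exit[OF st(1) \<tau>, of x] subA A(2) by blast
    then show False using neg by force
  qed
  then have "(\<lambda>t. \<phi> t x) ` {s..t} \<subseteq> \<Omega> - nodal_set \<Omega> u"
    unfolding nodal_complement using neg by force
  moreover have "connected ((\<lambda>t. \<phi> t x) ` {s..t})"
    by (intro connected_continuous_image flow_continuous_time) (use st in auto)
  moreover have "A \<inter> (\<lambda>t. \<phi> t x) ` {s..t} \<noteq> {}" using A(2) st by auto
  ultimately have "(\<lambda>t. \<phi> t x) ` {s..t} \<subseteq> A"
    using components_maximal[OF A(1)[unfolded nodal_domains_def]] by blast
  then show ?thesis using st by auto
qed

lemma neumann_domain_meets_one_negative_nodal_domain:
  assumes D: "D \<in> neumann_domains \<Omega> u"
    and A1: "A1 \<in> nodal_domains \<Omega> u" "x1 \<in> D \<inter> A1" "u x1 < 0"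
    and A2: "A2 \<in> nodal_domains \<Omega> u" "x2 \<in> D \<inter> A2" "u x2 < 0"
  shows "A1 = A2"
proof (rule ccontr)
  assume ne: "A1 \<noteq> A2"
  interpret n: dirichlet_problem \<Omega> V "\<lambda>x. - u x" ev by (rule problem_uminus)
  have D\<Omega>: "D \<subseteq> \<Omega> - neumann_line_set \<Omega> u" and conD: "connected D"
    using D in_components_subset in_components_connected by (auto simp: neumann_domains_def)
  have Dreg: "D \<subseteq> regular"
    using D\<Omega> closure_subset[of \<Omega>] by (auto simp: regular_def neumann_line_set_def critical_points_def)
  define Neg where "Neg = {A \<in> nodal_domains \<Omega> u. \<exists>x\<in>A. u x < 0}"
  have Neg: "u x < 0" if "A \<in> Neg" "x \<in> A" for A x
    using that nodal_domain_sign by (auto simp: Neg_def)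
  \<comment> \<open>Points whose trajectory enters \<open>A\<close> at some time; open as a union of
    preimages, one for each time.\<close>
  define E where "E = (\<lambda>A. \<Union>t\<in>{0..}. \<phi> t -` A)"
  have openE: "open (E A)" if "A \<in> nodal_domains \<Omega> u" for A
    unfolding E_def using open_nodal_domain[OF that] flow_continuous[of _ UNIV] by (intro open_UN ballI open_vimage) auto
  define Ext where "Ext = (\<Union>t\<in>{0..}. \<phi> t -` (- closure \<Omega>))"
  have openExt: "open Ext"
    unfolding Ext_def using flow_continuous[of _ UNIV] by (intro open_UN ballI open_vimage) auto
  have disjE: "A = A'" if x: "x \<in> D" "A \<in> Neg" "A' \<in> Neg" "x \<in> E A" "x \<in> E A'" for x A A'
  proof -
    obtain s s' where s: "0 \<le> s" "\<phi> s x \<in> A" "0 \<le> s'" "\<phi> s' x \<in> A'" using x(4,5) by (auto simp: E_def)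
    have xr: "x \<in> regular" using x(1) Dreg by blast
    have nod: "A \<in> nodal_domains \<Omega> u" "A' \<in> nodal_domains \<Omega> u" using x(2,3) by (auto simp: Neg_def)
    have "\<phi> (max s s') x \<in> A"
      using negative_nodal_domain_invariant[OF xr nod(1) s(2) Neg[OF x(2) s(2)] s(1)] by simp
    moreover have "\<phi> (max s s') x \<in> A'"
      using negative_nodal_domain_invariant[OF xr nod(2) s(4) Neg[OF x(3) s(4)] s(3)] by simp
    ultimately show ?thesis
      using components_nonoverlap[OF nod[unfolded nodal_domains_def]] by blast
  qed
  have disjExt: "False" if x: "x \<in> D" and A: "A \<in> Neg" "x \<in> E A" and ext: "x \<in> Ext" for x A
  proof -
    obtain s where s: "0 \<le> s" "\<phi> s x \<in> A" using A by (auto simp: E_def)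
    obtain t where t: "0 \<le> t" "\<phi> t x \<notin> closure \<Omega>" using ext by (auto simp: Ext_def)
    have xr: "x \<in> regular" using x Dreg by blast
    have tn: "\<phi> t x \<notin> \<Omega>" using t closure_subset by blast
    have A\<Omega>: "A \<subseteq> \<Omega>" using nodal_domain_subset A by (auto simp: Neg_def)
    show False
    proof (cases "s \<le> t")
      case True
      have "A \<in> nodal_domains \<Omega> u" using A(1) by (simp add: Neg_def)
      from negative_nodal_domain_invariant[OF xr this s(2) Neg[OF A(1) s(2)] s(1) True] A\<Omega> tn
      show False by blast
    next
      case False
      then have ts: "t \<le> s" by simp
      \<comment> \<open>A trajectory that leaves and returns would meet the boundary at two
        different times, both at level 0, against strict decrease. The times differ because at
        \<open>t\<close> the trajectory is off the closure.\<close>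
      have "\<phi> 0 x \<in> \<Omega>" using x D\<Omega> flow by auto
      then obtain \<tau> where \<tau>: "0 \<le> \<tau>" "\<tau> \<le> t" "\<phi> \<tau> x \<in> frontier \<Omega>" "u (\<phi> \<tau> x) = 0"
        using flow_exit[OF order_refl t(1), of x] tn by blast
      obtain \<sigma> where \<sigma>: "t \<le> \<sigma>" "\<sigma> \<le> s" "\<phi> \<sigma> x \<in> frontier \<Omega>" "u (\<phi> \<sigma> x) = 0"
        using flow_exit[OF t(1) ts, of x] tn s A\<Omega> by blast
      have "\<tau> \<noteq> t" using \<tau>(3) t(2) by (auto simp: frontier_def)
      then have "\<tau> < \<sigma>" using \<tau> \<sigma> by simp
      from u_flow_decreasing[OF xr \<tau>(1) this] show False using \<tau> \<sigma> by simp
    qed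
  qed
  \<comment> \<open>Rules out the third fate. The negative point \<open>x1\<close> of
    \<open>D\<close> is essential here: a domain inside \<open>L(r)\<close> with
    \<open>u > u r\<close> everywhere would otherwise be possible.\<close>
  have cover: "x \<in> Ext \<or> (\<exists>A\<in>Neg. x \<in> E A)" if x: "x \<in> D" for x
  proof (rule ccontr)
    assume no: "\<not> ?thesis"
    have xr: "x \<in> regular" using x Dreg by blast
    have tr: "trapped x" using no by (auto simp: trapped_def Ext_def)
    have pos: "0 \<le> u (\<phi> t x)" if t: "0 \<le> t" for t
    proof (rule ccontr)
      assume "\<not> 0 \<le> u (\<phi> t x)"
      then have un: "u (\<phi> t x) < 0" by simp
      have "\<phi> t x \<in> \<Omega>" using tr t un boundary_zero[of "\<phi> t x"] by (force simp: trapped_def)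
      then have "\<phi> t x \<in> \<Omega> - nodal_set \<Omega> u" unfolding nodal_complement using un by simp
      then obtain A where "A \<in> nodal_domains \<Omega> u" "\<phi> t x \<in> A"
        unfolding nodal_domains_def by (metis Union_components UnionE)
      then show False using no un t by (auto simp: Neg_def E_def)
    qed
    obtain r where r: "r \<in> closure \<Omega>" "limit_point x r" using trapped_limit_point[OF tr] by blast
    have "0 \<le> u r"
    proof (rule ccontr)
      assume "\<not> 0 \<le> u r"
      have "isCont u r" using u_isCont r closure_dom_subset by blast
      then obtain d where d: "0 < d" "\<And>y. dist y r < d \<Longrightarrow> dist (u y) (u r) < - u r"
        unfolding continuous_at_eps_delta using \<open>\<not> 0 \<le> u r\<close> by (metis neg_0_less_iff_less not_le)
      obtain t where "0 \<le> t" "dist (\<phi> t x) r < d" using limit_pointD[OF r(2) d(1)] by metis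
      then show False using d(2) pos by (force simp: dist_real_def)
    qed
    note sad = nonneg_limit_saddle[OF xr tr r(2) this]
    have "D \<inter> frontier (saddle_lines \<Omega> u r) = {}"
    proof -
      have "D \<inter> frontier \<Omega> = {}" using D\<Omega> open_dom by (auto simp: frontier_def interior_open)
      moreover have "frontier (saddle_lines \<Omega> u r) - frontier \<Omega> \<subseteq> neumann_line_set \<Omega> u"
        unfolding neumann_line_set_def using sad(1)
          closure_subset[of "(\<Union>r\<in>saddle_points \<Omega> u. frontier (saddle_lines \<Omega> u r)) - frontier \<Omega>"] by blast
      ultimately show ?thesis using D\<Omega> by blast
    qed
    moreover have "x \<in> D \<inter> saddle_lines \<Omega> u r" using x sad(2) by (auto simp: saddle_lines_def)
    \<comment> \<open>A connected set that meets \<open>L(r)\<close> but not its frontier lies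
      inside \<open>L(r)\<close>.\<close>
    ultimately have DL: "D \<subseteq> saddle_lines \<Omega> u r" using connected_Int_frontier[OF conD] by blast
    \<comment> \<open>On the stable part \<open>u\<close> is above \<open>u r\<close>, on the
      unstable part below; as \<open>u\<close> passes from \<open>u x1 < u r\<close> to
      \<open>u x > u r\<close> on the connected \<open>D\<close>, the level would have to be
      attained.\<close>
    have no_level: "u y \<noteq> u r" if y: "y \<in> D" for y
    proof -
      have yc: "y \<in> closure \<Omega>" "grad u y \<noteq> 0" using y Dreg by (auto simp: regular_def)
      consider "y \<in> stable_set \<Omega> u r" | "y \<in> stable_set \<Omega> (\<lambda>x. - u x) r"
        using DL y by (auto simp: saddle_lines_def stable_neg)
      then show ?thesis
      proof cases
        case 1
        then show ?thesis using stable_set_less[OF yc] by force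
      next
        case 2
        then show ?thesis using n.stable_set_less[OF yc(1) _ 2] yc(2) grad_neg[OF yc(1)] by simp
      qed
    qed
    moreover have "u r < u x" using stable_set_u_less[OF xr sad(2)] .
    moreover have "u x1 < u r" using A1 \<open>0 \<le> u r\<close> by simp
    moreover have "connected (u ` D)"
      by (intro connected_continuous_image conD continuous_on_u) (use D\<Omega> dom_subset in auto)
    then have "u r \<in> u ` D"
      using connectedD_interval[of "u ` D" "u x1" "u x" "u r"] x A1 \<open>u r < u x\<close> \<open>u x1 < u r\<close> by auto
    ultimately show False using no_level by (metis imageE)
  qed
  have N: "A1 \<in> Neg" "A2 \<in> Neg" using A1 A2 by (auto simp: Neg_def)
  have inE: "x1 \<in> E A1" "x2 \<in> E A2" using A1 A2 flow by (auto simp: E_def intro!: bexI[of _ 0])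
  \<comment> \<open>The fates other than entering \<open>A1\<close>. They form an open set that is
    disjoint from \<open>E A1\<close> within \<open>D\<close> and contains \<open>x2\<close>, so
    \<open>D\<close> would be disconnected.\<close>
  let ?R = "Ext \<union> (\<Union>A\<in>Neg - {A1}. E A)"
  have "open ?R" using openExt openE by (auto simp: Neg_def)
  moreover have "open (E A1)" using openE A1 by blast
  moreover have "D \<subseteq> E A1 \<union> ?R" using cover by blast
  moreover have "E A1 \<inter> ?R \<inter> D = {}" using disjE disjExt N by blast
  moreover have "E A1 \<inter> D \<noteq> {}" using inE A1 by blast
  moreover have "?R \<inter> D \<noteq> {}" using inE A2 N ne by blast
  ultimately show False using connectedD[OF conD, of "E A1" ?R] by blast
qed

end

section \<open>Counting the domains of each sign\<close>

context dirichlet_problem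
begin

definition meeting_domain :: "(real^2) set \<Rightarrow> (real^2) set" where
  "meeting_domain A = (SOME D. D \<in> neumann_domains \<Omega> u \<and> D \<inter> A \<noteq> {})"

lemma meeting_domain:
  assumes "A \<in> nodal_domains \<Omega> u"
  shows "meeting_domain A \<in> neumann_domains \<Omega> u" "meeting_domain A \<inter> A \<noteq> {}"
proof -
  have "\<exists>D. D \<in> neumann_domains \<Omega> u \<and> D \<inter> A \<noteq> {}" using nodal_domain_meets_neumann_domain[OF assms] by blast
  from someI_ex[OF this] show "meeting_domain A \<in> neumann_domains \<Omega> u" "meeting_domain A \<inter> A \<noteq> {}"
    unfolding meeting_domain_def by auto
qed

lemma inj_meeting_domain:
  shows "inj_on meeting_domain {A \<in> nodal_domains \<Omega> u. \<exists>x\<in>A. u x < 0}"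
proof (rule inj_onI)
  obtain X \<kappa> L \<phi> where "dirichlet_flow \<Omega> V u ev X \<kappa> L \<phi>" using flow_extends by blast
  then interpret dirichlet_flow \<Omega> V u ev X \<kappa> L \<phi> .
  fix A B assume A: "A \<in> {A \<in> nodal_domains \<Omega> u. \<exists>x\<in>A. u x < 0}"
    and B: "B \<in> {A \<in> nodal_domains \<Omega> u. \<exists>x\<in>A. u x < 0}" and eq: "meeting_domain A = meeting_domain B"
  obtain x y where xy: "x \<in> meeting_domain A \<inter> A" "y \<in> meeting_domain A \<inter> B"
    using meeting_domain(2)[of A] meeting_domain(2)[of B] A B eq by auto
  have "u x < 0" "u y < 0" using nodal_domain_sign A B xy by auto
  then show "A = B"
    using neumann_domain_meets_one_negative_nodal_domain[OF meeting_domain(1)[of A]] A B xy by blast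
qed

lemma nodal_set_neg: "nodal_set \<Omega> (\<lambda>x. - u x) = nodal_set \<Omega> u"
  by (simp add: nodal_set_def)

lemma card_negative_nodal_domains:
  assumes "finite (neumann_domains \<Omega> u)"
  shows "finite {A \<in> nodal_domains \<Omega> u. \<exists>x\<in>A. u x < 0}"
    and "card {A \<in> nodal_domains \<Omega> u. \<exists>x\<in>A. u x < 0} \<le> card (neumann_domains \<Omega> u)"
proof -
  have sub: "meeting_domain ` {A \<in> nodal_domains \<Omega> u. \<exists>x\<in>A. u x < 0} \<subseteq> neumann_domains \<Omega> u"
    using meeting_domain(1) by auto
  show "finite {A \<in> nodal_domains \<Omega> u. \<exists>x\<in>A. u x < 0}"
    using inj_on_finite[OF inj_meeting_domain sub assms] .
  show "card {A \<in> nodal_domains \<Omega> u. \<exists>x\<in>A. u x < 0} \<le> card (neumann_domains \<Omega> u)"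
    using card_inj_on_le[OF inj_meeting_domain sub assms] .
qed

lemma number_of_nodal_domains_le: "number_of (nodal_domains \<Omega> u) \<le> 2 * number_of (neumann_domains \<Omega> u)"
proof (cases "finite (neumann_domains \<Omega> u)")
  case True
  interpret n: dirichlet_problem \<Omega> V "\<lambda>x. - u x" ev by (rule problem_uminus)
  let ?N = "{A \<in> nodal_domains \<Omega> u. \<exists>x\<in>A. u x < 0}"
  let ?P = "{A \<in> nodal_domains \<Omega> u. \<exists>x\<in>A. - u x < 0}"
  have "nodal_domains \<Omega> (\<lambda>x. - u x) = nodal_domains \<Omega> u" by (simp add: nodal_domains_def nodal_set_neg)
  then have P: "finite ?P" "card ?P \<le> card (neumann_domains \<Omega> u)"
    using n.card_negative_nodal_domains True by (simp_all add: neumann_domains_neg)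
  have N: "finite ?N" "card ?N \<le> card (neumann_domains \<Omega> u)"
    using card_negative_nodal_domains[OF True] by auto
  have "A \<in> ?N \<union> ?P" if A: "A \<in> nodal_domains \<Omega> u" for A
  proof -
    obtain x where "x \<in> A" "u x \<noteq> 0"
      using nodal_domain_nonempty[OF A] nodal_domain_subset[OF A] by blast
    then show ?thesis using A by force
  qed
  then have eq: "nodal_domains \<Omega> u = ?N \<union> ?P" by (intro equalityI subsetI) auto
  have "finite (?N \<union> ?P)" using N(1) P(1) by (rule finite_UnI)
  then have "finite (nodal_domains \<Omega> u)" by (simp only: eq[symmetric])
  moreover have "card (nodal_domains \<Omega> u) \<le> 2 * card (neumann_domains \<Omega> u)"
  proof -
    have "card (nodal_domains \<Omega> u) = card (?N \<union> ?P)" by (rule arg_cong[OF eq])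
    also have "\<dots> \<le> card ?N + card ?P" by (rule card_Un_le)
    finally show ?thesis using N(2) P(2) by linarith
  qed
  moreover have "2 * enat k = enat (2 * k)" for k by (metis numeral_eq_enat times_enat_simps(1))
  ultimately show ?thesis using True by (simp add: number_of_def)
next
  case False
  moreover have "2 * \<infinity> = (\<infinity> :: enat)" by (simp add: imult_is_infinity)
  ultimately show ?thesis by (simp add: number_of_def)
qed

end

theorem corollary1p4:
  fixes \<Omega> V :: "(real^2) set" and u :: "real^2 \<Rightarrow> real" and ev :: real
  assumes "open \<Omega>" and "connected \<Omega>" and "\<Omega> \<noteq> {}" and "bounded \<Omega>"
    and "open V" and "closure \<Omega> \<subseteq> V" and "real_analytic_on u V"
    and "dirichlet_eigenfunction \<Omega> ev u"
  shows "2 * number_of (neumann_domains \<Omega> u) \<ge> number_of (nodal_domains \<Omega> u)"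
proof -
  interpret dirichlet_problem \<Omega> V u ev using assms by unfold_locales
  show ?thesis by (rule number_of_nodal_domains_le)
qed

end
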